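(* Let $n\geqslant 3$ and let $L_1^{n+1}$ be a locally symmetric Lorentz space of dimension $n+1$ for which there are constants $c_1,c_2$ such that its sectional curvature $K$ satisfies $K(u,v)=-\frac{c_1}{n}$ for any spacelike vector $u$ and any timelike vector $v$, and $K(u,v)\geqslant c_2$ for any spacelike vectors $u$ and $v$. Assume $c=2c_2+\frac{c_1}{n}>0$. Let $M^n$ be a spacelike hypersurface in $L_1^{n+1}$ with mean curvature $H$ and squared length $S$ of the second fundamental form, and define $P$ by $n(n-1)P=n^2H^2-S$. Suppose that there are $a,b\in\mathbb{R}$ such that $P+aH=b$ on $M^n$ and $(n-1)a^2+4nb\geqslant 0$. Let $L$ be the operator acting on $C^2$-functions $f$ on $M^n$ by $$L(f)=\sum_{i,j}(nH\delta_{ij}-h_{ij})f_{ij}+\frac{(n-1)a}{2}\triangle f .$$ Then $$L(nH)\geqslant|\phi|^2L_{|H|}(|\phi|),$$ where $|\phi|^2=S-nH^2$ and $L_{|H|}(|\phi|)=|\phi|^2-\frac{n(n-2)}{\sqrt{n(n-1)}}|H||\phi|+nc-nH^2$.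
   Context: A Lorentz space $L_1^{n+1}$ is an $(n+1)$-dimensional connected semi-Riemannian manifold of index $1$; it is locally symmetric if its curvature tensor is parallel. The sectional curvature of the nondegenerate plane spanned by $u,v$ is denoted $K(u,v)$. A hypersurface $M^n$ is spacelike if the induced metric is positive definite (a Riemannian metric). With $\{e_1,\dots,e_n\}$ a local orthonormal tangent frame of $M^n$ and $e_{n+1}$ a unit timelike normal, $h_{ij}$ are the components of the second fundamental form, $H=\frac1n\sum_j h_{jj}$ is the mean curvature, and $S=\sum_{i,j}h_{ij}^2$. For a function $f$ on $M^n$, $f_{ij}$ are the components of its Hessian with respect to the induced metric and $\triangle f=\sum_i f_{ii}$. The quantity $|\phi|\geqslant 0$ is the norm of the traceless tensor $\phi_{ij}=h_{ij}-H\delta_{ij}$. *)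

theory Defs
  imports "HOL-Analysis.Analysis"
begin

section \<open>Smooth manifolds\<close>

text \<open>
  \<open>C_k_on k S f\<close> is only used for open \<open>S\<close> in a Euclidean space. There, having differentiable
  iterated directional derivatives of all orders below \<open>k\<close>, those of order \<open>k\<close> being continuous,
  is the same as being of class \<open>C\<^sup>k\<close>.
\<close>

primrec C_k_on ::
  "nat \<Rightarrow> 'a::real_normed_vector set \<Rightarrow> ('a \<Rightarrow> 'b::real_normed_vector) \<Rightarrow> bool" where
  "C_k_on 0 S f \<longleftrightarrow> continuous_on S f"
| "C_k_on (Suc k) S f \<longleftrightarrow>
     (\<forall>x\<in>S. f differentiable (at x)) \<and>
     (\<forall>v. C_k_on k S (\<lambda>x. frechet_derivative f (at x) v))"

definition smooth_on :: "'a::real_normed_vector set \<Rightarrow> ('a \<Rightarrow> 'b::real_normed_vector) \<Rightarrow> bool" where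
  "smooth_on S f \<longleftrightarrow> (\<forall>k. C_k_on k S f)"

text \<open>A chart is a domain together with a coordinate map (whose values off the domain are junk).\<close>

type_synonym ('p, 'e) chart = "'p set \<times> ('p \<Rightarrow> 'e)"

definition chart_image :: "('p, 'e) chart \<Rightarrow> 'e set" where
  "chart_image c = snd c ` fst c"

definition chart_inv :: "('p, 'e) chart \<Rightarrow> 'e \<Rightarrow> 'p" where
  "chart_inv c = inv_into (fst c) (snd c)"

definition is_chart :: "('p::topological_space, 'e::euclidean_space) chart \<Rightarrow> bool" where
  "is_chart c \<longleftrightarrow> open (fst c) \<and> open (chart_image c) \<and>
     homeomorphism (fst c) (chart_image c) (snd c) (chart_inv c)"

definition transition :: "('p, 'e) chart \<Rightarrow> ('p, 'e) chart \<Rightarrow> 'e \<Rightarrow> 'e" where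
  "transition c d = snd d \<circ> chart_inv c"

definition smooth_atlas :: "('p::topological_space, 'e::euclidean_space) chart set \<Rightarrow> bool" where
  "smooth_atlas A \<longleftrightarrow> (\<forall>c\<in>A. is_chart c) \<and>
     (\<forall>c\<in>A. \<forall>d\<in>A. smooth_on (snd c ` (fst c \<inter> fst d)) (transition c d))"

section \<open>Semi-Riemannian manifolds\<close>

text \<open>
  A metric is given by its coordinate expressions: \<open>gten M c x\<close> is the bilinear form on the model
  space that represents the metric in the chart \<open>c\<close> at the point with coordinates \<open>x\<close>. Tangent
  vectors at \<open>p\<close> are likewise handled through their coordinate vectors in charts around \<open>p\<close>.
  The point set of the manifold is the union of the chart domains, an open subset of the ambient
  type.
\<close>

record ('p, 'e) semi_riem =
  charts :: "('p, 'e) chart set"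
  gten :: "('p, 'e) chart \<Rightarrow> 'e \<Rightarrow> 'e \<Rightarrow> 'e \<Rightarrow> real"

definition points :: "('p, 'e) semi_riem \<Rightarrow> 'p set" where
  "points M = (\<Union>c\<in>charts M. fst c)"

definition semi_riemannian ::
  "('p::{t2_space, second_countable_topology}, 'e::euclidean_space) semi_riem \<Rightarrow> bool" where
  "semi_riemannian M \<longleftrightarrow> smooth_atlas (charts M) \<and>
     (\<forall>c\<in>charts M.
        (\<forall>x\<in>chart_image c. bilinear (gten M c x) \<and>
           (\<forall>u v. gten M c x u v = gten M c x v u) \<and>
           (\<forall>u. (\<forall>v. gten M c x u v = 0) \<longrightarrow> u = 0)) \<and>
        (\<forall>u v. smooth_on (chart_image c) (\<lambda>x. gten M c x u v))) \<and>
     (\<forall>c\<in>charts M. \<forall>d\<in>charts M. \<forall>p\<in>fst c \<inter> fst d. \<forall>u v.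
        gten M c (snd c p) u v =
          gten M d (snd d p)
            (frechet_derivative (transition c d) (at (snd c p)) u)
            (frechet_derivative (transition c d) (at (snd c p)) v))"

definition form_index :: "('e::euclidean_space \<Rightarrow> 'e \<Rightarrow> real) \<Rightarrow> nat" where
  "form_index B = Max {dim W | W. subspace W \<and> (\<forall>w\<in>W. w \<noteq> 0 \<longrightarrow> B w w < 0)}"

definition lorentz_space ::
  "('p::{t2_space, second_countable_topology}, 'e::euclidean_space) semi_riem \<Rightarrow> bool" where
  "lorentz_space M \<longleftrightarrow> semi_riemannian M \<and> connected (points M) \<and>
     (\<forall>c\<in>charts M. \<forall>x\<in>chart_image c. form_index (gten M c x) = 1)"

definition riemannian ::
  "('p::{t2_space, second_countable_topology}, 'e::euclidean_space) semi_riem \<Rightarrow> bool" where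
  "riemannian M \<longleftrightarrow> semi_riemannian M \<and>
     (\<forall>c\<in>charts M. \<forall>x\<in>chart_image c. \<forall>u. u \<noteq> 0 \<longrightarrow> gten M c x u u > 0)"

text \<open>
  The Levi-Civita connection in a chart, \<open>\<nabla>\<^sub>u v = D\<^sub>u v + christoffel M c x u v\<close>. The Christoffel
  map is determined by the Koszul formula for constant coordinate fields \<open>u\<close>, \<open>v\<close>, \<open>z\<close>.
\<close>

definition christoffel ::
  "('p, 'e::euclidean_space) semi_riem \<Rightarrow> ('p, 'e) chart \<Rightarrow> 'e \<Rightarrow> 'e \<Rightarrow> 'e \<Rightarrow> 'e" where
  "christoffel M c x u v = (THE w. \<forall>z. 2 * gten M c x w z =
       frechet_derivative (\<lambda>y. gten M c y v z) (at x) u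
     + frechet_derivative (\<lambda>y. gten M c y u z) (at x) v
     - frechet_derivative (\<lambda>y. gten M c y u v) (at x) z)"

text \<open>
  Curvature convention: \<open>R(u, v) w = \<nabla>\<^sub>u \<nabla>\<^sub>v w - \<nabla>\<^sub>v \<nabla>\<^sub>u w - \<nabla>\<^bsub>[u, v]\<^esub> w\<close>, evaluated on constant
  coordinate fields. With \<open>K(u, v) = g(R(u, v) v, u) / (g(u, u) g(v, v) - g(u, v)\<^sup>2)\<close> the unit sphere
  and the unit de Sitter space have \<open>K = 1\<close>.
\<close>

definition curv ::
  "('p, 'e::euclidean_space) semi_riem \<Rightarrow> ('p, 'e) chart \<Rightarrow> 'e \<Rightarrow> 'e \<Rightarrow> 'e \<Rightarrow> 'e \<Rightarrow> 'e" where
  "curv M c x u v w =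
       frechet_derivative (\<lambda>y. christoffel M c y v w) (at x) u
     - frechet_derivative (\<lambda>y. christoffel M c y u w) (at x) v
     + christoffel M c x u (christoffel M c x v w)
     - christoffel M c x v (christoffel M c x u w)"

definition nabla_curv ::
  "('p, 'e::euclidean_space) semi_riem \<Rightarrow> ('p, 'e) chart \<Rightarrow> 'e \<Rightarrow> 'e \<Rightarrow> 'e \<Rightarrow> 'e \<Rightarrow> 'e \<Rightarrow> 'e" where
  "nabla_curv M c x z u v w =
       frechet_derivative (\<lambda>y. curv M c y u v w) (at x) z
     + christoffel M c x z (curv M c x u v w)
     - curv M c x (christoffel M c x z u) v w
     - curv M c x u (christoffel M c x z v) w
     - curv M c x u v (christoffel M c x z w)"

definition locally_symmetric :: "('p, 'e::euclidean_space) semi_riem \<Rightarrow> bool" where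
  "locally_symmetric M \<longleftrightarrow>
     (\<forall>c\<in>charts M. \<forall>x\<in>chart_image c. \<forall>z u v w. nabla_curv M c x z u v w = 0)"

definition spacelike ::
  "('p, 'e::euclidean_space) semi_riem \<Rightarrow> ('p, 'e) chart \<Rightarrow> 'e \<Rightarrow> 'e \<Rightarrow> bool" where
  "spacelike M c x u \<longleftrightarrow> gten M c x u u > 0"

definition timelike ::
  "('p, 'e::euclidean_space) semi_riem \<Rightarrow> ('p, 'e) chart \<Rightarrow> 'e \<Rightarrow> 'e \<Rightarrow> bool" where
  "timelike M c x u \<longleftrightarrow> gten M c x u u < 0"

definition plane_disc ::
  "('p, 'e::euclidean_space) semi_riem \<Rightarrow> ('p, 'e) chart \<Rightarrow> 'e \<Rightarrow> 'e \<Rightarrow> 'e \<Rightarrow> real" where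
  "plane_disc M c x u v = gten M c x u u * gten M c x v v - (gten M c x u v)\<^sup>2"

text \<open>
  \<open>plane_disc M c x u v \<noteq> 0\<close> says that \<open>u\<close> and \<open>v\<close> are linearly independent and span a nondegenerate
  plane.
\<close>

definition nondeg_plane ::
  "('p, 'e::euclidean_space) semi_riem \<Rightarrow> ('p, 'e) chart \<Rightarrow> 'e \<Rightarrow> 'e \<Rightarrow> 'e \<Rightarrow> bool" where
  "nondeg_plane M c x u v \<longleftrightarrow> plane_disc M c x u v \<noteq> 0"

definition sec_curv ::
  "('p, 'e::euclidean_space) semi_riem \<Rightarrow> ('p, 'e) chart \<Rightarrow> 'e \<Rightarrow> 'e \<Rightarrow> 'e \<Rightarrow> real" where
  "sec_curv M c x u v = gten M c x (curv M c x u v v) u / plane_disc M c x u v"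

section \<open>Spacelike hypersurfaces\<close>

definition local_rep ::
  "('p, 'a) chart \<Rightarrow> ('q, 'b) chart \<Rightarrow> ('p \<Rightarrow> 'q) \<Rightarrow> 'a \<Rightarrow> 'b" where
  "local_rep c d F = snd d \<circ> F \<circ> chart_inv c"

definition smooth_map ::
  "('p::topological_space, 'a::euclidean_space) semi_riem \<Rightarrow>
   ('q::topological_space, 'b::euclidean_space) semi_riem \<Rightarrow> ('p \<Rightarrow> 'q) \<Rightarrow> bool" where
  "smooth_map M L F \<longleftrightarrow> F ` points M \<subseteq> points L \<and> continuous_on (points M) F \<and>
     (\<forall>c\<in>charts M. \<forall>d\<in>charts L.
        smooth_on (snd c ` (fst c \<inter> F -` fst d)) (local_rep c d F))"

text \<open>
  \<open>M\<close> carries the metric induced by \<open>F\<close> and this metric is Riemannian. Since it is positive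
  definite, the differential of \<open>F\<close> is automatically injective, so \<open>F\<close> is an immersion.
\<close>

definition spacelike_hypersurface ::
  "('p::{t2_space, second_countable_topology}, 'a::euclidean_space) semi_riem \<Rightarrow>
   ('q::{t2_space, second_countable_topology}, 'b::euclidean_space) semi_riem \<Rightarrow>
   ('p \<Rightarrow> 'q) \<Rightarrow> bool" where
  "spacelike_hypersurface M L F \<longleftrightarrow>
     DIM('b) = DIM('a) + 1 \<and> riemannian M \<and> smooth_map M L F \<and>
     (\<forall>c\<in>charts M. \<forall>d\<in>charts L. \<forall>p\<in>fst c \<inter> F -` fst d. \<forall>u v.
        gten M c (snd c p) u v =
          gten L d (snd d (F p))
            (frechet_derivative (local_rep c d F) (at (snd c p)) u)
            (frechet_derivative (local_rep c d F) (at (snd c p)) v))"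

text \<open>
  A smooth timelike unit normal field along \<open>F\<close> on an open set \<open>U\<close>; \<open>N d p\<close> is the coordinate
  vector in the chart \<open>d\<close> of a tangent vector of \<open>L\<close> at \<open>F p\<close>.
\<close>

definition unit_normal ::
  "('p::topological_space, 'a::euclidean_space) semi_riem \<Rightarrow>
   ('q::topological_space, 'b::euclidean_space) semi_riem \<Rightarrow>
   ('p \<Rightarrow> 'q) \<Rightarrow> 'p set \<Rightarrow> (('q, 'b) chart \<Rightarrow> 'p \<Rightarrow> 'b) \<Rightarrow> bool" where
  "unit_normal M L F U N \<longleftrightarrow>
     (\<forall>d\<in>charts L. \<forall>d'\<in>charts L. \<forall>p\<in>U. F p \<in> fst d \<inter> fst d' \<longrightarrow>
        N d' p = frechet_derivative (transition d d') (at (snd d (F p))) (N d p)) \<and>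
     (\<forall>c\<in>charts M. \<forall>d\<in>charts L.
        smooth_on (snd c ` (fst c \<inter> U \<inter> F -` fst d)) (\<lambda>x. N d (chart_inv c x)) \<and>
        (\<forall>p\<in>fst c \<inter> U \<inter> F -` fst d.
           gten L d (snd d (F p)) (N d p) (N d p) = -1 \<and>
           (\<forall>u. gten L d (snd d (F p)) (N d p)
                  (frechet_derivative (local_rep c d F) (at (snd c p)) u) = 0)))"

text \<open>
  The pointwise quantities below are independent of the chart and of the orthonormal frame, so both
  are chosen arbitrarily at each point.
\<close>

definition chart_at :: "('p, 'e) semi_riem \<Rightarrow> 'p \<Rightarrow> ('p, 'e) chart" where
  "chart_at M p = (SOME c. c \<in> charts M \<and> p \<in> fst c)"

definition orthonormal_frame ::
  "('p, 'e::euclidean_space) semi_riem \<Rightarrow> 'p \<Rightarrow> (nat \<Rightarrow> 'e) \<Rightarrow> bool" where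
  "orthonormal_frame M p e \<longleftrightarrow>
     (\<forall>i<DIM('e). \<forall>j<DIM('e).
        gten M (chart_at M p) (snd (chart_at M p) p) (e i) (e j) = (if i = j then 1 else 0))"

definition frame :: "('p, 'e::euclidean_space) semi_riem \<Rightarrow> 'p \<Rightarrow> nat \<Rightarrow> 'e" where
  "frame M p = (SOME e. orthonormal_frame M p e)"

text \<open>
  The second fundamental form \<open>h(u, v) = g(\<nabla>\<^sub>u dF(v), N)\<close>, the connection being that of \<open>L\<close>;
  \<open>u\<close> and \<open>v\<close> are coordinate vectors of tangent vectors of \<open>M\<close> at \<open>p\<close>. The opposite sign convention
  amounts to replacing \<open>N\<close> by \<open>-N\<close>.
\<close>

definition second_ff ::
  "('p, 'a::euclidean_space) semi_riem \<Rightarrow> ('q, 'b::euclidean_space) semi_riem \<Rightarrow>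
   ('p \<Rightarrow> 'q) \<Rightarrow> (('q, 'b) chart \<Rightarrow> 'p \<Rightarrow> 'b) \<Rightarrow> 'p \<Rightarrow> 'a \<Rightarrow> 'a \<Rightarrow> real" where
  "second_ff M L F N p u v =
    (let c = chart_at M p; d = chart_at L (F p); x = snd c p; y = snd d (F p);
         DF = (\<lambda>z w. frechet_derivative (local_rep c d F) (at z) w)
     in gten L d y
          (frechet_derivative (\<lambda>z. DF z v) (at x) u + christoffel L d y (DF x u) (DF x v))
          (N d p))"

definition h_comp ::
  "('p, 'a::euclidean_space) semi_riem \<Rightarrow> ('q, 'b::euclidean_space) semi_riem \<Rightarrow>
   ('p \<Rightarrow> 'q) \<Rightarrow> (('q, 'b) chart \<Rightarrow> 'p \<Rightarrow> 'b) \<Rightarrow> 'p \<Rightarrow> nat \<Rightarrow> nat \<Rightarrow> real" where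
  "h_comp M L F N p i j = second_ff M L F N p (frame M p i) (frame M p j)"

definition mean_curvature ::
  "('p, 'a::euclidean_space) semi_riem \<Rightarrow> ('q, 'b::euclidean_space) semi_riem \<Rightarrow>
   ('p \<Rightarrow> 'q) \<Rightarrow> (('q, 'b) chart \<Rightarrow> 'p \<Rightarrow> 'b) \<Rightarrow> 'p \<Rightarrow> real" where
  "mean_curvature M L F N p = (\<Sum>j<DIM('a). h_comp M L F N p j j) / real DIM('a)"

definition sq_length ::
  "('p, 'a::euclidean_space) semi_riem \<Rightarrow> ('q, 'b::euclidean_space) semi_riem \<Rightarrow>
   ('p \<Rightarrow> 'q) \<Rightarrow> (('q, 'b) chart \<Rightarrow> 'p \<Rightarrow> 'b) \<Rightarrow> 'p \<Rightarrow> real" where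
  "sq_length M L F N p = (\<Sum>i<DIM('a). \<Sum>j<DIM('a). (h_comp M L F N p i j)\<^sup>2)"

definition phi_comp ::
  "('p, 'a::euclidean_space) semi_riem \<Rightarrow> ('q, 'b::euclidean_space) semi_riem \<Rightarrow>
   ('p \<Rightarrow> 'q) \<Rightarrow> (('q, 'b) chart \<Rightarrow> 'p \<Rightarrow> 'b) \<Rightarrow> 'p \<Rightarrow> nat \<Rightarrow> nat \<Rightarrow> real" where
  "phi_comp M L F N p i j =
     h_comp M L F N p i j - mean_curvature M L F N p * (if i = j then 1 else 0)"

definition phi_norm ::
  "('p, 'a::euclidean_space) semi_riem \<Rightarrow> ('q, 'b::euclidean_space) semi_riem \<Rightarrow>
   ('p \<Rightarrow> 'q) \<Rightarrow> (('q, 'b) chart \<Rightarrow> 'p \<Rightarrow> 'b) \<Rightarrow> 'p \<Rightarrow> real" where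
  "phi_norm M L F N p = sqrt (\<Sum>i<DIM('a). \<Sum>j<DIM('a). (phi_comp M L F N p i j)\<^sup>2)"

lemma phi_norm_squared:
  fixes M :: "('p, 'a::euclidean_space) semi_riem"
  shows "(phi_norm M L F N p)\<^sup>2 =
    sq_length M L F N p - real DIM('a) * (mean_curvature M L F N p)\<^sup>2"
proof -
  let ?n = "DIM('a)" and ?h = "h_comp M L F N p" and ?H = "mean_curvature M L F N p"
  have tr: "(\<Sum>j<?n. ?h j j) = real ?n * ?H"
    by (simp add: mean_curvature_def)
  have entry: "(phi_comp M L F N p i j)\<^sup>2 =
      (?h i j)\<^sup>2 + (if i = j then ?H\<^sup>2 - 2 * ?H * ?h i j else 0)" for i j
    by (simp add: phi_comp_def power2_eq_square algebra_simps)
  have "(phi_norm M L F N p)\<^sup>2 = (\<Sum>i<?n. \<Sum>j<?n. (phi_comp M L F N p i j)\<^sup>2)"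
    by (simp add: phi_norm_def sum_nonneg)
  also have "\<dots> = sq_length M L F N p + (\<Sum>i<?n. ?H\<^sup>2 - 2 * ?H * ?h i i)"
    by (simp add: entry sq_length_def sum.distrib)
  also have "(\<Sum>i<?n. ?H\<^sup>2 - 2 * ?H * ?h i i) = real ?n * ?H\<^sup>2 - 2 * ?H * (\<Sum>i<?n. ?h i i)"
    by (simp add: sum_subtractf sum_distrib_left)
  finally show ?thesis
    by (simp add: tr power2_eq_square)
qed

text \<open>The Hessian and the Laplacian of a function on \<open>M\<close>.\<close>

definition hess ::
  "('p, 'a::euclidean_space) semi_riem \<Rightarrow> ('p \<Rightarrow> real) \<Rightarrow> 'p \<Rightarrow> 'a \<Rightarrow> 'a \<Rightarrow> real" where
  "hess M f p u v =
    (let c = chart_at M p; x = snd c p;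
         Df = (\<lambda>z w. frechet_derivative (f \<circ> chart_inv c) (at z) w)
     in frechet_derivative (\<lambda>z. Df z v) (at x) u - Df x (christoffel M c x u v))"

definition hess_comp ::
  "('p, 'a::euclidean_space) semi_riem \<Rightarrow> ('p \<Rightarrow> real) \<Rightarrow> 'p \<Rightarrow> nat \<Rightarrow> nat \<Rightarrow> real" where
  "hess_comp M f p i j = hess M f p (frame M p i) (frame M p j)"

definition laplacian ::
  "('p, 'a::euclidean_space) semi_riem \<Rightarrow> ('p \<Rightarrow> real) \<Rightarrow> 'p \<Rightarrow> real" where
  "laplacian M f p = (\<Sum>i<DIM('a). hess_comp M f p i i)"

definition L_op ::
  "('p, 'a::euclidean_space) semi_riem \<Rightarrow> ('q, 'b::euclidean_space) semi_riem \<Rightarrow>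
   ('p \<Rightarrow> 'q) \<Rightarrow> (('q, 'b) chart \<Rightarrow> 'p \<Rightarrow> 'b) \<Rightarrow> real \<Rightarrow> ('p \<Rightarrow> real) \<Rightarrow> 'p \<Rightarrow> real" where
  "L_op M L F N a f p =
     (\<Sum>i<DIM('a). \<Sum>j<DIM('a).
        (real DIM('a) * mean_curvature M L F N p * (if i = j then 1 else 0)
           - h_comp M L F N p i j) * hess_comp M f p i j)
     + (real DIM('a) - 1) * a / 2 * laplacian M f p"

definition L_poly :: "nat \<Rightarrow> real \<Rightarrow> real \<Rightarrow> real \<Rightarrow> real" where
  "L_poly n c H x =
     x\<^sup>2 - real n * (real n - 2) / sqrt (real n * (real n - 1)) * \<bar>H\<bar> * x
       + real n * c - real n * H\<^sup>2"

end

theory Submission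
  imports Defs
begin

text \<open>
  Since every indefinite plane has sectional curvature \<open>k = - c1 / n\<close>, polarization shows that the
  whole curvature tensor of the ambient space is that of constant curvature \<open>k\<close>, and then \<open>c \<le> k\<close>.
  The shape operator \<open>A\<close> is therefore a Codazzi tensor, and with the Gauss equation the Ricci identity
  for \<open>A\<close> gives Simons' formula
  \<open>\<Delta>S / 2 = |\<nabla>A|\<^sup>2 + \<Sum> h\<^sub>i\<^sub>j (nH)\<^sub>i\<^sub>j + k (nS - n\<^sup>2H\<^sup>2) + S\<^sup>2 - nH tr A\<^sup>3\<close>.
  Differentiating the relation \<open>S = (nH)\<^sup>2 + (n - 1) a (nH) - n (n - 1) b\<close> twice turns this into
  \<open>L(nH) = |\<nabla>A|\<^sup>2 - n\<^sup>2|\<nabla>H|\<^sup>2 + k (nS - n\<^sup>2H\<^sup>2) + S\<^sup>2 - nH tr A\<^sup>3\<close>.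
  Differentiating it once and using Cauchy-Schwarz and \<open>(n - 1) a\<^sup>2 + 4nb \<ge> 0\<close> gives
  \<open>|\<nabla>A|\<^sup>2 \<ge> n\<^sup>2|\<nabla>H|\<^sup>2\<close> (where this degenerates, \<open>A = 0\<close> and both sides of the claim vanish), and Okumura's
  inequality for the traceless part of \<open>A\<close> bounds the remaining terms from below.
\<close>

section \<open>Calculus of smooth functions\<close>

text \<open>The statement builds H, S and \<open>h_comp\<close> from charts and frames picked
  arbitrarily at each point, which hides their smoothness. The local theory therefore stays in one
  fixed pair of charts with the shape operator A, a smooth field of endomorphisms, and with the
  traces of A and of its square; differentiating a trace needs no moving frame. Frames enter only at
  the single point where the inequality is evaluated, and invariance of the second fundamental form
  identifies the two traces with nH and S around that point. On the constants: spacelike planes have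
  curvature k = - c1 / n as well, so c2 <= k and c = 2 c2 - k <= k. With \<tau> = nH, \<alpha> = (n
  - 1) a and \<beta> = n (n - 1) b the relation reads S = \<tau>^2 + \<alpha> \<tau> - \<beta>, so
  that (2 \<tau> + \<alpha>)^2 - 4 S = \<alpha>^2 + 4 \<beta> = (n - 1) ((n - 1) a^2 + 4 n b) >= 0.
  This is what lets Cauchy-Schwarz, applied to the first derivative 2 <A, \<nabla>A> = (2 \<tau> +
  \<alpha>) d\<tau> of the relation, yield |d\<tau>| <= |\<nabla>A|.\<close>

abbreviation dd :: "('a::real_normed_vector \<Rightarrow> 'b::real_normed_vector) \<Rightarrow> 'a \<Rightarrow> 'a \<Rightarrow> 'b" where
  "dd f x v \<equiv> frechet_derivative f (at x) v"

lemma has_derivative_dd: "f differentiable (at x) \<Longrightarrow> (f has_derivative dd f x) (at x)"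
  by (simp add: frechet_derivative_works)

lemma dd_eq: "(f has_derivative f') (at x) \<Longrightarrow> dd f x v = f' v"
  by (metis frechet_derivative_at)

lemma linear_dd: "f differentiable (at x) \<Longrightarrow> linear (dd f x)"
  by (rule linear_frechet_derivative)

text \<open>f and g have the same derivatives at x, so the choice hidden in
  \<open>frechet_derivative\<close> picks the same map for both, even at a point where no derivative
  exists.\<close>

lemma dd_cong:
  assumes "open S" "x \<in> S" "\<And>y. y \<in> S \<Longrightarrow> f y = g y"
  shows "dd f x v = dd g x v"
proof -
  have "(f has_derivative f') (at x) \<longleftrightarrow> (g has_derivative f') (at x)" for f'
    using has_derivative_transform_within_open[of f f' x UNIV S g]
      has_derivative_transform_within_open[of g f' x UNIV S f] assms by auto
  then show ?thesis by (simp add: frechet_derivative_def)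
qed

lemma differentiable_cong_open:
  assumes "open S" "x \<in> S" "\<And>y. y \<in> S \<Longrightarrow> f y = g y"
  shows "f differentiable (at x) \<longleftrightarrow> g differentiable (at x)"
  using has_derivative_transform_within_open[of f _ x UNIV S g]
      has_derivative_transform_within_open[of g _ x UNIV S f] assms
  unfolding differentiable_def by auto

lemma differentiable_linear:
  "bounded_linear h \<Longrightarrow> f differentiable (at x) \<Longrightarrow> (\<lambda>x. h (f x)) differentiable (at x)"
  unfolding differentiable_def using bounded_linear.has_derivative by blast

text \<open>Linearity in v has to survive differentiation in the base point, so that the derivative
  of a field of linear maps is again such a field.\<close>

lemma linear_dd_param:
  fixes T :: "'a::real_normed_vector \<Rightarrow> 'b::real_vector \<Rightarrow> 'c::real_normed_vector"
  assumes "open S" "x \<in> S" and lin: "\<And>y. y \<in> S \<Longrightarrow> linear (T y)"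
    and T: "\<And>v. (\<lambda>y. T y v) differentiable (at x)"
  shows "linear (\<lambda>v. dd (\<lambda>y. T y v) x u)"
proof (rule linearI)
  have dv: "((\<lambda>y. T y v) has_derivative dd (\<lambda>y. T y v) x) (at x)" for v
    using T by (rule has_derivative_dd)
  show "dd (\<lambda>y. T y (v + v')) x u = dd (\<lambda>y. T y v) x u + dd (\<lambda>y. T y v') x u" for v v'
    using dd_cong[OF assms(1,2), of "\<lambda>y. T y (v + v')" "\<lambda>y. T y v + T y v'" u]
      dd_eq[OF has_derivative_add[OF dv[of v] dv[of v']]] lin by (simp add: linear_add)
  show "dd (\<lambda>y. T y (c *\<^sub>R v)) x u = c *\<^sub>R dd (\<lambda>y. T y v) x u" for v c
    using dd_cong[OF assms(1,2), of "\<lambda>y. T y (c *\<^sub>R v)" "\<lambda>y. c *\<^sub>R T y v" u]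
      dd_eq[OF has_derivative_scaleR_right[OF dv[of v], of c]] lin by (simp add: linear_scale)
qed

section \<open>Closure properties of the classes C^k\<close>

lemma C_k_on_cong:
  assumes "open S" "\<And>y. y \<in> S \<Longrightarrow> f y = g y"
  shows "C_k_on k S f \<longleftrightarrow> C_k_on k S g"
  using assms(2)
proof (induction k arbitrary: f g)
  case 0
  then show ?case by (simp cong: continuous_on_cong)
next
  case (Suc k)
  have "C_k_on k S (\<lambda>x. dd f x v) \<longleftrightarrow> C_k_on k S (\<lambda>x. dd g x v)" for v
    by (rule Suc.IH) (use dd_cong[OF assms(1)] Suc.prems in blast)
  moreover have "f differentiable (at x) \<longleftrightarrow> g differentiable (at x)" if "x \<in> S" for x
    using differentiable_cong_open[OF assms(1) that] Suc.prems by blast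
  ultimately show ?case by simp
qed

lemma C_k_on_subset: "C_k_on k S f \<Longrightarrow> T \<subseteq> S \<Longrightarrow> C_k_on k T f"
  by (induction k arbitrary: f) (auto intro: continuous_on_subset)

lemma C_k_on_SucD: "C_k_on (Suc k) S f \<Longrightarrow> C_k_on k S f"
proof (induction k arbitrary: f)
  case 0
  then show ?case
    by (auto intro!: continuous_at_imp_continuous_on differentiable_imp_continuous_within)
next
  case (Suc k)
  then show ?case using C_k_on.simps(2) by blast
qed

lemma C_k_on_const: "C_k_on k S (\<lambda>x. c)"
  by (induction k arbitrary: c) auto

lemma C_k_on_id: "C_k_on k S (\<lambda>x. x)"
  by (cases k) (auto simp: C_k_on_const)

lemma C_k_on_add:
  assumes "open S" "C_k_on k S f" "C_k_on k S g"
  shows "C_k_on k S (\<lambda>x. f x + g x)"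
  using assms(2,3)
proof (induction k arbitrary: f g)
  case 0
  then show ?case by (simp add: continuous_on_add)
next
  case (Suc k)
  have "C_k_on k S (\<lambda>x. dd (\<lambda>x. f x + g x) x v)" for v
  proof (rule C_k_on_cong[OF assms(1), THEN iffD2])
    show "dd (\<lambda>x. f x + g x) x v = dd f x v + dd g x v" if "x \<in> S" for x
      using Suc.prems that by (auto intro!: dd_eq has_derivative_add has_derivative_dd)
    show "C_k_on k S (\<lambda>x. dd f x v + dd g x v)" using Suc by auto
  qed
  then show ?case using Suc.prems by (auto intro: differentiable_add)
qed

lemma C_k_on_linear:
  assumes "open S" "bounded_linear h" "C_k_on k S f"
  shows "C_k_on k S (\<lambda>x. h (f x))"
  using assms(3)
proof (induction k arbitrary: f)
  case 0
  then show ?case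
    using bounded_linear.continuous_on[OF assms(2)] by simp
next
  case (Suc k)
  have d: "((\<lambda>x. h (f x)) has_derivative (\<lambda>v. h (dd f x v))) (at x)" if "x \<in> S" for x
    using Suc.prems that by (auto intro!: bounded_linear.has_derivative[OF assms(2)] has_derivative_dd)
  have "C_k_on k S (\<lambda>x. dd (\<lambda>x. h (f x)) x v)" for v
    by (rule C_k_on_cong[OF assms(1), where g = "\<lambda>x. h (dd f x v)", THEN iffD2])
       (use Suc in \<open>auto intro!: dd_eq[OF d]\<close>)
  then show ?case using d by (auto intro: differentiableI)
qed

lemma C_k_on_bilinear:
  assumes "open S" "bounded_bilinear h" "C_k_on k S f" "C_k_on k S g"
  shows "C_k_on k S (\<lambda>x. h (f x) (g x))"
  using assms(3,4)
proof (induction k arbitrary: f g)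
  case 0
  then show ?case by (simp add: bounded_bilinear.continuous_on[OF assms(2)])
next
  case (Suc k)
  have d: "((\<lambda>x. h (f x) (g x)) has_derivative (\<lambda>v. h (f x) (dd g x v) + h (dd f x v) (g x))) (at x)"
    if "x \<in> S" for x
    using Suc.prems that by (auto intro!: bounded_bilinear.FDERIV[OF assms(2)] has_derivative_dd)
  have "C_k_on k S (\<lambda>x. h (f x) (dd g x v) + h (dd f x v) (g x))" for v
    using Suc C_k_on_SucD[of k S f] C_k_on_SucD[of k S g] by (intro C_k_on_add[OF assms(1)]) auto
  then have "C_k_on k S (\<lambda>x. dd (\<lambda>x. h (f x) (g x)) x v)" for v
    by (subst C_k_on_cong[OF assms(1), where g = "\<lambda>x. h (f x) (dd g x v) + h (dd f x v) (g x)"])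
       (auto intro!: dd_eq[OF d])
  then show ?case using d by (auto intro: differentiableI)
qed

lemma C_k_on_sum:
  assumes "open S" "\<And>i. i \<in> I \<Longrightarrow> C_k_on k S (f i)"
  shows "C_k_on k S (\<lambda>x. \<Sum>i\<in>I. f i x)"
  using assms(2)
  by (induction I rule: infinite_finite_induct) (auto simp: C_k_on_const intro: C_k_on_add[OF assms(1)])

lemma linear_basis_expansion:
  fixes f :: "'a::euclidean_space \<Rightarrow> 'b::real_vector"
  assumes "linear f" shows "f v = (\<Sum>b\<in>Basis. (v \<bullet> b) *\<^sub>R f b)"
proof -
  have "f v = f (\<Sum>b\<in>Basis. (v \<bullet> b) *\<^sub>R b)" by (simp add: euclidean_representation)
  also have "\<dots> = (\<Sum>b\<in>Basis. (v \<bullet> b) *\<^sub>R f b)"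
    using assms by (simp add: linear_sum linear_scale)
  finally show ?thesis .
qed

text \<open>Expanding the chain rule in a basis turns the derivative of the composition into a
  finite sum of products. Each product has a component of the derivative of f as one factor and a
  partial derivative of g composed with f as the other, to which the induction, with f fixed and g
  arbitrary, applies.\<close>

lemma C_k_on_compose:
  fixes f :: "'a::euclidean_space \<Rightarrow> 'b::euclidean_space"
  assumes "open S" "open T" "f ` S \<subseteq> T" "C_k_on k S f" "C_k_on k T g"
  shows "C_k_on k S (\<lambda>x. g (f x))"
  using assms(4,5)
proof (induction k arbitrary: g)
  case 0
  then show ?case using continuous_on_compose2[of T g S f] assms(3) by auto
next
  case (Suc k)
  have d: "((\<lambda>x. g (f x)) has_derivative (\<lambda>v. dd g (f x) (dd f x v))) (at x)"
    if "x \<in> S" for x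
    using diff_chain_at[of f "dd f x" x g "dd g (f x)"] Suc.prems that assms(3)
    by (auto intro!: has_derivative_dd simp: o_def)
  have e: "dd (\<lambda>x. g (f x)) x v = (\<Sum>b\<in>Basis. (dd f x v \<bullet> b) *\<^sub>R dd g (f x) b)" if "x \<in> S" for x v
  proof -
    have "linear (dd g (f x))" using Suc.prems that assms(3) by (intro linear_dd) auto
    then show ?thesis unfolding dd_eq[OF d[OF that]] by (rule linear_basis_expansion)
  qed
  have fk: "C_k_on k S f" using Suc.prems(1) by (rule C_k_on_SucD)
  have "C_k_on k S (\<lambda>x. (dd f x v \<bullet> b) *\<^sub>R dd g (f x) b)" for b v
    using Suc.prems
    by (intro C_k_on_bilinear[OF assms(1) bounded_bilinear_scaleR]
          C_k_on_linear[OF assms(1) bounded_linear_inner_left] Suc.IH fk) auto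
  then have "C_k_on k S (\<lambda>x. dd (\<lambda>x. g (f x)) x v)" for v
    by (subst C_k_on_cong[OF assms(1) e]) (auto intro!: C_k_on_sum[OF assms(1)])
  then show ?case using d by (auto intro: differentiableI)
qed

text \<open>The product rule for a variable linear map applied to a variable vector.
  Differentiability of T at each fixed vector is enough, since the basis expansion reduces
  everything to finitely many fixed vectors.\<close>

lemma has_derivative_apply:
  fixes w :: "'a::real_normed_vector \<Rightarrow> 'b::euclidean_space"
    and T :: "'a \<Rightarrow> 'b \<Rightarrow> 'c::real_normed_vector"
  assumes "open S" "x \<in> S" "\<And>y. y \<in> S \<Longrightarrow> linear (T y)"
    "\<And>v. (\<lambda>y. T y v) differentiable (at x)" "w differentiable (at x)"
  shows "((\<lambda>y. T y (w y)) has_derivative (\<lambda>u. dd (\<lambda>y. T y (w x)) x u + T x (dd w x u))) (at x)"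
proof -
  have e: "T y v = (\<Sum>b\<in>Basis. (v \<bullet> b) *\<^sub>R T y b)" if "y \<in> S" for y v
    using assms(3)[OF that] by (rule linear_basis_expansion)
  have Db: "((\<lambda>y. T y b) has_derivative dd (\<lambda>y. T y b) x) (at x)" for b
    using assms(4) by (rule has_derivative_dd)
  have "((\<lambda>y. \<Sum>b\<in>Basis. (w y \<bullet> b) *\<^sub>R T y b) has_derivative
      (\<lambda>u. \<Sum>b\<in>Basis. (w x \<bullet> b) *\<^sub>R dd (\<lambda>y. T y b) x u + (dd w x u \<bullet> b) *\<^sub>R T x b)) (at x)"
    by (intro has_derivative_sum has_derivative_scaleR Db
        bounded_linear.has_derivative[OF bounded_linear_inner_left] has_derivative_dd assms(5))
  moreover have "dd (\<lambda>y. T y (w x)) x u = (\<Sum>b\<in>Basis. (w x \<bullet> b) *\<^sub>R dd (\<lambda>y. T y b) x u)" for u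
  proof -
    have d: "((\<lambda>y. \<Sum>b\<in>Basis. (w x \<bullet> b) *\<^sub>R T y b) has_derivative
      (\<lambda>u. \<Sum>b\<in>Basis. (w x \<bullet> b) *\<^sub>R dd (\<lambda>y. T y b) x u)) (at x)"
      by (intro has_derivative_sum has_derivative_scaleR_right Db)
    have "dd (\<lambda>y. T y (w x)) x u = dd (\<lambda>y. \<Sum>b\<in>Basis. (w x \<bullet> b) *\<^sub>R T y b) x u"
      by (rule dd_cong[OF assms(1,2) e])
    then show ?thesis unfolding dd_eq[OF d] .
  qed
  ultimately have "((\<lambda>y. \<Sum>b\<in>Basis. (w y \<bullet> b) *\<^sub>R T y b) has_derivative
      (\<lambda>u. dd (\<lambda>y. T y (w x)) x u + T x (dd w x u))) (at x)"
    by (simp add: sum.distrib e[OF assms(2), of "dd w x _"])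
  then show ?thesis
    by (rule has_derivative_transform_within_open[OF _ assms(1,2)]) (simp add: e)
qed

section \<open>Linear systems with smooth coefficients\<close>

lemma continuous_solve:
  fixes T :: "'a::euclidean_space \<Rightarrow> 'b::euclidean_space \<Rightarrow> 'b"
  assumes "open S" "x0 \<in> S" and lin: "\<And>x. x \<in> S \<Longrightarrow> linear (T x)" and inj: "inj (T x0)"
    and T: "\<And>v. continuous_on S (\<lambda>x. T x v)" and r: "continuous_on S r"
    and sol: "\<And>x. x \<in> S \<Longrightarrow> T x (w x) = r x"
  shows "isCont w x0"
proof -
  \<comment> \<open>Injectivity gives T x0 a lower bound B. Perturbing by less than B / 2 preserves
    the bound B / 2, which then controls w x - w x0 by the residual \<rho>.\<close>
  obtain B where B: "B > 0" "\<And>v. B * norm v \<le> norm (T x0 v)"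
    using linear_inj_bounded_below_pos[OF lin[OF assms(2)] inj] by blast
  define \<sigma> where "\<sigma> x = (\<Sum>b\<in>Basis. norm (T x b - T x0 b))" for x
  have bound: "norm (T x v - T x0 v) \<le> \<sigma> x * norm v" if "x \<in> S" for x v
  proof -
    have "T x v - T x0 v = (\<Sum>b\<in>Basis. (v \<bullet> b) *\<^sub>R (T x b - T x0 b))"
      by (simp add: linear_basis_expansion[OF lin[OF that], of v]
          linear_basis_expansion[OF lin[OF assms(2)], of v] scaleR_diff_right sum_subtractf)
    also have "norm \<dots> \<le> (\<Sum>b\<in>Basis. norm v * norm (T x b - T x0 b))"
      by (rule sum_norm_le) (simp add: Basis_le_norm mult_right_mono)
    finally show ?thesis by (simp add: \<sigma>_def sum_distrib_left mult.commute)
  qed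
  have "isCont \<sigma> x0" unfolding \<sigma>_def
    using T assms(1,2) by (intro continuous_intros) (auto simp: continuous_on_eq_continuous_at)
  then have \<sigma>: "\<sigma> \<midarrow>x0\<rightarrow> 0" by (simp add: isCont_def) (simp add: \<sigma>_def)
  define \<rho> where "\<rho> x = norm (r x - T x (w x0))" for x
  have "isCont \<rho> x0" unfolding \<rho>_def
    using T r assms(1,2) by (intro continuous_intros) (auto simp: continuous_on_eq_continuous_at)
  then have \<rho>: "\<rho> \<midarrow>x0\<rightarrow> 0" using sol[OF assms(2)] by (simp add: isCont_def) (simp add: \<rho>_def)
  have ev: "eventually (\<lambda>x. norm (w x - w x0) \<le> 2 / B * \<rho> x) (at x0)"
  proof -
    have "eventually (\<lambda>x. \<sigma> x < B / 2) (at x0)"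
      using order_tendstoD(2)[OF \<sigma>, of "B/2"] B by simp
    moreover have "eventually (\<lambda>x. x \<in> S) (at x0)"
      using assms(1,2) by (rule eventually_at_in_open')
    ultimately show ?thesis
    proof eventually_elim
      case (elim x)
      let ?d = "w x - w x0"
      have "T x ?d = r x - T x (w x0)" using sol lin elim by (simp add: linear_diff)
      then have "B * norm ?d \<le> \<rho> x + norm (T x ?d - T x0 ?d)"
        using B(2)[of ?d] norm_triangle_sub[of "T x0 ?d" "T x ?d"] unfolding \<rho>_def
        by (simp add: norm_minus_commute)
      also have "\<dots> \<le> \<rho> x + B / 2 * norm ?d"
        using bound[of x ?d] elim by (smt (verit) mult_right_mono norm_ge_zero)
      finally show ?case using B(1) by (simp add: field_simps)
    qed
  qed
  have "((\<lambda>x. w x - w x0) \<longlongrightarrow> 0) (at x0)"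
    by (rule Lim_null_comparison[OF ev]) (use tendsto_mult[OF tendsto_const \<rho>, of "2/B"] in simp)
  then show ?thesis by (simp add: isCont_def LIM_zero_iff)
qed

text \<open>Both factors vanish at x, one of them to first order, so the product is of smaller order
  than the distance to x. The factor \<psi> is merely continuous: below it is a component of the
  solution, whose differentiability is the goal.\<close>

lemma has_derivative_prod_zero:
  fixes \<phi> :: "'a::real_normed_vector \<Rightarrow> real" and \<psi> :: "'a \<Rightarrow> 'b::real_normed_vector"
  assumes "\<phi> differentiable (at x)" "\<phi> x = 0" "isCont \<psi> x" "\<psi> x = 0"
  shows "((\<lambda>y. \<phi> y *\<^sub>R \<psi> y) has_derivative (\<lambda>h. 0)) (at x)"
proof -
  have d: "(\<phi> has_derivative dd \<phi> x) (at x)" using assms(1) by (rule has_derivative_dd)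
  obtain K where K: "\<And>h. norm (dd \<phi> x h) \<le> norm h * K"
    using bounded_linear.bounded[OF has_derivative_bounded_linear[OF d]] by blast
  have q: "((\<lambda>y. norm (\<phi> y - \<phi> x - dd \<phi> x (y - x)) / norm (y - x)) \<longlongrightarrow> 0) (at x)"
    using d unfolding has_derivative_iff_norm by blast
  have p: "((\<lambda>y. norm (\<psi> y)) \<longlongrightarrow> 0) (at x)"
    using assms(3,4) by (auto simp: isCont_def dest: tendsto_norm)
  have "((\<lambda>y. (norm (\<phi> y - \<phi> x - dd \<phi> x (y - x)) / norm (y - x) + K) * norm (\<psi> y)) \<longlongrightarrow> 0) (at x)"
    using tendsto_mult[OF tendsto_add[OF q tendsto_const[of K]] p] by simp
  moreover have "eventually (\<lambda>y. norm (norm (\<phi> y *\<^sub>R \<psi> y) / norm (y - x)) \<le>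
     (norm (\<phi> y - \<phi> x - dd \<phi> x (y - x)) / norm (y - x) + K) * norm (\<psi> y)) (at x)"
  proof (rule eventually_mono[OF eventually_at_ball[of 1 x UNIV]], simp_all)
    fix y :: 'a
    have *: "\<bar>\<phi> y\<bar> \<le> \<bar>\<phi> y - \<phi> x - dd \<phi> x (y - x)\<bar> + norm (y - x) * K"
      using K[of "y - x"] assms(2) by auto
    show "\<bar>\<phi> y\<bar> * norm (\<psi> y) / norm (y - x) \<le>
         (\<bar>\<phi> y - \<phi> x - dd \<phi> x (y - x)\<bar> / norm (y - x) + K) * norm (\<psi> y)"
    proof (cases "y = x")
      case False
      then have "\<bar>\<phi> y\<bar> / norm (y - x) \<le> \<bar>\<phi> y - \<phi> x - dd \<phi> x (y - x)\<bar> / norm (y - x) + K"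
        using divide_right_mono[OF *, of "norm (y - x)"] by (simp add: add_divide_distrib)
      from mult_right_mono[OF this, of "norm (\<psi> y)"] show ?thesis by simp
    qed (simp add: assms)
  qed
  ultimately have "((\<lambda>y. norm (\<phi> y *\<^sub>R \<psi> y) / norm (y - x)) \<longlongrightarrow> 0) (at x)"
    by (rule Lim_null_comparison[rotated])
  then show ?thesis
    unfolding has_derivative_iff_norm using assms(2,4) by simp
qed

text \<open>T x0 (w x - w x0) equals r x - T x (w x0) - E x with the error E x = (T x - T x0) (w x -
  w x0). Continuity of w makes E a sum of products as in \<open>has_derivative_prod_zero\<close>,
  and the left inverse J of T x0 then expresses w through differentiable functions.\<close>

lemma differentiable_solve:
  fixes T :: "'a::euclidean_space \<Rightarrow> 'b::euclidean_space \<Rightarrow> 'b"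
  assumes "open S" "x0 \<in> S" and lin: "\<And>x. x \<in> S \<Longrightarrow> linear (T x)" and inj: "inj (T x0)"
    and T: "\<And>v x. x \<in> S \<Longrightarrow> (\<lambda>x. T x v) differentiable (at x)"
    and r: "\<And>x. x \<in> S \<Longrightarrow> r differentiable (at x)"
    and sol: "\<And>x. x \<in> S \<Longrightarrow> T x (w x) = r x"
  shows "w differentiable (at x0)"
proof -
  have cw: "isCont w x0"
    using T r inj lin sol by (intro continuous_solve[OF assms(1,2), of T r])
      (auto intro!: continuous_at_imp_continuous_on differentiable_imp_continuous_within)
  obtain J where J: "linear J" "J \<circ> T x0 = id"
    using linear_injective_left_inverse[OF lin[OF assms(2)] inj] by blast
  then have JT: "J (T x0 v) = v" for v by (metis comp_apply id_apply)
  define E where "E x = (\<Sum>b\<in>Basis. \<Sum>c\<in>Basis.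
      (((T x b - T x0 b) \<bullet> c) *\<^sub>R (((w x - w x0) \<bullet> b) *\<^sub>R c)))" for x
  have E: "(E has_derivative (\<lambda>h. \<Sum>b::'b\<in>Basis. \<Sum>c::'b\<in>Basis. 0)) (at x0)"
    unfolding E_def
    by (intro has_derivative_sum has_derivative_prod_zero)
       (use T[OF assms(2)] cw in \<open>auto intro!: differentiable_diff continuous_intros\<close>)
  have Eeq: "E x = T x (w x - w x0) - T x0 (w x - w x0)" if "x \<in> S" for x
  proof -
    have "T x (w x - w x0) - T x0 (w x - w x0) = (\<Sum>b\<in>Basis. ((w x - w x0) \<bullet> b) *\<^sub>R (T x b - T x0 b))"
      by (simp add: linear_basis_expansion[OF lin[OF that], of "w x - w x0"]
          linear_basis_expansion[OF lin[OF assms(2)], of "w x - w x0"] scaleR_diff_right sum_subtractf)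
    also have "\<dots> = (\<Sum>b\<in>Basis. ((w x - w x0) \<bullet> b) *\<^sub>R (\<Sum>c\<in>Basis. ((T x b - T x0 b) \<bullet> c) *\<^sub>R c))"
      by (simp add: euclidean_representation)
    finally show ?thesis by (simp add: E_def scaleR_sum_right mult.commute)
  qed
  have eq: "w x0 + J (r x - T x (w x0) - E x) = w x" if "x \<in> S" for x
  proof -
    have "r x - T x (w x0) - E x = T x0 (w x - w x0)"
      unfolding Eeq[OF that] using sol[OF that] lin[OF that] by (simp add: linear_diff)
    then show ?thesis by (simp add: JT)
  qed
  have "E differentiable (at x0)" using E by (rule differentiableI)
  then have "(\<lambda>x. w x0 + J (r x - T x (w x0) - E x)) differentiable (at x0)"
    using r[OF assms(2)] T[OF assms(2), of "w x0"] J(1)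
    by (intro differentiable_add differentiable_const differentiable_linear[of J] differentiable_diff)
       (auto simp: linear_conv_bounded_linear)
  then show ?thesis
    using differentiable_cong_open[OF assms(1,2), of "\<lambda>x. w x0 + J (r x - T x (w x0) - E x)" w] eq by simp
qed

lemma C_k_on_apply:
  fixes w :: "'a::euclidean_space \<Rightarrow> 'b::euclidean_space"
  assumes "open S" and lin: "\<And>x. x \<in> S \<Longrightarrow> linear (T x)"
    and T: "\<And>v. C_k_on k S (\<lambda>x. T x v)" and w: "C_k_on k S w"
  shows "C_k_on k S (\<lambda>x. T x (w x))"
proof -
  have "C_k_on k S (\<lambda>x. \<Sum>b\<in>Basis. (w x \<bullet> b) *\<^sub>R T x b)"
    by (intro C_k_on_sum[OF assms(1)] C_k_on_bilinear[OF assms(1) bounded_bilinear_scaleR]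
        C_k_on_linear[OF assms(1) bounded_linear_inner_left] T w)
  then show ?thesis
    by (subst C_k_on_cong[OF assms(1) linear_basis_expansion[OF lin]])
qed

text \<open>Differentiating \<open>T w = r\<close> gives the system \<open>T (D w) = D r - (D T) w\<close> for the derivative, with the same
  matrix; this yields smoothness without a formula for the inverse of \<open>T\<close>.\<close>

lemma C_k_on_solve:
  fixes T :: "'a::euclidean_space \<Rightarrow> 'b::euclidean_space \<Rightarrow> 'b"
  assumes "open S" and lin: "\<And>x. x \<in> S \<Longrightarrow> linear (T x)" and inj: "\<And>x. x \<in> S \<Longrightarrow> inj (T x)"
    and T: "\<And>v. C_k_on k S (\<lambda>x. T x v)" and r: "C_k_on k S r"
    and sol: "\<And>x. x \<in> S \<Longrightarrow> T x (w x) = r x"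
  shows "C_k_on k S w"
  using T r sol
proof (induction k arbitrary: w r)
  case 0
  then show ?case
    using continuous_solve[OF assms(1), of _ T r w] lin inj
    by (auto intro!: continuous_at_imp_continuous_on)
next
  case (Suc k)
  have dw: "w differentiable (at x)" if "x \<in> S" for x
    by (rule differentiable_solve[OF assms(1) that, of T r]) (use Suc.prems lin inj that in auto)
  have wk: "C_k_on k S w"
    by (rule Suc.IH[of r]) (use Suc.prems C_k_on_SucD in blast)+
  have "C_k_on k S (\<lambda>x. dd w x u)" for u
  proof (rule Suc.IH[where r = "\<lambda>x. dd r x u + (-1) *\<^sub>R dd (\<lambda>y. T y (w x)) x u"])
    show "C_k_on k S (\<lambda>x. T x v)" for v using Suc.prems C_k_on_SucD by blast
    have lin': "linear (\<lambda>v. dd (\<lambda>y. T y v) x u)" if "x \<in> S" for x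
      by (rule linear_dd_param[OF assms(1) that lin]) (use Suc.prems(1) that in auto)
    have Tw: "C_k_on k S (\<lambda>x. dd (\<lambda>y. T y (w x)) x u)"
      by (rule C_k_on_apply[OF assms(1) lin' _ wk, of "\<lambda>x. x"]) (use Suc.prems in auto)
    show "C_k_on k S (\<lambda>x. dd r x u + (-1) *\<^sub>R dd (\<lambda>y. T y (w x)) x u)"
      using Suc.prems(2)
      by (intro C_k_on_add[OF assms(1)] C_k_on_linear[OF assms(1) bounded_linear_scaleR_right, OF Tw]) auto
    show "T x (dd w x u) = dd r x u + (-1) *\<^sub>R dd (\<lambda>y. T y (w x)) x u" if "x \<in> S" for x
    proof -
      have "((\<lambda>y. T y (w y)) has_derivative (\<lambda>u. dd (\<lambda>y. T y (w x)) x u + T x (dd w x u))) (at x)"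
        using Suc.prems(1) that by (intro has_derivative_apply[OF assms(1) that lin] dw) auto
      then have "dd (\<lambda>y. T y (w y)) x u = dd (\<lambda>y. T y (w x)) x u + T x (dd w x u)"
        by (rule dd_eq)
      moreover have "dd (\<lambda>y. T y (w y)) x u = dd r x u"
        by (rule dd_cong[OF assms(1) that Suc.prems(3)])
      ultimately show ?thesis by simp
    qed
  qed
  then show ?case using dw by simp
qed

section \<open>The same rules for smooth functions\<close>

lemma smooth_on_differentiable: "smooth_on S f \<Longrightarrow> x \<in> S \<Longrightarrow> f differentiable (at x)"
  using C_k_on.simps(2)[of 0 S f] by (auto simp: smooth_on_def)

lemma smooth_on_dd: "smooth_on S f \<Longrightarrow> smooth_on S (\<lambda>x. dd f x v)"
  unfolding smooth_on_def using C_k_on.simps(2) by blast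

lemma smooth_on_cong:
  "open S \<Longrightarrow> (\<And>y. y \<in> S \<Longrightarrow> f y = g y) \<Longrightarrow> smooth_on S f \<longleftrightarrow> smooth_on S g"
  unfolding smooth_on_def using C_k_on_cong[of S f g] by auto

lemma smooth_on_subset: "smooth_on S f \<Longrightarrow> T \<subseteq> S \<Longrightarrow> smooth_on T f"
  unfolding smooth_on_def using C_k_on_subset by blast

lemma smooth_on_continuous: "smooth_on S f \<Longrightarrow> continuous_on S f"
  unfolding smooth_on_def using C_k_on.simps(1) by blast

lemma smooth_on_const: "smooth_on S (\<lambda>x. c)"
  by (simp add: smooth_on_def C_k_on_const)

lemma smooth_on_id: "smooth_on S (\<lambda>x. x)"
  by (simp add: smooth_on_def C_k_on_id)

lemma smooth_on_add:
  "open S \<Longrightarrow> smooth_on S f \<Longrightarrow> smooth_on S g \<Longrightarrow> smooth_on S (\<lambda>x. f x + g x)"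
  by (simp add: smooth_on_def C_k_on_add)

lemma smooth_on_linear:
  "open S \<Longrightarrow> bounded_linear h \<Longrightarrow> smooth_on S f \<Longrightarrow> smooth_on S (\<lambda>x. h (f x))"
  by (simp add: smooth_on_def C_k_on_linear)

lemma smooth_on_minus: "open S \<Longrightarrow> smooth_on S f \<Longrightarrow> smooth_on S (\<lambda>x. - f x)"
  by (rule smooth_on_linear[of S uminus]) (auto intro: bounded_linear_minus bounded_linear_ident)

lemma smooth_on_diff:
  "open S \<Longrightarrow> smooth_on S f \<Longrightarrow> smooth_on S g \<Longrightarrow> smooth_on S (\<lambda>x. f x - g x)"
  using smooth_on_add[of S f "\<lambda>x. - g x"] smooth_on_minus[of S g] by simp

lemma smooth_on_bilinear:
  "open S \<Longrightarrow> bounded_bilinear h \<Longrightarrow> smooth_on S f \<Longrightarrow> smooth_on S g \<Longrightarrow> smooth_on S (\<lambda>x. h (f x) (g x))"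
  by (simp add: smooth_on_def C_k_on_bilinear)

lemma smooth_on_sum:
  "open S \<Longrightarrow> (\<And>i. i \<in> I \<Longrightarrow> smooth_on S (f i)) \<Longrightarrow> smooth_on S (\<lambda>x. \<Sum>i\<in>I. f i x)"
  by (simp add: smooth_on_def C_k_on_sum)

lemma smooth_on_compose:
  fixes f :: "'a::euclidean_space \<Rightarrow> 'b::euclidean_space"
  shows "open S \<Longrightarrow> open T \<Longrightarrow> f ` S \<subseteq> T \<Longrightarrow> smooth_on S f \<Longrightarrow> smooth_on T g \<Longrightarrow> smooth_on S (\<lambda>x. g (f x))"
  unfolding smooth_on_def using C_k_on_compose by blast

lemma smooth_on_apply:
  fixes w :: "'a::euclidean_space \<Rightarrow> 'b::euclidean_space"
  shows "open S \<Longrightarrow> (\<And>x. x \<in> S \<Longrightarrow> linear (T x)) \<Longrightarrow> (\<And>v. smooth_on S (\<lambda>x. T x v)) \<Longrightarrow> smooth_on S w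
    \<Longrightarrow> smooth_on S (\<lambda>x. T x (w x))"
  unfolding smooth_on_def by (blast intro: C_k_on_apply)

lemma smooth_on_solve:
  fixes T :: "'a::euclidean_space \<Rightarrow> 'b::euclidean_space \<Rightarrow> 'b"
  assumes "open S" "\<And>x. x \<in> S \<Longrightarrow> linear (T x)" "\<And>x. x \<in> S \<Longrightarrow> inj (T x)"
    and "\<And>v. smooth_on S (\<lambda>x. T x v)" and "smooth_on S r"
    and "\<And>x. x \<in> S \<Longrightarrow> T x (w x) = r x"
  shows "smooth_on S w"
  unfolding smooth_on_def
  by (intro allI, rule C_k_on_solve[OF assms(1), where T = T and r = r])
     (use assms in \<open>auto simp: smooth_on_def\<close>)

lemma smooth_on_apply2:
  fixes v :: "'a::euclidean_space \<Rightarrow> 'b::euclidean_space" and w :: "'a \<Rightarrow> 'c::euclidean_space"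
  assumes "open S" "\<And>x. x \<in> S \<Longrightarrow> bilinear (T x)" "\<And>v w. smooth_on S (\<lambda>x. T x v w)"
    "smooth_on S v" "smooth_on S w"
  shows "smooth_on S (\<lambda>x. T x (v x) (w x))"
proof (rule smooth_on_apply[OF assms(1), where T = "\<lambda>x. T x (v x)"])
  show "linear (T x (v x))" if "x \<in> S" for x using assms(2)[OF that] by (simp add: bilinear_def)
  show "smooth_on S (\<lambda>x. T x (v x) w)" for w
    by (rule smooth_on_apply[OF assms(1), where T = "\<lambda>x v. T x v w"])
       (use assms in \<open>auto simp: bilinear_def\<close>)
qed (rule assms)

lemma has_derivative_apply2:
  fixes v :: "'a::real_normed_vector \<Rightarrow> 'b::euclidean_space" and w :: "'a \<Rightarrow> 'c::euclidean_space"
  assumes "open S" "x \<in> S" and bil: "\<And>y. y \<in> S \<Longrightarrow> bilinear (T y)"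
    and T: "\<And>v w. (\<lambda>y. T y v w) differentiable (at x)"
    and v: "v differentiable (at x)" and w: "w differentiable (at x)"
  shows "((\<lambda>y. T y (v y) (w y)) has_derivative
    (\<lambda>u. dd (\<lambda>y. T y (v x) (w x)) x u + T x (dd v x u) (w x) + T x (v x) (dd w x u))) (at x)"
proof -
  have 1: "((\<lambda>y. T y (v y) w) has_derivative (\<lambda>u. dd (\<lambda>y. T y (v x) w) x u + T x (dd v x u) w)) (at x)" for w
    by (rule has_derivative_apply[OF assms(1,2), where T = "\<lambda>x v. T x v w"])
       (use bil T v in \<open>auto simp: bilinear_def\<close>)
  have "((\<lambda>y. T y (v y) (w y)) has_derivative
    (\<lambda>u. dd (\<lambda>y. T y (v y) (w x)) x u + T x (v x) (dd w x u))) (at x)"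
    by (rule has_derivative_apply[OF assms(1,2), where T = "\<lambda>y. T y (v y)"])
       (use bil w differentiableI[OF 1] in \<open>auto simp: bilinear_def\<close>)
  then show ?thesis unfolding dd_eq[OF 1] .
qed

section \<open>Symmetry of second derivatives\<close>

lemma second_difference:
  fixes g :: "'a::euclidean_space \<Rightarrow> real"
  assumes "smooth_on S g" "ball x e \<subseteq> S" "0 < t" "t * (norm u + norm v) < e"
  obtains y where "dist x y \<le> t * (norm u + norm v)"
    "g (x + t *\<^sub>R u + t *\<^sub>R v) - g (x + t *\<^sub>R u) - g (x + t *\<^sub>R v) + g x = t\<^sup>2 * dd (\<lambda>y. dd g y u) y v"
proof -
  have near: "dist x (x + s *\<^sub>R u + s' *\<^sub>R v) \<le> t * (norm u + norm v)" if "0 \<le> s" "s \<le> t" "0 \<le> s'" "s' \<le> t" for s s'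
  proof -
    have "norm (s *\<^sub>R u + s' *\<^sub>R v) \<le> s * norm u + s' * norm v"
      using norm_triangle_ineq[of "s *\<^sub>R u" "s' *\<^sub>R v"] that by simp
    also have "\<dots> \<le> t * norm u + t * norm v" using that by (intro add_mono mult_right_mono) auto
    finally show ?thesis by (simp add: dist_norm norm_minus_commute algebra_simps)
  qed
  have inS: "x + s *\<^sub>R u + s' *\<^sub>R v \<in> S" if "0 \<le> s" "s \<le> t" "0 \<le> s'" "s' \<le> t" for s s'
    using near[OF that] assms(2,4) by (force simp: dist_norm)
  have der: "((\<lambda>s. f (p + s *\<^sub>R w)) has_real_derivative dd f (p + s *\<^sub>R w) w) (at s)"
    if "f differentiable (at (p + s *\<^sub>R w))" for f :: "'a \<Rightarrow> real" and p w s
  proof -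
    have "((\<lambda>s. p + s *\<^sub>R w) has_derivative (\<lambda>h. h *\<^sub>R w)) (at s)" by (auto intro!: derivative_eq_intros)
    from diff_chain_at[OF this has_derivative_dd[OF that]]
    have "((\<lambda>s. f (p + s *\<^sub>R w)) has_derivative (\<lambda>h. dd f (p + s *\<^sub>R w) (h *\<^sub>R w))) (at s)"
      by (simp add: o_def)
    then show ?thesis
      using linear_scale[OF linear_dd[OF that]] by (simp add: has_field_derivative_def mult.commute[of _ "dd f _ w"] mult_commute_abs)
  qed
  \<comment> \<open>The mixed second difference is the increment of \<phi> over [0, t]. The mean
    value theorem in direction u, and then for \<psi> in direction v, turns it into t^2 times a
    mixed derivative at an intermediate point.\<close>
  define \<phi> where "\<phi> s = g ((x + t *\<^sub>R v) + s *\<^sub>R u) - g (x + s *\<^sub>R u)" for s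
  have "\<exists>s>0. s < t \<and> \<phi> t - \<phi> 0 = (t - 0) * (dd g ((x + t *\<^sub>R v) + s *\<^sub>R u) u - dd g (x + s *\<^sub>R u) u)"
    unfolding \<phi>_def
  proof (rule MVT2[OF assms(3)])
    fix s assume s: "0 \<le> s" "s \<le> t"
    show "((\<lambda>s. g ((x + t *\<^sub>R v) + s *\<^sub>R u) - g (x + s *\<^sub>R u)) has_real_derivative
        dd g ((x + t *\<^sub>R v) + s *\<^sub>R u) u - dd g (x + s *\<^sub>R u) u) (at s)"
      using inS[OF s, of t] inS[OF s, of 0] assms(3)
      by (intro DERIV_diff der smooth_on_differentiable[OF assms(1)]) (auto simp: algebra_simps)
  qed
  then obtain s where s: "0 < s" "s < t"
    "\<phi> t - \<phi> 0 = t * (dd g ((x + s *\<^sub>R u) + t *\<^sub>R v) u - dd g (x + s *\<^sub>R u) u)"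
    by (auto simp: algebra_simps)
  define \<psi> where "\<psi> s' = dd g ((x + s *\<^sub>R u) + s' *\<^sub>R v) u" for s'
  have "\<exists>s'>0. s' < t \<and> \<psi> t - \<psi> 0 = (t - 0) * dd (\<lambda>y. dd g y u) ((x + s *\<^sub>R u) + s' *\<^sub>R v) v"
    unfolding \<psi>_def
  proof (rule MVT2[OF assms(3)])
    fix s' assume s': "0 \<le> s'" "s' \<le> t"
    show "((\<lambda>s'. dd g ((x + s *\<^sub>R u) + s' *\<^sub>R v) u) has_real_derivative
        dd (\<lambda>y. dd g y u) ((x + s *\<^sub>R u) + s' *\<^sub>R v) v) (at s')"
      using inS[of s s'] s' s
      by (intro der[where f = "\<lambda>y. dd g y u"] smooth_on_differentiable[OF smooth_on_dd[OF assms(1)]]) auto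
  qed
  then obtain s' where s': "0 < s'" "s' < t" "\<psi> t - \<psi> 0 = t * dd (\<lambda>y. dd g y u) (x + s *\<^sub>R u + s' *\<^sub>R v) v"
    by auto
  show thesis
  proof (rule that)
    show "dist x (x + s *\<^sub>R u + s' *\<^sub>R v) \<le> t * (norm u + norm v)" using near s s' by simp
    have "g (x + t *\<^sub>R u + t *\<^sub>R v) - g (x + t *\<^sub>R u) - g (x + t *\<^sub>R v) + g x = \<phi> t - \<phi> 0"
      by (simp add: \<phi>_def algebra_simps)
    also have "\<dots> = t * (\<psi> t - \<psi> 0)" using s(3) by (simp add: \<psi>_def)
    finally show "g (x + t *\<^sub>R u + t *\<^sub>R v) - g (x + t *\<^sub>R u) - g (x + t *\<^sub>R v) + g x =
        t\<^sup>2 * dd (\<lambda>y. dd g y u) (x + s *\<^sub>R u + s' *\<^sub>R v) v"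
      by (simp add: s'(3) power2_eq_square)
  qed
qed

text \<open>The second difference is symmetric in u and v. So arbitrarily near x the two mixed
  derivatives share a value, though at different points, and by continuity they cannot differ at
  x.\<close>

lemma dd_commute_real:
  fixes g :: "'a::euclidean_space \<Rightarrow> real"
  assumes "open S" "x \<in> S" "smooth_on S g"
  shows "dd (\<lambda>y. dd g y u) x v = dd (\<lambda>y. dd g y v) x u"
proof (rule ccontr)
  define P where "P = (\<lambda>y. dd (\<lambda>y. dd g y u) y v)"
  define Q where "Q = (\<lambda>y. dd (\<lambda>y. dd g y v) y u)"
  assume "\<not> ?thesis"
  then have ne: "P x \<noteq> Q x" by (simp add: P_def Q_def)
  define \<epsilon> where "\<epsilon> = dist (P x) (Q x) / 2"
  have "\<epsilon> > 0" using ne by (simp add: \<epsilon>_def)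
  have "continuous_on S P" "continuous_on S Q"
    unfolding P_def Q_def by (intro smooth_on_continuous smooth_on_dd assms)+
  then have "isCont P x" "isCont Q x" using assms by (auto simp: continuous_on_eq_continuous_at)
  then have "\<exists>d>0. \<forall>y. dist y x < d \<longrightarrow> dist (P y) (P x) < \<epsilon>" "\<exists>d>0. \<forall>y. dist y x < d \<longrightarrow> dist (Q y) (Q x) < \<epsilon>"
    using \<open>\<epsilon> > 0\<close> unfolding continuous_at_eps_delta by blast+
  then obtain d1 d2 where d: "d1 > 0" "d2 > 0" "\<And>y. dist y x < d1 \<Longrightarrow> dist (P y) (P x) < \<epsilon>"
      "\<And>y. dist y x < d2 \<Longrightarrow> dist (Q y) (Q x) < \<epsilon>"
    by blast
  obtain e where e: "e > 0" "ball x e \<subseteq> S" using assms open_contains_ball by blast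
  define \<delta> where "\<delta> = min e (min d1 d2)"
  \<comment> \<open>All points x + s u + s' v with s and s' in [0, t] then lie within \<delta> of x;
    the summand 1 keeps the denominator positive when u = v = 0.\<close>
  define t where "t = \<delta> / (2 * (norm u + norm v + 1))"
  have pos: "norm u + norm v + 1 > 0" by (smt (verit) norm_ge_zero)
  have "\<delta> > 0" using d e by (simp add: \<delta>_def)
  then have t: "t > 0" using pos by (simp add: t_def)
  have "t * (norm u + norm v) < t * (2 * (norm u + norm v + 1))"
    using t pos by (intro mult_strict_left_mono) (auto intro: add_nonneg_nonneg)
  also have "\<dots> = \<delta>" using pos by (simp add: t_def)
  finally have small: "t * (norm u + norm v) < \<delta>" .
  obtain y where y: "dist x y \<le> t * (norm u + norm v)"
    "g (x + t *\<^sub>R u + t *\<^sub>R v) - g (x + t *\<^sub>R u) - g (x + t *\<^sub>R v) + g x = t\<^sup>2 * P y"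
    using second_difference[OF assms(3) e(2) t, of u v] small unfolding P_def \<delta>_def by auto
  obtain z where z: "dist x z \<le> t * (norm v + norm u)"
    "g (x + t *\<^sub>R v + t *\<^sub>R u) - g (x + t *\<^sub>R v) - g (x + t *\<^sub>R u) + g x = t\<^sup>2 * Q z"
    using second_difference[OF assms(3) e(2) t, of v u] small unfolding Q_def \<delta>_def by (auto simp: add.commute)
  have "t\<^sup>2 * P y = t\<^sup>2 * Q z" using y(2) z(2) by (simp add: algebra_simps)
  then have "P y = Q z" using t by simp
  moreover have "dist (P y) (P x) < \<epsilon>" "dist (Q z) (Q x) < \<epsilon>"
    using y(1) z(1) small d(3)[of y] d(4)[of z] by (auto simp: \<delta>_def dist_commute add.commute)
  ultimately have "dist (P x) (Q x) < 2 * \<epsilon>" using dist_triangle2[of "P x" "Q x" "P y"]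
    by (auto simp: dist_commute)
  then show False by (simp add: \<epsilon>_def)
qed

lemma dd_commute:
  fixes f :: "'a::euclidean_space \<Rightarrow> 'b::euclidean_space"
  assumes "open S" "x \<in> S" "smooth_on S f"
  shows "dd (\<lambda>y. dd f y u) x v = dd (\<lambda>y. dd f y v) x u"
proof (rule euclidean_eqI)
  fix b :: 'b
  have 1: "dd (\<lambda>z. f z \<bullet> b) y w = dd f y w \<bullet> b" if "y \<in> S" for y w
    using bounded_linear.has_derivative[OF bounded_linear_inner_left[of b]
        has_derivative_dd[OF smooth_on_differentiable[OF assms(3) that]]]
    by (rule dd_eq)
  have 2: "dd (\<lambda>y. dd f y w \<bullet> b) x w' = dd (\<lambda>y. dd f y w) x w' \<bullet> b" for w w'
    using bounded_linear.has_derivative[OF bounded_linear_inner_left[of b]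
        has_derivative_dd[OF smooth_on_differentiable[OF smooth_on_dd[OF assms(3)] assms(2)]]]
    by (rule dd_eq)
  have 3: "dd (\<lambda>y. dd (\<lambda>z. f z \<bullet> b) y w) x w' = dd (\<lambda>y. dd f y w) x w' \<bullet> b" for w w'
    unfolding 2[symmetric] by (rule dd_cong[OF assms(1,2) 1])
  have "smooth_on S (\<lambda>z. f z \<bullet> b)"
    by (rule smooth_on_linear[OF assms(1) bounded_linear_inner_left assms(3)])
  from dd_commute_real[OF assms(1,2) this]
  show "dd (\<lambda>y. dd f y u) x v \<bullet> b = dd (\<lambda>y. dd f y v) x u \<bullet> b" unfolding 3 .
qed

section \<open>The Levi-Civita connection and the curvature tensor\<close>

text \<open>\<open>christoffel\<close> freed from the record, so that the local theory can speak of
  a field of bilinear forms without any manifold.\<close>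

definition levi_civita :: "('e::euclidean_space \<Rightarrow> 'e \<Rightarrow> 'e \<Rightarrow> real) \<Rightarrow> 'e \<Rightarrow> 'e \<Rightarrow> 'e \<Rightarrow> 'e" where
  "levi_civita G x u v = (THE w. \<forall>z. 2 * G x w z =
       dd (\<lambda>y. G y v z) x u + dd (\<lambda>y. G y u z) x v - dd (\<lambda>y. G y u v) x z)"

definition riemann :: "('e::euclidean_space \<Rightarrow> 'e \<Rightarrow> 'e \<Rightarrow> 'e) \<Rightarrow> 'e \<Rightarrow> 'e \<Rightarrow> 'e \<Rightarrow> 'e \<Rightarrow> 'e" where
  "riemann \<Gamma> x u v w = dd (\<lambda>y. \<Gamma> y v w) x u - dd (\<lambda>y. \<Gamma> y u w) x v
     + \<Gamma> x u (\<Gamma> x v w) - \<Gamma> x v (\<Gamma> x u w)"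

lemma christoffel_eq_levi_civita: "christoffel M c = levi_civita (gten M c)"
  by (simp add: fun_eq_iff christoffel_def levi_civita_def)

lemma curv_eq_riemann: "curv M c = riemann (levi_civita (gten M c))"
  by (simp add: fun_eq_iff curv_def riemann_def christoffel_eq_levi_civita)

text \<open>A semi-Riemannian metric in one chart. The signature is left open: the locale serves the
  Lorentzian ambient metric and the Riemannian induced metric alike.\<close>

locale metric_field =
  fixes Y :: "'e::euclidean_space set" and G :: "'e \<Rightarrow> 'e \<Rightarrow> 'e \<Rightarrow> real"
  assumes open_Y: "open Y"
    and bil: "x \<in> Y \<Longrightarrow> bilinear (G x)"
    and sym: "x \<in> Y \<Longrightarrow> G x u v = G x v u"
    and nondeg: "x \<in> Y \<Longrightarrow> (\<And>v. G x u v = 0) \<Longrightarrow> u = 0"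
    and smooth: "smooth_on Y (\<lambda>x. G x u v)"
begin

lemma diff_G: "x \<in> Y \<Longrightarrow> (\<lambda>x. G x u v) differentiable (at x)"
  by (rule smooth_on_differentiable[OF smooth])

lemma lin1: "x \<in> Y \<Longrightarrow> linear (\<lambda>u. G x u v)" and lin2: "x \<in> Y \<Longrightarrow> linear (G x u)"
  using bil by (auto simp: bilinear_def)

lemma G_linear:
  assumes "x \<in> Y"
  shows "G x (u + u') v = G x u v + G x u' v" "G x u (v + v') = G x u v + G x u v'"
    "G x (u - u') v = G x u v - G x u' v" "G x u (v - v') = G x u v - G x u v'"
    "G x (- u) v = - G x u v" "G x u (- v) = - G x u v"
    "G x (c *\<^sub>R u) v = c * G x u v" "G x u (c *\<^sub>R v) = c * G x u v"
    "G x 0 v = 0" "G x u 0 = 0"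
  using bil[OF assms] by (simp_all add: bilinear_ladd bilinear_radd bilinear_lsub bilinear_rsub
      bilinear_lneg bilinear_rneg bilinear_lmul bilinear_rmul bilinear_lzero bilinear_rzero)

lemma G_eqI: "x \<in> Y \<Longrightarrow> (\<And>z. G x u z = G x v z) \<Longrightarrow> u = v"
  using nondeg[of x "u - v"] by (simp add: G_linear)

text \<open>Lowering an index, with the covector encoded as a vector through the Euclidean inner
  product. This makes it an endomorphism of the model space, the form required by
  \<open>smooth_on_solve\<close>.\<close>

definition flat :: "'e \<Rightarrow> 'e \<Rightarrow> 'e" where
  "flat x w = (\<Sum>b\<in>Basis. G x w b *\<^sub>R b)"

lemma flat_inner: 
  assumes "x \<in> Y" shows "flat x w \<bullet> z = G x w z"
proof -
  have "flat x w \<bullet> z = (\<Sum>b\<in>Basis. (z \<bullet> b) *\<^sub>R G x w b)"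
    by (simp add: flat_def inner_sum_left inner_commute[of z] mult.commute)
  then show ?thesis using linear_basis_expansion[OF lin2[OF assms]] by metis
qed

lemma linear_flat: "x \<in> Y \<Longrightarrow> linear (flat x)"
  by (rule linearI; rule euclidean_eqI) (simp_all add: flat_inner G_linear inner_add_left)

lemma inj_flat: "x \<in> Y \<Longrightarrow> inj (flat x)"
  by (rule injI, rule G_eqI) (auto simp: flat_inner[symmetric])

lemma smooth_flat: "smooth_on Y (\<lambda>x. flat x w)"
  unfolding flat_def
  by (intro smooth_on_sum[OF open_Y] smooth_on_bilinear[OF open_Y bounded_bilinear_scaleR] smooth smooth_on_const)

lemma riesz:
  assumes "x \<in> Y" "linear l" obtains w where "\<And>z. G x w z = (l z :: real)"
proof -
  have "surj (flat x)"
    using linear_injective_imp_surjective[OF linear_flat inj_flat] assms by blast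
  then obtain w where "flat x w = (\<Sum>b\<in>Basis. l b *\<^sub>R b)" by (metis surjD)
  then have "G x w z = (\<Sum>b\<in>Basis. l b *\<^sub>R b) \<bullet> z" for z
    using flat_inner[OF assms(1)] by metis
  also have "(\<Sum>b\<in>Basis. l b *\<^sub>R b) \<bullet> z = l z" for z
    using linear_basis_expansion[OF assms(2), of z] by (simp add: inner_sum_left inner_commute[of z] mult.commute)
  finally show thesis by (rule that)
qed

text \<open>Christoffel symbols and the shape operator are defined by duality. Here their smoothness
  follows: they solve a linear system whose matrix \<open>flat\<close> is smooth and
  invertible.\<close>

lemma smooth_riesz:
  assumes S: "open S" "f ` S \<subseteq> Y" "smooth_on S f"
    and "\<And>z. smooth_on S (\<lambda>x. l x z)" "\<And>x z. x \<in> S \<Longrightarrow> G (f x) (w x) z = l x z"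
  shows "smooth_on S (w :: 'a::euclidean_space \<Rightarrow> 'e)"
proof -
  have fS: "f x \<in> Y" if "x \<in> S" for x using S that by auto
  have "smooth_on S (\<lambda>x. flat (f x) w')" for w'
    by (rule smooth_on_compose[OF S(1) open_Y S(2,3) smooth_flat])
  moreover
  have "smooth_on S (\<lambda>x. \<Sum>b\<in>Basis. l x b *\<^sub>R b)"
    by (intro smooth_on_sum[OF S(1)] smooth_on_bilinear[OF S(1) bounded_bilinear_scaleR] assms smooth_on_const)
  moreover have "flat (f x) (w x) = (\<Sum>b\<in>Basis. l x b *\<^sub>R b)" if "x \<in> S" for x
    using assms(5)[OF that] by (simp add: flat_def)
  ultimately
  show ?thesis 
    using smooth_on_solve[OF S(1), of "\<lambda>x. flat (f x)"] linear_flat inj_flat fS by blast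
qed

lemma linear_dG1: "x \<in> Y \<Longrightarrow> linear (\<lambda>u. dd (\<lambda>y. G y u v) x w)"
  by (rule linear_dd_param[OF open_Y]) (auto intro: lin1 diff_G)

lemma linear_dG2: "x \<in> Y \<Longrightarrow> linear (\<lambda>v. dd (\<lambda>y. G y u v) x w)"
  by (rule linear_dd_param[OF open_Y]) (auto intro: lin2 diff_G)

lemma linear_dG3: "x \<in> Y \<Longrightarrow> linear (dd (\<lambda>y. G y u v) x)"
  by (rule linear_dd[OF diff_G])

abbreviation \<Gamma> where "\<Gamma> \<equiv> levi_civita G"

lemma dG_sym: "x \<in> Y \<Longrightarrow> dd (\<lambda>y. G y u v) x w = dd (\<lambda>y. G y v u) x w"
  by (rule dd_cong[OF open_Y]) (auto intro: sym)

text \<open>Justifies the definite description in \<open>levi_civita\<close>: the right-hand side is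
  linear in z, so the vector exists by \<open>riesz\<close>, and nondegeneracy makes it
  unique.\<close>

lemma koszul:
  assumes "x \<in> Y"
  shows "2 * G x (\<Gamma> x u v) z = dd (\<lambda>y. G y v z) x u + dd (\<lambda>y. G y u z) x v - dd (\<lambda>y. G y u v) x z"
proof -
  let ?l = "\<lambda>z. (dd (\<lambda>y. G y v z) x u + dd (\<lambda>y. G y u z) x v - dd (\<lambda>y. G y u v) x z) / 2"
  have "linear ?l"
    using linear_dG2[OF assms, of v u] linear_dG2[OF assms, of u v] linear_dG3[OF assms, of u v]
    by (auto simp: linear_iff algebra_simps add_divide_distrib diff_divide_distrib)
  from riesz[OF assms this] obtain w where w: "\<And>z. G x w z = ?l z" by blast
  have "\<forall>z. 2 * G x (\<Gamma> x u v) z = dd (\<lambda>y. G y v z) x u + dd (\<lambda>y. G y u z) x v - dd (\<lambda>y. G y u v) x z"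
    unfolding levi_civita_def
  proof (rule theI)
    show "\<forall>z. 2 * G x w z = dd (\<lambda>y. G y v z) x u + dd (\<lambda>y. G y u z) x v - dd (\<lambda>y. G y u v) x z"
      by (simp add: w)
    show "w' = w" if "\<forall>z. 2 * G x w' z = dd (\<lambda>y. G y v z) x u + dd (\<lambda>y. G y u z) x v - dd (\<lambda>y. G y u v) x z" for w'
    proof (rule G_eqI[OF assms])
      show "G x w' z = G x w z" for z using that[rule_format, of z] w[of z] by simp
    qed
  qed
  then show ?thesis by blast
qed

lemma smooth_chr: "smooth_on Y (\<lambda>x. \<Gamma> x u v)"
proof (rule smooth_riesz[OF open_Y _ smooth_on_id])
  show "smooth_on Y (\<lambda>x. (dd (\<lambda>y. G y v z) x u + dd (\<lambda>y. G y u z) x v - dd (\<lambda>y. G y u v) x z) *\<^sub>R (1/2))" for z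
    by (intro smooth_on_bilinear[OF open_Y bounded_bilinear_scaleR] smooth_on_const smooth_on_add smooth_on_diff open_Y
        smooth_on_dd smooth)
  show "G x (\<Gamma> x u v) z = (dd (\<lambda>y. G y v z) x u + dd (\<lambda>y. G y u z) x v - dd (\<lambda>y. G y u v) x z) *\<^sub>R (1/2)"
    if "x \<in> Y" for x z using koszul[OF that] by (simp add: field_simps)
qed auto

lemma diff_chr: "x \<in> Y \<Longrightarrow> (\<lambda>x. \<Gamma> x u v) differentiable (at x)"
  by (rule smooth_on_differentiable[OF smooth_chr])

lemma chr_sym:
  assumes "x \<in> Y" shows "\<Gamma> x u v = \<Gamma> x v u"
proof (rule G_eqI[OF assms])
  show "G x (\<Gamma> x u v) z = G x (\<Gamma> x v u) z" for z
    using koszul[OF assms, of u v z] koszul[OF assms, of v u z] dG_sym[OF assms, of u v] by simp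
qed

lemma chr_linear:
  assumes "x \<in> Y" shows "linear (\<Gamma> x u)"
proof (rule linearI; rule G_eqI[OF assms])
  show "G x (\<Gamma> x u (v + v')) z = G x (\<Gamma> x u v + \<Gamma> x u v') z" for v v' z
    using koszul[OF assms, of u "v+v'" z] koszul[OF assms, of u v z] koszul[OF assms, of u v' z]
    by (simp add: G_linear assms linear_add[OF linear_dG1] linear_add[OF linear_dG2] linear_add[OF linear_dG3])
  show "G x (\<Gamma> x u (c *\<^sub>R v)) z = G x (c *\<^sub>R \<Gamma> x u v) z" for c v z
  proof -
    have "2 * G x (\<Gamma> x u (c *\<^sub>R v)) z = c * (2 * G x (\<Gamma> x u v) z)"
      unfolding koszul[OF assms]
      by (simp add: assms linear_scale[OF linear_dG1] linear_scale[OF linear_dG2]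
        linear_scale[OF linear_dG3] algebra_simps)
    then show ?thesis by (simp add: G_linear assms)
  qed
qed

lemma chr_bilinear: 
  assumes "x \<in> Y" shows "bilinear (\<Gamma> x)"
proof -
  have "\<Gamma> x u v = \<Gamma> x v u" for u v using chr_sym[OF assms] .
  then have "(\<lambda>u. \<Gamma> x u v) = \<Gamma> x v" for v by (simp add: fun_eq_iff)
  then show ?thesis using chr_linear[OF assms] by (simp add: bilinear_def)
qed

text \<open>In the sum of the Koszul formulas for (w, u, v) and (w, v, u) all derivatives except
  those in direction w cancel.\<close>

lemma compat:
  assumes "x \<in> Y"
  shows "dd (\<lambda>y. G y u v) x w = G x (\<Gamma> x w u) v + G x u (\<Gamma> x w v)"
  using koszul[OF assms, of w u v] koszul[OF assms, of w v u] dG_sym[OF assms, of v u w]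
  unfolding sym[OF assms, of u "\<Gamma> x w v"] by linarith

lemma dd_metric:
  assumes "x \<in> Y" "X differentiable (at x)" "Z differentiable (at x)"
  shows "((\<lambda>y. G y (X y) (Z y)) has_derivative (\<lambda>u. G x (dd X x u + \<Gamma> x u (X x)) (Z x)
    + G x (X x) (dd Z x u + \<Gamma> x u (Z x)))) (at x)"
  using has_derivative_apply2[OF open_Y assms(1) bil diff_G[OF assms(1)] assms(2,3)]
  by (rule has_derivative_eq_rhs) (auto simp: compat G_linear assms)

abbreviation R where "R \<equiv> riemann \<Gamma>"

lemma R_antisym: "R x u v w = - R x v u w"
  by (simp add: riemann_def)

text \<open>Constant fields commute, so only the symmetry of \<Gamma> is needed: the derivative
  terms and the quadratic terms cancel separately in pairs.\<close>

lemma R_bianchi: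
  assumes "x \<in> Y" shows "R x u v w + R x v w u + R x w u v = 0"
proof -
  have "dd (\<lambda>y. \<Gamma> y v w) x u = dd (\<lambda>y. \<Gamma> y w v) x u" for u v w
    by (rule dd_cong[OF open_Y assms chr_sym])
  from this[of v w u] this[of w u v] this[of u v w] show ?thesis
    by (simp add: riemann_def chr_sym[OF assms, of v w] chr_sym[OF assms, of v u] chr_sym[OF assms, of w u])
qed

lemma linear_dchr1: "x \<in> Y \<Longrightarrow> linear (\<lambda>u. dd (\<lambda>y. \<Gamma> y u v) x w)"
  using chr_bilinear by (intro linear_dd_param[OF open_Y]) (auto simp: bilinear_def intro: diff_chr)

lemma linear_dchr2: "x \<in> Y \<Longrightarrow> linear (\<lambda>v. dd (\<lambda>y. \<Gamma> y u v) x w)"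
  by (rule linear_dd_param[OF open_Y]) (auto intro: chr_linear diff_chr)

lemma linear_dchr3: "x \<in> Y \<Longrightarrow> linear (dd (\<lambda>y. \<Gamma> y u v) x)"
  by (rule linear_dd[OF diff_chr])

lemma R_linear:
  assumes "x \<in> Y"
  shows "linear (\<lambda>u. R x u v w)" "linear (\<lambda>v. R x u v w)" "linear (R x u v)"
proof -
  note b = chr_bilinear[OF assms]
  note s = bilinear_ladd[OF b] bilinear_radd[OF b] bilinear_lmul[OF b] bilinear_rmul[OF b]
    linear_add[OF linear_dchr1[OF assms]] linear_add[OF linear_dchr2[OF assms]] linear_add[OF linear_dchr3[OF assms]]
    linear_scale[OF linear_dchr1[OF assms]] linear_scale[OF linear_dchr2[OF assms]] linear_scale[OF linear_dchr3[OF assms]]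
  show "linear (\<lambda>u. R x u v w)" "linear (\<lambda>v. R x u v w)" "linear (R x u v)"
    by (intro linearI; simp add: riemann_def s algebra_simps)+
qed

text \<open>The second derivatives of the function y |-> G y w z commute. When both are expanded
  with \<open>compat\<close>, the mixed products cancel and the difference is G (R u v w) z + G w (R
  u v z).\<close>

lemma R_skew:
  assumes "x \<in> Y" shows "G x (R x u v w) z = - G x (R x u v z) w"
proof -
  note C = chr_sym[OF assms]
  have d2: "dd (\<lambda>y. dd (\<lambda>y. G y w z) y v) x u =
      G x (dd (\<lambda>y. \<Gamma> y v w) x u + \<Gamma> x u (\<Gamma> x v w)) z + G x (\<Gamma> x v w) (\<Gamma> x u z)
    + G x (\<Gamma> x u w) (\<Gamma> x v z) + G x w (dd (\<lambda>y. \<Gamma> y v z) x u + \<Gamma> x u (\<Gamma> x v z))" for u v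
  proof -
    have "dd (\<lambda>y. dd (\<lambda>y. G y w z) y v) x u = dd (\<lambda>y. G y (\<Gamma> y v w) z + G y w (\<Gamma> y v z)) x u"
      by (rule dd_cong[OF open_Y assms compat])
    also have "\<dots> = (G x (dd (\<lambda>y. \<Gamma> y v w) x u + \<Gamma> x u (\<Gamma> x v w)) z + G x (\<Gamma> x v w) (\<Gamma> x u z))
      + (G x (\<Gamma> x u w) (\<Gamma> x v z) + G x w (dd (\<lambda>y. \<Gamma> y v z) x u + \<Gamma> x u (\<Gamma> x v z)))"
      using dd_eq[OF has_derivative_add[OF dd_metric[OF assms diff_chr[OF assms, of v w] differentiable_const[of z]]
         dd_metric[OF assms differentiable_const[of w] diff_chr[OF assms, of v z]]]]
      by simp
    finally show ?thesis by simp
  qed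
  have "dd (\<lambda>y. dd (\<lambda>y. G y w z) y v) x u = dd (\<lambda>y. dd (\<lambda>y. G y w z) y u) x v"
    by (rule dd_commute[OF open_Y assms smooth])
  then show ?thesis
    unfolding d2 by (simp add: riemann_def G_linear assms sym[OF assms, of w])
qed

end

section \<open>Algebraic curvature tensors and constant curvature\<close>

lemma quadratic_zero:
  fixes \<alpha> \<beta> \<gamma> :: real
  assumes "\<epsilon> > 0" "\<And>t. \<bar>t\<bar> < \<epsilon> \<Longrightarrow> \<alpha> + t * \<beta> + t * t * \<gamma> = 0"
  shows "\<gamma> = 0"
proof -
  have "\<alpha> = 0" using assms(2)[of 0] assms(1) by simp
  moreover have "(\<epsilon>/2) * (\<epsilon>/2) * \<gamma> = 0"
    using assms(2)[of "\<epsilon>/2"] assms(2)[of "-\<epsilon>/2"] assms(1) \<open>\<alpha> = 0\<close> by (simp add: field_simps)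
  ultimately show ?thesis using assms(1) by simp
qed

lemma quadratic_open:
  fixes \<alpha> \<beta> \<gamma> :: real
  assumes "\<alpha> > 0"
  obtains \<epsilon> where "\<epsilon> > 0" "\<And>t. \<bar>t\<bar> < \<epsilon> \<Longrightarrow> \<alpha> + t * \<beta> + t * t * \<gamma> > 0"
proof -
  have "isCont (\<lambda>t. \<alpha> + t * \<beta> + t * t * \<gamma>) 0" by (intro continuous_intros)
  then have "\<exists>d>0. \<forall>t. dist t 0 < d \<longrightarrow> dist (\<alpha> + t * \<beta> + t * t * \<gamma>) \<alpha> < \<alpha>"
    using assms unfolding continuous_at_eps_delta by (metis (no_types, lifting) add.right_neutral mult_zero_left)
  then obtain d where d: "d > 0" "\<And>t. \<bar>t\<bar> < d \<Longrightarrow> \<bar>t * \<beta> + t * t * \<gamma>\<bar> < \<alpha>"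
    by (auto simp: dist_real_def add.assoc)
  show thesis
  proof (rule that[OF d(1)])
    show "\<alpha> + t * \<beta> + t * t * \<gamma> > 0" if "\<bar>t\<bar> < d" for t using d(2)[OF that] by linarith
  qed
qed

text \<open>Pair symmetry makes F u v v w symmetric in u and w, so polarizing the outer pair gives F
  u v v w = 0. Polarizing the inner pair makes F skew in its two middle arguments, and then the
  three terms of the Bianchi identity coincide.\<close>

lemma curvature_like_zero:
  fixes F :: "'e::real_vector \<Rightarrow> 'e \<Rightarrow> 'e \<Rightarrow> 'e \<Rightarrow> real"
  assumes lin: "\<And>v w z. linear (\<lambda>u. F u v w z)"
    and a1: "\<And>u v w z. F u v w z = - F v u w z" and a2: "\<And>u v w z. F u v w z = - F u v z w"
    and bianchi: "\<And>u v w z. F u v w z + F v w u z + F w u v z = 0"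
    and zero: "\<And>u v. F u v v u = 0"
  shows "F u v w z = 0"
proof -
  have pair: "F u v w z = F w z u v" for u v w z
    using bianchi[of u v w z] bianchi[of v w z u] bianchi[of w z u v] bianchi[of z u v w]
      a1[of w u v z] a2[of u w v z] a2[of v w u z] a2[of w z v u] a1[of z v w u] a2[of v z w u]
      a2[of z u w v] a2[of u v z w]
    by linarith
  have lin4: "F u v w (z + z') = F u v w z + F u v w z'" for u v w z z'
    using a2[of u v w "z+z'"] a2[of u v w z] a2[of u v w z'] pair[of u v "z+z'" w] pair[of u v z w] pair[of u v z' w]
     linear_add[OF lin] by simp
  have lin2: "F u (v+v') w z = F u v w z + F u v' w z" for u v v' w z
    using a1[of u "v+v'" w z] a1[of u v w z] a1[of u v' w z] linear_add[OF lin] by simp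
  have lin3: "F u v (w+w') z = F u v w z + F u v w' z" for u v w w' z
    using a2[of u v "w+w'" z] a2[of u v w z] a2[of u v w' z] lin4 by simp
  have p1: "F u v v w = 0" for u v w
    using zero[of "u+w" v] zero[of u v] zero[of w v] pair[of u v v w] a1[of v w u v] a2[of w v u v]
    by (simp add: lin4 linear_add[OF lin])
  have p2: "F u v w z = - F u w v z" for u v w z
    using p1[of u "v+w" z] p1[of u v z] p1[of u w z] by (simp add: lin2 lin3)
  show ?thesis
    using bianchi[of u v w z] p2[of u v w z] a1[of u w v z] p2[of v w u z] a1[of v u w z] by linarith
qed

text \<open>A biquadratic form that vanishes on an open set of pairs vanishes identically; hence the
  sectional curvatures of the indefinite planes determine the curvature tensor.\<close>

lemma (in metric_field) constant_curvature:
  assumes x: "x \<in> Y"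
    and K: "\<And>u v. G x u u > 0 \<Longrightarrow> G x v v < 0 \<Longrightarrow>
        G x (R x u v v) u = k * (G x u u * G x v v - (G x u v)\<^sup>2)"
    and u0: "G x u0 u0 > 0" and v0: "G x v0 v0 < 0"
  shows "R x u v w = k *\<^sub>R (G x v w *\<^sub>R u - G x u w *\<^sub>R v)"
proof -
  define F where "F u v w z = G x (R x u v w) z - k * (G x v w * G x u z - G x u w * G x v z)" for u v w z
  note GL = G_linear[OF x]
  note RL = linear_add[OF R_linear(1)[OF x]] linear_add[OF R_linear(2)[OF x]] linear_add[OF R_linear(3)[OF x]]
    linear_scale[OF R_linear(1)[OF x]] linear_scale[OF R_linear(2)[OF x]] linear_scale[OF R_linear(3)[OF x]]
  have a1: "F u v w z = - F v u w z" for u v w z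
    using R_antisym[of x u v w] by (simp add: F_def GL algebra_simps)
  have a2: "F u v w z = - F u v z w" for u v w z
    using R_skew[OF x, of u v w z] by (simp add: F_def algebra_simps)
  have b: "F u v w z + F v w u z + F w u v z = 0" for u v w z
  proof -
    have "G x (R x u v w) z + G x (R x v w u) z + G x (R x w u v) z = G x (R x u v w + R x v w u + R x w u v) z"
      by (simp add: GL)
    then have "G x (R x u v w) z + G x (R x v w u) z + G x (R x w u v) z = 0"
      by (simp add: R_bianchi[OF x] GL)
    then show ?thesis
      by (simp add: F_def sym[OF x, of w] sym[OF x, of v u] algebra_simps)
  qed
  have lin: "linear (\<lambda>u. F u v w z)" for v w z
    by (rule linearI) (simp_all add: F_def RL GL algebra_simps)
  have lin4: "F u v w (z + z') = F u v w z + F u v w z'" "F u v w (c *\<^sub>R z) = c * F u v w z" for u v w z z' c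
    by (simp_all add: F_def GL algebra_simps)
  have K0: "F u v v u = 0" if "G x u u > 0" "G x v v < 0" for u v
    using K[OF that] by (simp add: F_def sym[OF x, of v u] power2_eq_square algebra_simps)
  \<comment> \<open>For small t the vector u0 + t z stays spacelike, so the polynomial F (u0 + t z)
    v v (u0 + t z) in t vanishes near 0. Its coefficient of t^2 is the claim.\<close>
  have step1: "F z v v z = 0" if v: "G x v v < 0" for z v
  proof -
    have gq: "G x (u0 + t *\<^sub>R z) (u0 + t *\<^sub>R z) = G x u0 u0 + t * (2 * G x u0 z) + t * t * G x z z" for t
      by (simp add: GL sym[OF x, of z u0] algebra_simps)
    obtain \<epsilon> where \<epsilon>: "\<epsilon> > 0" "\<And>t. \<bar>t\<bar> < \<epsilon> \<Longrightarrow> G x u0 u0 + t * (2 * G x u0 z) + t * t * G x z z > 0"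
      using quadratic_open[OF u0, of "2 * G x u0 z" "G x z z"] by blast
    have fq: "F (u0 + t *\<^sub>R z) v v (u0 + t *\<^sub>R z) = F u0 v v u0 + t * (F u0 v v z + F z v v u0) + t * t * F z v v z" for t
      by (simp add: linear_add[OF lin] linear_scale[OF lin] lin4 algebra_simps)
    show ?thesis
    proof (rule quadratic_zero[OF \<epsilon>(1)])
      fix t :: real assume "\<bar>t\<bar> < \<epsilon>"
      then have "G x (u0 + t *\<^sub>R z) (u0 + t *\<^sub>R z) > 0" using \<epsilon>(2) gq by metis
      from K0[OF this v] show "F u0 v v u0 + t * (F u0 v v z + F z v v u0) + t * t * F z v v z = 0"
        unfolding fq .
    qed
  qed
  have flip: "F u v v u = F v u u v" for u v using a1[of u v v u] a2[of v u v u] by simp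
  \<comment> \<open>The same argument for the other pair of arguments, along the timelike vectors v0
    + t v, removes the condition on v.\<close>
  have zero: "F u v v u = 0" for u v
  proof -
    have gq: "- G x (v0 + t *\<^sub>R v) (v0 + t *\<^sub>R v) = - G x v0 v0 + t * (- 2 * G x v0 v) + t * t * (- G x v v)" for t
      by (simp add: GL sym[OF x, of v v0] algebra_simps)
    obtain \<epsilon> where \<epsilon>: "\<epsilon> > 0" "\<And>t. \<bar>t\<bar> < \<epsilon> \<Longrightarrow> - G x v0 v0 + t * (- 2 * G x v0 v) + t * t * (- G x v v) > 0"
      using quadratic_open[of "- G x v0 v0" "- 2 * G x v0 v" "- G x v v"] v0 by auto
    have fq: "F (v0 + t *\<^sub>R v) u u (v0 + t *\<^sub>R v) = F v0 u u v0 + t * (F v0 u u v + F v u u v0) + t * t * F v u u v" for t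
      by (simp add: linear_add[OF lin] linear_scale[OF lin] lin4 algebra_simps)
    have "F v u u v = 0"
    proof (rule quadratic_zero[OF \<epsilon>(1)])
      fix t :: real assume "\<bar>t\<bar> < \<epsilon>"
      then have "G x (v0 + t *\<^sub>R v) (v0 + t *\<^sub>R v) < 0" using \<epsilon>(2) gq by (metis neg_0_less_iff_less)
      from step1[OF this, of u] show "F v0 u u v0 + t * (F v0 u u v + F v u u v0) + t * t * F v u u v = 0"
        unfolding fq[symmetric] flip[of "v0 + t *\<^sub>R v"] .
    qed
    then show ?thesis by (simp add: flip[of u])
  qed
  have "F u v w z = 0" for z by (rule curvature_like_zero[OF lin a1 a2 b zero])
  then show ?thesis
    by (intro G_eqI[OF x]) (simp add: F_def GL algebra_simps)
qed

section \<open>Gauss and Codazzi equations\<close>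

text \<open>The map f is either an immersion read in charts or a transition map; hence no relation
  between the dimensions and no isometry condition.\<close>

locale smooth_along = metric_field Y G
  for Y :: "'e::euclidean_space set" and G +
  fixes V :: "'a::euclidean_space set" and f :: "'a \<Rightarrow> 'e"
  assumes open_V: "open V" and smooth_f: "smooth_on V f" and f_into: "x \<in> V \<Longrightarrow> f x \<in> Y"
begin

text \<open>The pull-back connection along f: X is a vector field along f, that is, X x is tangent
  to the ambient space at f x.\<close>

definition cov :: "('a \<Rightarrow> 'e) \<Rightarrow> 'a \<Rightarrow> 'a \<Rightarrow> 'e" where
  "cov X x u = dd X x u + \<Gamma> (f x) (dd f x u) (X x)"

lemma f_img: "f ` V \<subseteq> Y" using f_into by auto

lemma diff_f: "x \<in> V \<Longrightarrow> f differentiable (at x)"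
  by (rule smooth_on_differentiable[OF smooth_f])

lemma linear_df: "x \<in> V \<Longrightarrow> linear (dd f x)"
  by (rule linear_dd[OF diff_f])

lemma smooth_df: "smooth_on V (\<lambda>x. dd f x u)"
  by (rule smooth_on_dd[OF smooth_f])

lemma chain: 
  assumes "x \<in> V" "h differentiable (at (f x))"
  shows "((\<lambda>y. h (f y)) has_derivative (\<lambda>u. dd h (f x) (dd f x u))) (at x)"
  using diff_chain_at[OF has_derivative_dd[OF diff_f[OF assms(1)]] has_derivative_dd[OF assms(2)]]
  by (simp add: o_def)

lemma smooth_G_along: "smooth_on V X \<Longrightarrow> smooth_on V Z \<Longrightarrow> smooth_on V (\<lambda>x. G (f x) (X x) (Z x))"
  by (rule smooth_on_apply2[OF open_V, where T = "\<lambda>x. G (f x)"])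
     (auto intro: bil f_into smooth_on_compose[OF open_V open_Y f_img smooth_f smooth])

lemma smooth_chr_along: "smooth_on V X \<Longrightarrow> smooth_on V Z \<Longrightarrow> smooth_on V (\<lambda>x. \<Gamma> (f x) (X x) (Z x))"
  by (rule smooth_on_apply2[OF open_V, where T = "\<lambda>x. \<Gamma> (f x)"])
     (auto intro: chr_bilinear f_into smooth_on_compose[OF open_V open_Y f_img smooth_f smooth_chr])

lemma smooth_cov: "smooth_on V X \<Longrightarrow> smooth_on V (\<lambda>x. cov X x u)"
  unfolding cov_def by (intro smooth_on_add[OF open_V] smooth_on_dd smooth_chr_along smooth_df)

lemma cov_cong: "x \<in> V \<Longrightarrow> (\<And>y. y \<in> V \<Longrightarrow> X y = Z y) \<Longrightarrow> cov X x u = cov Z x u"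
  unfolding cov_def using dd_cong[OF open_V, of x X Z] by simp

lemma cov_df_sym: "x \<in> V \<Longrightarrow> cov (\<lambda>x. dd f x v) x u = cov (\<lambda>x. dd f x u) x v"
  unfolding cov_def using dd_commute[OF open_V _ smooth_f] chr_sym[OF f_into] by auto

lemma dd_metric_along:
  assumes x: "x \<in> V" and X: "X differentiable (at x)" and Z: "Z differentiable (at x)"
  shows "dd (\<lambda>y. G (f y) (X y) (Z y)) x u = G (f x) (cov X x u) (Z x) + G (f x) (X x) (cov Z x u)"
proof -
  note c = chain[OF x diff_G[OF f_into[OF x]]]
  have "((\<lambda>y. G (f y) (X y) (Z y)) has_derivative
    (\<lambda>u. dd (\<lambda>y. G (f y) (X x) (Z x)) x u + G (f x) (dd X x u) (Z x) + G (f x) (X x) (dd Z x u))) (at x)"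
    by (rule has_derivative_apply2[OF open_V x, where T = "\<lambda>x. G (f x)", OF bil[OF f_into] differentiableI[OF c] X Z])
  from dd_eq[OF this] show ?thesis
    by (simp add: dd_eq[OF c] compat f_into x G_linear cov_def)
qed

text \<open>The curvature of the pull-back connection is the pull-back of the curvature. The second
  derivatives of f and of X drop out by symmetry.\<close>

lemma cov_commute:
  assumes x: "x \<in> V" and X: "smooth_on V X"
  shows "cov (\<lambda>x. cov X x v) x u - cov (\<lambda>x. cov X x u) x v = R (f x) (dd f x u) (dd f x v) (X x)"
proof -
  note y = f_into[OF x]
  note c = chain[OF x diff_chr[OF y]]
  have dX: "X differentiable (at x)" using X x by (rule smooth_on_differentiable)
  have d: "dd (\<lambda>x. cov X x v) x u = dd (\<lambda>x. dd X x v) x u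
     + (dd (\<lambda>y. \<Gamma> y (dd f x v) (X x)) (f x) (dd f x u)
       + \<Gamma> (f x) (dd (\<lambda>x. dd f x v) x u) (X x) + \<Gamma> (f x) (dd f x v) (dd X x u))" for u v
  proof -
    have "((\<lambda>y. \<Gamma> (f y) (dd f y v) (X y)) has_derivative (\<lambda>u. dd (\<lambda>y. \<Gamma> (f y) (dd f x v) (X x)) x u
       + \<Gamma> (f x) (dd (\<lambda>x. dd f x v) x u) (X x) + \<Gamma> (f x) (dd f x v) (dd X x u))) (at x)"
      by (rule has_derivative_apply2[OF open_V x, where T = "\<lambda>x. \<Gamma> (f x)", OF chr_bilinear[OF f_into] differentiableI[OF c]
          smooth_on_differentiable[OF smooth_df x] dX])
    from dd_eq[OF has_derivative_add[OF has_derivative_dd[OF smooth_on_differentiable[OF smooth_on_dd[OF X] x]] this]]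
    show ?thesis unfolding cov_def by (simp add: dd_eq[OF c])
  qed
  note b = chr_bilinear[OF y]
  show ?thesis
    unfolding cov_def[of "\<lambda>x. cov X x v"] cov_def[of "\<lambda>x. cov X x u"] d
      dd_commute[OF open_V x smooth_f, of v u] dd_commute[OF open_V x X, of v u]
    by (simp add: cov_def riemann_def bilinear_radd[OF b] algebra_simps)
qed

text \<open>Derivatives of g obey the product rule for \<open>cov\<close>, and the covariant
  derivative of df is symmetric; so the Koszul combination for g isolates the tangential component
  of that derivative. The argument covers hypersurfaces and isometric changes of chart at
  once.\<close>

lemma pullback_chr:
  assumes g: "metric_field V g" and x: "x \<in> V"
    and iso: "\<And>x u v. x \<in> V \<Longrightarrow> g x u v = G (f x) (dd f x u) (dd f x v)"
  shows "G (f x) (cov (\<lambda>x. dd f x v) x u) (dd f x z) = g x (levi_civita g x u v) z"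
proof -
  interpret g: metric_field V g by (rule g)
  have d: "dd (\<lambda>y. g y v z) x u = G (f x) (cov (\<lambda>x. dd f x v) x u) (dd f x z) + G (f x) (dd f x v) (cov (\<lambda>x. dd f x z) x u)" for u v z
  proof -
    have "dd (\<lambda>y. g y v z) x u = dd (\<lambda>y. G (f y) (dd f y v) (dd f y z)) x u"
      by (rule dd_cong[OF open_V x iso])
    then show ?thesis
      using dd_metric_along[OF x smooth_on_differentiable[OF smooth_df x] smooth_on_differentiable[OF smooth_df x]] by simp
  qed
  show ?thesis
    using g.koszul[OF x, of u v z]
    unfolding d cov_df_sym[OF x, of v u] cov_df_sym[OF x, of z u] cov_df_sym[OF x, of z v]
    by (simp add: sym[OF f_into[OF x], of "dd f x v"] sym[OF f_into[OF x], of "dd f x u"] )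
qed

end

text \<open>The immersion in one pair of charts. The metric g is a parameter tied to G by
  \<open>iso\<close>, because M comes with its metric; \<open>const_curv\<close> is supplied later
  by \<open>constant_curvature\<close>.\<close>

locale hypersurface = smooth_along Y G V f + g: metric_field V g
  for Y :: "'e::euclidean_space set" and G and V :: "'a::euclidean_space set" and f g +
  fixes \<nu> :: "'a \<Rightarrow> 'e" and k :: real
  assumes dim: "DIM('e) = DIM('a) + 1"
    and iso: "x \<in> V \<Longrightarrow> g x u v = G (f x) (dd f x u) (dd f x v)"
    and pos: "x \<in> V \<Longrightarrow> u \<noteq> 0 \<Longrightarrow> g x u u > 0"
    and smooth_\<nu>: "smooth_on V \<nu>"
    and unit: "x \<in> V \<Longrightarrow> G (f x) (\<nu> x) (\<nu> x) = -1"
    and normal: "x \<in> V \<Longrightarrow> G (f x) (\<nu> x) (dd f x u) = 0"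
    and const_curv: "x \<in> V \<Longrightarrow> R (f x) X Z W = k *\<^sub>R (G (f x) Z W *\<^sub>R X - G (f x) X W *\<^sub>R Z)"
begin

abbreviation \<gamma> where "\<gamma> \<equiv> levi_civita g"

definition h :: "'a \<Rightarrow> 'a \<Rightarrow> 'a \<Rightarrow> real" where
  "h x u v = G (f x) (cov (\<lambda>x. dd f x v) x u) (\<nu> x)"

text \<open>The shape operator, h with one index raised. That the choice succeeds is
  \<open>g_A\<close>.\<close>

definition A :: "'a \<Rightarrow> 'a \<Rightarrow> 'a" where
  "A x u = (SOME w. \<forall>z. g x w z = h x u z)"

lemma normal': "x \<in> V \<Longrightarrow> G (f x) (dd f x u) (\<nu> x) = 0"
  using normal[of x u] sym[OF f_into, of x "\<nu> x"] by simp

lemma inj_df: assumes "x \<in> V" "dd f x u = dd f x v" shows "u = v"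
proof (rule g.G_eqI[OF assms(1)])
  show "g x u z = g x v z" for z using assms by (simp add: iso)
qed

lemma diff_\<nu>: "x \<in> V \<Longrightarrow> \<nu> differentiable (at x)"
  by (rule smooth_on_differentiable[OF smooth_\<nu>])

text \<open>The normal is orthogonal to the image of df but not to itself, hence outside this image.
  The image has codimension 1, so together with the normal it spans the ambient tangent
  space.\<close>

lemma tangent_normal_eqI:
  assumes x: "x \<in> V" and t: "\<And>z. G (f x) X (dd f x z) = G (f x) Z (dd f x z)"
    and n: "G (f x) X (\<nu> x) = G (f x) Z (\<nu> x)"
  shows "X = Z"
proof (rule G_eqI[OF f_into[OF x]])
  note y = f_into[OF x]
  let ?W = "range (dd f x)"
  have W: "subspace ?W" using linear_subspace_image[OF linear_df[OF x] subspace_UNIV] .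
  have "\<nu> x \<notin> span ?W"
  proof
    assume "\<nu> x \<in> span ?W"
    then obtain z where "\<nu> x = dd f x z" using W by (auto simp: span_eq_iff[THEN iffD2])
    then show False using normal[OF x, of z] unit[OF x] by simp
  qed
  then have "dim (insert (\<nu> x) ?W) = dim ?W + 1" by (simp add: dim_insert)
  also have "dim ?W = DIM('a)"
    using dim_image_eq[OF linear_df[OF x], of UNIV] inj_df[OF x] by (auto simp: inj_on_def)
  finally have sp: "span (insert (\<nu> x) ?W) = UNIV" using dim by (metis dim_eq_full)
  fix z
  have "z \<in> span (insert (\<nu> x) ?W)" using sp by simp
  then show "G (f x) X z = G (f x) Z z"
  proof (induction rule: span_induct_alt)
    case base then show ?case by (simp add: G_linear y)
  next
    case (step c b z)
    then have "G (f x) X b = G (f x) Z b" using t n by auto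
    then show ?case using step by (simp add: G_linear y)
  qed
qed

lemma linear_cov_df: assumes "x \<in> V" shows "linear (\<lambda>u. cov (\<lambda>x. dd f x v) x u)"
  using linear_dd[OF smooth_on_differentiable[OF smooth_df assms], of v] linear_df[OF assms] chr_bilinear[OF f_into[OF assms]]
  unfolding cov_def by (auto simp: linear_iff bilinear_def scaleR_add_right)

lemma h_sym: "x \<in> V \<Longrightarrow> h x u v = h x v u"
  by (simp add: h_def cov_df_sym[of x u v])

lemma linear_h: assumes "x \<in> V" shows "linear (h x u)"
proof -
  have "linear (\<lambda>v. cov (\<lambda>x. dd f x u) x v)" by (rule linear_cov_df[OF assms])
  then show ?thesis unfolding h_def cov_df_sym[OF assms, of _ u]
    by (auto simp: linear_iff G_linear f_into assms)
qed

lemma smooth_h: "smooth_on V (\<lambda>x. h x u v)"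
  unfolding h_def by (intro smooth_G_along smooth_cov smooth_df smooth_\<nu>)

lemma g_A: assumes "x \<in> V" shows "g x (A x u) z = h x u z"
proof -
  obtain w where "\<And>z. g x w z = h x u z" using g.riesz[OF assms linear_h[OF assms]] by blast
  then have "\<forall>z. g x (A x u) z = h x u z" unfolding A_def by (intro someI[where P = "\<lambda>w. \<forall>z. g x w z = h x u z"]) blast
  then show ?thesis by blast
qed

lemma linear_A: assumes "x \<in> V" shows "linear (A x)"
proof (rule linearI; rule g.G_eqI[OF assms])
  have "(\<lambda>u. h x u z) = h x z" for z using h_sym[OF assms] by auto
  then have hl: "linear (\<lambda>u. h x u z)" for z using linear_h[OF assms] by simp
  show "g x (A x (u + v)) z = g x (A x u + A x v) z" for u v z
    by (simp add: g_A assms g.G_linear linear_add[OF hl])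
  show "g x (A x (c *\<^sub>R u)) z = g x (c *\<^sub>R A x u) z" for c u z
    by (simp add: g_A assms g.G_linear linear_scale[OF hl])
qed

lemma smooth_A: "smooth_on V (\<lambda>x. A x u)"
  by (rule g.smooth_riesz[OF open_V _ smooth_on_id smooth_h]) (auto simp: g_A)

lemma A_selfadjoint: "x \<in> V \<Longrightarrow> g x (A x u) v = g x u (A x v)"
  using g_A[of x u v] g_A[of x v u] h_sym[of x u v] g.sym[of x u "A x v"] by simp

text \<open>The normal part carries a minus sign because G \<nu> \<nu> = -1, while h is the product
  with \<nu>.\<close>

lemma gauss_formula:
  assumes x: "x \<in> V"
  shows "cov (\<lambda>x. dd f x v) x u = dd f x (\<gamma> x u v) - h x u v *\<^sub>R \<nu> x"
proof (rule tangent_normal_eqI[OF x])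
  show "G (f x) (cov (\<lambda>x. dd f x v) x u) (dd f x z) = G (f x) (dd f x (\<gamma> x u v) - h x u v *\<^sub>R \<nu> x) (dd f x z)" for z
    using pullback_chr[OF g.metric_field_axioms x iso, of v u z]
    by (simp add: G_linear f_into x normal iso[OF x, symmetric])
  show "G (f x) (cov (\<lambda>x. dd f x v) x u) (\<nu> x) = G (f x) (dd f x (\<gamma> x u v) - h x u v *\<^sub>R \<nu> x) (\<nu> x)"
    by (simp add: h_def[symmetric] G_linear f_into x normal' unit)
qed

text \<open>Differentiating G \<nu> (df z) = 0 gives the tangential part, and differentiating G
  \<nu> \<nu> = -1 shows that there is no normal part.\<close>

lemma weingarten_formula:
  assumes x: "x \<in> V"
  shows "cov \<nu> x u = - dd f x (A x u)"
proof (rule tangent_normal_eqI[OF x])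
  note y = f_into[OF x]
  show "G (f x) (cov \<nu> x u) (dd f x z) = G (f x) (- dd f x (A x u)) (dd f x z)" for z
  proof -
    have "dd (\<lambda>y. G (f y) (\<nu> y) (dd f y z)) x u = dd (\<lambda>y. 0) x u"
      by (rule dd_cong[OF open_V x normal])
    then have "G (f x) (cov \<nu> x u) (dd f x z) + G (f x) (\<nu> x) (cov (\<lambda>x. dd f x z) x u) = 0"
      using dd_metric_along[OF x diff_\<nu>[OF x] smooth_on_differentiable[OF smooth_df x]] by simp
    then show ?thesis
      using g_A[OF x, of u z] sym[OF y, of "\<nu> x"] by (simp add: h_def G_linear y iso[OF x])
  qed
  have "dd (\<lambda>y. G (f y) (\<nu> y) (\<nu> y)) x u = dd (\<lambda>y. -1) x u"
    by (rule dd_cong[OF open_V x unit])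
  then have "G (f x) (cov \<nu> x u) (\<nu> x) = 0"
    using dd_metric_along[OF x diff_\<nu>[OF x] diff_\<nu>[OF x], of u] sym[OF y, of "\<nu> x"] by simp
  then show "G (f x) (cov \<nu> x u) (\<nu> x) = G (f x) (- dd f x (A x u)) (\<nu> x)"
    by (simp add: G_linear y normal' x)
qed

lemma cov_tangent_normal:
  assumes x: "x \<in> V" and Z: "Z differentiable (at x)" and s: "s differentiable (at x)"
  shows "cov (\<lambda>x. dd f x (Z x) - s x *\<^sub>R \<nu> x) x u = dd f x (dd Z x u + \<gamma> x u (Z x) + s x *\<^sub>R A x u)
     - (h x u (Z x) + dd s x u) *\<^sub>R \<nu> x"
proof -
  note y = f_into[OF x]
  note b = chr_bilinear[OF y]
  note l = linear_df[OF x]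
  have "((\<lambda>x. dd f x (Z x) - s x *\<^sub>R \<nu> x) has_derivative
      (\<lambda>u. (dd (\<lambda>y. dd f y (Z x)) x u + dd f x (dd Z x u)) - (s x *\<^sub>R dd \<nu> x u + dd s x u *\<^sub>R \<nu> x))) (at x)"
    by (intro has_derivative_diff has_derivative_apply[OF open_V x linear_df] has_derivative_scaleR
        has_derivative_dd Z s diff_\<nu>[OF x] smooth_on_differentiable[OF smooth_df x])
  from dd_eq[OF this]
  have "cov (\<lambda>x. dd f x (Z x) - s x *\<^sub>R \<nu> x) x u = cov (\<lambda>y. dd f y (Z x)) x u + dd f x (dd Z x u)
      - s x *\<^sub>R cov \<nu> x u - dd s x u *\<^sub>R \<nu> x"
    by (simp add: cov_def bilinear_rsub[OF b] bilinear_rmul[OF b] algebra_simps)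
  then show ?thesis
    unfolding gauss_formula[OF x] weingarten_formula[OF x]
    by (simp add: linear_add[OF l] linear_scale[OF l] linear_neg[OF l] algebra_simps)
qed

text \<open>Both sides are the commutator of covariant derivatives applied to df w: on the left by
  differentiating the Gauss formula once more, on the right by constant curvature. The tangential
  part is the Gauss equation and the normal part is the Codazzi equation.\<close>

lemma gauss_codazzi_aux:
  assumes x: "x \<in> V"
  shows "dd f x (riemann \<gamma> x u v w + h x v w *\<^sub>R A x u - h x u w *\<^sub>R A x v)
     - (h x u (\<gamma> x v w) + dd (\<lambda>y. h y v w) x u - h x v (\<gamma> x u w) - dd (\<lambda>y. h y u w) x v) *\<^sub>R \<nu> x
   = dd f x (k *\<^sub>R (g x v w *\<^sub>R u - g x u w *\<^sub>R v))"
proof -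
  note l = linear_df[OF x]
  have c: "cov (\<lambda>x. cov (\<lambda>x. dd f x w) x v) x u = dd f x (dd (\<lambda>x. \<gamma> x v w) x u + \<gamma> x u (\<gamma> x v w) + h x v w *\<^sub>R A x u)
     - (h x u (\<gamma> x v w) + dd (\<lambda>y. h y v w) x u) *\<^sub>R \<nu> x" for u v
  proof -
    have "cov (\<lambda>x. cov (\<lambda>x. dd f x w) x v) x u = cov (\<lambda>x. dd f x (\<gamma> x v w) - h x v w *\<^sub>R \<nu> x) x u"
      by (rule cov_cong[OF x gauss_formula])
    then show ?thesis
      using cov_tangent_normal[OF x g.diff_chr[OF x] smooth_on_differentiable[OF smooth_h x]] by simp
  qed
  have "cov (\<lambda>x. cov (\<lambda>x. dd f x w) x v) x u - cov (\<lambda>x. cov (\<lambda>x. dd f x w) x u) x v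
      = dd f x (k *\<^sub>R (g x v w *\<^sub>R u - g x u w *\<^sub>R v))"
    unfolding cov_commute[OF x smooth_df] const_curv[OF x] iso[OF x]
    by (simp add: linear_diff[OF l] linear_scale[OF l])
  then show ?thesis unfolding c
    by (simp add: riemann_def linear_add[OF l] linear_diff[OF l] linear_scale[OF l] algebra_simps)
qed

lemma gauss_equation:
  assumes x: "x \<in> V"
  shows "riemann \<gamma> x u v w = k *\<^sub>R (g x v w *\<^sub>R u - g x u w *\<^sub>R v) - (h x v w *\<^sub>R A x u - h x u w *\<^sub>R A x v)"
proof -
  have "riemann \<gamma> x u v w + h x v w *\<^sub>R A x u - h x u w *\<^sub>R A x v = k *\<^sub>R (g x v w *\<^sub>R u - g x u w *\<^sub>R v)"
  proof (rule g.G_eqI[OF x])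
    fix z
    show "g x (riemann \<gamma> x u v w + h x v w *\<^sub>R A x u - h x u w *\<^sub>R A x v) z = g x (k *\<^sub>R (g x v w *\<^sub>R u - g x u w *\<^sub>R v)) z"
      unfolding iso[OF x] gauss_codazzi_aux[OF x, of u v w, unfolded iso[OF x], symmetric]
      by (simp add: G_linear f_into x normal)
  qed
  then show ?thesis by (simp add: algebra_simps)
qed

text \<open>With constant curvature the commutator is tangential, so its normal component vanishes.
  The term A (\<gamma> u v) of the covariant derivative of A is symmetric in u and v and is
  therefore left out on both sides.\<close>

lemma codazzi:
  assumes x: "x \<in> V"
  shows "dd (\<lambda>y. A y v) x u + \<gamma> x u (A x v) = dd (\<lambda>y. A y u) x v + \<gamma> x v (A x u)"
proof (rule g.G_eqI[OF x])
  fix w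
  have "G (f x) (dd f x (riemann \<gamma> x u v w + h x v w *\<^sub>R A x u - h x u w *\<^sub>R A x v)
     - (h x u (\<gamma> x v w) + dd (\<lambda>y. h y v w) x u - h x v (\<gamma> x u w) - dd (\<lambda>y. h y u w) x v) *\<^sub>R \<nu> x) (\<nu> x) = 0"
    unfolding gauss_codazzi_aux[OF x] by (rule normal'[OF x])
  then have 1: "h x u (\<gamma> x v w) + dd (\<lambda>y. h y v w) x u = h x v (\<gamma> x u w) + dd (\<lambda>y. h y u w) x v"
    by (simp add: G_linear f_into x normal' unit)
  have 2: "dd (\<lambda>y. h y v w) x u = g x (dd (\<lambda>y. A y v) x u + \<gamma> x u (A x v)) w + h x v (\<gamma> x u w)" for u v
  proof -
    have "dd (\<lambda>y. h y v w) x u = dd (\<lambda>y. g y (A y v) w) x u"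
      by (rule dd_cong[OF open_V x]) (simp add: g_A)
    also have "\<dots> = g x (dd (\<lambda>y. A y v) x u + \<gamma> x u (A x v)) w + g x (A x v) (\<gamma> x u w)"
      using dd_eq[OF g.dd_metric[OF x smooth_on_differentiable[OF smooth_A x] differentiable_const]] by simp
    finally show ?thesis by (simp add: g_A x)
  qed
  show "g x (dd (\<lambda>y. A y v) x u + \<gamma> x u (A x v)) w = g x (dd (\<lambda>y. A y u) x v + \<gamma> x v (A x u)) w"
    using 1 unfolding 2 by simp
qed

end

section \<open>Frames, traces and Okumura's inequality\<close>

definition orthonormal_for :: "('a::euclidean_space \<Rightarrow> 'a \<Rightarrow> real) \<Rightarrow> (nat \<Rightarrow> 'a) \<Rightarrow> bool" where
  "orthonormal_for B e \<longleftrightarrow> (\<forall>i<DIM('a). \<forall>j<DIM('a). B (e i) (e j) = (if i = j then 1 else 0))"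

text \<open>Gram-Schmidt, adding one vector at a time while the span is still proper.\<close>

lemma orthonormal_for_exists:
  fixes B :: "'a::euclidean_space \<Rightarrow> 'a \<Rightarrow> real"
  assumes bil: "bilinear B" and sym: "\<And>u v. B u v = B v u" and pos: "\<And>u. u \<noteq> 0 \<Longrightarrow> B u u > 0"
  shows "\<exists>e. orthonormal_for B e"
proof -
  have "m \<le> DIM('a) \<Longrightarrow> \<exists>e. \<forall>i<m. \<forall>j<m. B (e i) (e j) = (if i = j then 1 else 0)" for m
  proof (induction m)
    case (Suc m)
    then obtain e where e: "\<And>i j. i < m \<Longrightarrow> j < m \<Longrightarrow> B (e i) (e j) = (if i = j then 1 else 0)" by auto
    have "dim (e ` {..<m}) \<le> card (e ` {..<m})" by (simp add: dim_le_card')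
    also have "\<dots> < DIM('a)" using card_image_le[of "{..<m}" e] Suc.prems by simp
    finally have "span (e ` {..<m}) \<noteq> UNIV" using dim_eq_full[of "e ` {..<m}"] by auto
    then obtain v where v: "v \<notin> span (e ` {..<m})" by auto
    define w where "w = v - (\<Sum>i<m. B v (e i) *\<^sub>R e i)"
    have "(\<Sum>i<m. B v (e i) *\<^sub>R e i) \<in> span (e ` {..<m})"
      by (intro span_sum span_scale span_base) auto
    then have "w \<noteq> 0" using v unfolding w_def by auto
    have we: "B w (e j) = 0" if "j < m" for j
    proof -
      have "B w (e j) = B v (e j) - (\<Sum>i<m. B v (e i) * B (e i) (e j))"
        using bil unfolding w_def
        by (simp add: bilinear_lsub bilinear_def linear_sum[of "\<lambda>x. B x (e j)"] linear_scale[of "\<lambda>x. B x (e j)"])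
      also have "(\<Sum>i<m. B v (e i) * B (e i) (e j)) = (\<Sum>i<m. if i = j then B v (e i) else 0)"
        using e that by (intro sum.cong) auto
      finally show ?thesis using that by simp
    qed
    define u where "u = (1 / sqrt (B w w)) *\<^sub>R w"
    have uu: "B u u = 1" using pos[OF \<open>w \<noteq> 0\<close>] bil
      by (simp add: u_def bilinear_lmul bilinear_rmul)
    have ue: "B u (e j) = 0" "B (e j) u = 0" if "j < m" for j
      using we[OF that] bil sym[of "e j" w] by (simp_all add: u_def bilinear_lmul bilinear_rmul)
    show ?case
      by (rule exI[of _ "e(m := u)"]) (auto simp: less_Suc_eq uu ue e)
  qed auto
  then show ?thesis unfolding orthonormal_for_def by blast
qed

text \<open>\<phi> sends the standard basis, numbered by \<beta>, to e. Pairing with e recovers the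
  coordinates, so \<phi> is injective and, for reasons of dimension, surjective.\<close>

lemma orthonormal_expansion:
  fixes B :: "'a::euclidean_space \<Rightarrow> 'a \<Rightarrow> real"
  assumes bil: "bilinear B" and e: "orthonormal_for B e"
  shows "v = (\<Sum>i<DIM('a). B v (e i) *\<^sub>R e i)"
proof -
  obtain \<beta> where \<beta>: "bij_betw \<beta> {0..<DIM('a)} (Basis :: 'a set)"
    using ex_bij_betw_nat_finite[OF finite_Basis] by blast
  define \<phi> where "\<phi> c = (\<Sum>i<DIM('a). (c \<bullet> \<beta> i) *\<^sub>R e i)" for c
  have lin: "linear \<phi>"
    by (rule linearI) (simp_all add: \<phi>_def inner_add_left scaleR_add_left sum.distrib scaleR_sum_right)
  have coord: "B (\<phi> c) (e j) = c \<bullet> \<beta> j" if "j < DIM('a)" for c j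
  proof -
    have "B (\<phi> c) (e j) = (\<Sum>i<DIM('a). (c \<bullet> \<beta> i) * B (e i) (e j))"
      using bil unfolding \<phi>_def
      by (simp add: bilinear_def linear_sum[of "\<lambda>x. B x (e j)"] linear_scale[of "\<lambda>x. B x (e j)"])
    also have "\<dots> = (\<Sum>i<DIM('a). if i = j then c \<bullet> \<beta> i else 0)"
      using e that by (intro sum.cong) (auto simp: orthonormal_for_def)
    finally show ?thesis using that by simp
  qed
  have "inj \<phi>"
  proof (rule linear_injective_0[OF lin, THEN iffD2], intro allI impI)
    fix c assume c: "\<phi> c = 0"
    show "c = 0"
    proof (rule euclidean_eqI)
      fix b :: 'a assume "b \<in> Basis"
      then obtain j where "j < DIM('a)" "b = \<beta> j" using \<beta> by (force simp: bij_betw_def)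
      then show "c \<bullet> b = 0 \<bullet> b" using coord[of j c] c bil by (simp add: bilinear_lzero)
    qed
  qed
  then have "surj \<phi>" using linear_injective_imp_surjective[OF lin] by blast
  then obtain c where c: "v = \<phi> c" by (metis surjD)
  show ?thesis unfolding c by (subst \<phi>_def) (simp add: coord)
qed

text \<open>The sum runs over a fixed basis and hence commutes with differentiation in the base
  point; \<open>trace_of_orthonormal\<close> passes to frames afterwards.\<close>

definition trace_of :: "('a::euclidean_space \<Rightarrow> 'a) \<Rightarrow> real" where
  "trace_of T = (\<Sum>b\<in>Basis. T b \<bullet> b)"

lemma trace_of_add: "trace_of (\<lambda>v. S v + T v) = trace_of S + trace_of T"
  by (simp add: trace_of_def inner_add_left sum.distrib)

lemma trace_of_diff: "trace_of (\<lambda>v. S v - T v) = trace_of S - trace_of T"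
  by (simp add: trace_of_def inner_diff_left sum_subtractf)

lemma trace_of_commute:
  fixes S T :: "'a::euclidean_space \<Rightarrow> 'a"
  assumes "linear S" "linear T" shows "trace_of (\<lambda>v. S (T v)) = trace_of (\<lambda>v. T (S v))"
proof -
  have "trace_of (\<lambda>v. S (T v)) = (\<Sum>b\<in>Basis. \<Sum>c\<in>Basis. (T b \<bullet> c) * (S c \<bullet> b))" if "linear S"
    for S T :: "'a \<Rightarrow> 'a"
    unfolding trace_of_def by (subst linear_basis_expansion[OF that]) (simp add: inner_sum_left)
  note e = this
  show ?thesis
    unfolding e[OF assms(1)] e[OF assms(2)] by (subst sum.swap) (simp add: mult.commute)
qed

lemma trace_of_orthonormal:
  fixes B :: "'a::euclidean_space \<Rightarrow> 'a \<Rightarrow> real"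
  assumes bil: "bilinear B" and e: "orthonormal_for B e" and T: "linear T"
  shows "trace_of T = (\<Sum>i<DIM('a). B (T (e i)) (e i))"
proof -
  have lB: "linear (\<lambda>u. B (T u) (e i))" for i
    using linear_compose[OF T, of "\<lambda>u. B u (e i)"] bil by (simp add: bilinear_def o_def)
  have "trace_of T = (\<Sum>b\<in>Basis. (\<Sum>i<DIM('a). B (T b) (e i) *\<^sub>R e i) \<bullet> b)"
    by (simp only: trace_of_def orthonormal_expansion[OF bil e, symmetric])
  also have "\<dots> = (\<Sum>i<DIM('a). \<Sum>b\<in>Basis. (e i \<bullet> b) * B (T b) (e i))"
    by (simp add: inner_sum_left sum.swap[of _ Basis] mult.commute)
  also have "\<dots> = (\<Sum>i<DIM('a). B (T (e i)) (e i))"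
  proof (intro sum.cong refl)
    show "(\<Sum>b\<in>Basis. (e i \<bullet> b) * B (T b) (e i)) = B (T (e i)) (e i)" for i
      using linear_basis_expansion[OF lB[of i], of "e i"] by simp
  qed
  finally show ?thesis .
qed

lemma orthonormal_inner:
  fixes B :: "'a::euclidean_space \<Rightarrow> 'a \<Rightarrow> real"
  assumes bil: "bilinear B" and e: "orthonormal_for B e"
  shows "B u v = (\<Sum>i<DIM('a). B u (e i) * B (e i) v)"
proof -
  have "B u v = B (\<Sum>i<DIM('a). B u (e i) *\<^sub>R e i) v" using orthonormal_expansion[OF bil e, of u] by simp
  then show ?thesis using bil
    by (simp add: bilinear_def linear_sum[of "\<lambda>x. B x v"] linear_scale[of "\<lambda>x. B x v"])
qed

lemma sum_kronecker:
  fixes j n :: nat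
  shows "j < n \<Longrightarrow> (\<Sum>i<n. f i * (if i = j then 1 else 0)) = (f j :: real)"
    "j < n \<Longrightarrow> (\<Sum>i<n. f i * (if j = i then 1 else 0)) = (f j :: real)"
    "j < n \<Longrightarrow> (\<Sum>i<n. (if i = j then 1 else 0) * f i) = (f j :: real)"
    "j < n \<Longrightarrow> (\<Sum>i<n. (if j = i then 1 else 0) * f i) = (f j :: real)"
proof -
  assume j: "j < n"
  have "(\<Sum>i<n. f i * (if i = j then 1 else 0)) = (\<Sum>i<n. if i = j then f i else 0)"
    by (intro sum.cong) auto
  then show *: "(\<Sum>i<n. f i * (if i = j then 1 else 0)) = f j" using j by (simp add: sum.delta)
  show "(\<Sum>i<n. f i * (if j = i then 1 else 0)) = f j" unfolding *[symmetric] by (intro sum.cong) auto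
  show "(\<Sum>i<n. (if i = j then 1 else 0) * f i) = f j" unfolding *[symmetric] by (intro sum.cong) auto
  show "(\<Sum>i<n. (if j = i then 1 else 0) * f i) = f j" unfolding *[symmetric] by (intro sum.cong) auto
qed

text \<open>Cauchy-Schwarz against the traceless part of the rank-one matrix \<open>v v\<^sup>T\<close>.\<close>

lemma traceless_form_bound:
  fixes \<phi> :: "nat \<Rightarrow> nat \<Rightarrow> real"
  assumes n: "n > 0" and tr: "(\<Sum>i<n. \<phi> i i) = 0"
  shows "(\<Sum>i<n. \<Sum>j<n. \<phi> i j * (v i * v j))\<^sup>2 \<le>
    (\<Sum>i<n. \<Sum>j<n. (\<phi> i j)\<^sup>2) * ((real n - 1) / real n) * (\<Sum>i<n. (v i)\<^sup>2)\<^sup>2"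
proof -
  define q where "q = (\<Sum>i<n. (v i)\<^sup>2)"
  define \<psi> where "\<psi> i j = v i * v j - q / n * (if i = j then 1 else 0)" for i j :: nat
  have 1: "(\<Sum>i<n. \<Sum>j<n. \<phi> i j * \<psi> i j) = (\<Sum>i<n. \<Sum>j<n. \<phi> i j * (v i * v j))"
  proof -
    have "(\<Sum>i<n. \<Sum>j<n. \<phi> i j * \<psi> i j) = (\<Sum>i<n. (\<Sum>j<n. \<phi> i j * (v i * v j)) - q / n * \<phi> i i)"
    proof (intro sum.cong refl)
      fix i assume "i \<in> {..<n}"
      have "(\<Sum>j<n. \<phi> i j * \<psi> i j) = (\<Sum>j<n. \<phi> i j * (v i * v j)) - q / n * (\<Sum>j<n. \<phi> i j * (if i = j then 1 else 0))"
        by (simp add: \<psi>_def sum_subtractf[symmetric] sum_distrib_left algebra_simps)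
      then show "(\<Sum>j<n. \<phi> i j * \<psi> i j) = (\<Sum>j<n. \<phi> i j * (v i * v j)) - q / n * \<phi> i i"
        using \<open>i \<in> _\<close> by (simp only: sum_kronecker lessThan_iff)
    qed
    moreover have "(\<Sum>i<n. q / n * \<phi> i i) = q / n * (\<Sum>i<n. \<phi> i i)" by (rule sum_distrib_left[symmetric])
    ultimately show ?thesis unfolding sum_subtractf tr by simp
  qed
  have 2: "(\<Sum>i<n. \<Sum>j<n. (\<psi> i j)\<^sup>2) = q\<^sup>2 * ((real n - 1) / real n)"
  proof -
    have e: "(\<psi> i j)\<^sup>2 = (v i)\<^sup>2 * (v j)\<^sup>2 - (2 * (q / n) * (v i * v j)) * (if i = j then 1 else 0)
        + (q / n)\<^sup>2 * (if i = j then 1 else 0)" for i j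
      by (simp add: \<psi>_def power2_eq_square algebra_simps)
    have "(\<Sum>i<n. \<Sum>j<n. (\<psi> i j)\<^sup>2) = (\<Sum>i<n. (v i)\<^sup>2 * q - 2 * (q / n) * (v i)\<^sup>2 + (q / n)\<^sup>2)"
    proof (intro sum.cong refl)
      fix i assume i: "i \<in> {..<n}"
      have "(\<Sum>j<n. (\<psi> i j)\<^sup>2) = (v i)\<^sup>2 * q - 2 * (q / n) * (v i * v i) + (q / n)\<^sup>2"
        using i unfolding e sum.distrib sum_subtractf
        by (simp only: sum_kronecker lessThan_iff) (simp add: q_def sum_distrib_left)
      then show "(\<Sum>j<n. (\<psi> i j)\<^sup>2) = (v i)\<^sup>2 * q - 2 * (q / n) * (v i)\<^sup>2 + (q / n)\<^sup>2"
        by (simp add: power2_eq_square)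
    qed
    also have "\<dots> = q * q - 2 * (q / n) * q + n * (q / n)\<^sup>2"
      unfolding sum.distrib sum_subtractf sum_distrib_left[symmetric] sum_distrib_right[symmetric] q_def[symmetric]
      by simp
    also have "\<dots> = q\<^sup>2 * ((real n - 1) / real n)"
      using n by (simp add: field_simps power2_eq_square)
    finally show ?thesis .
  qed
  have "(\<Sum>p\<in>{..<n}\<times>{..<n}. \<phi> (fst p) (snd p) * \<psi> (fst p) (snd p))\<^sup>2 \<le>
     (\<Sum>p\<in>{..<n}\<times>{..<n}. (\<phi> (fst p) (snd p))\<^sup>2) * (\<Sum>p\<in>{..<n}\<times>{..<n}. (\<psi> (fst p) (snd p))\<^sup>2)"
    by (rule Cauchy_Schwarz_ineq_sum)
  then show ?thesis
    by (simp add: sum.cartesian_product' 1[symmetric] 2[symmetric] mult.assoc mult.commute[of "_ / _"] flip: q_def)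
       (simp add: 1 2 mult.commute)
qed

text \<open>No diagonalization: the preceding bound says \<phi> <= (n - 1) t I as quadratic forms.
  Conjugating with m = \<phi> + t I and taking traces gives tr (\<phi> m^2) <= (n - 1) t tr (m^2),
  which by n (n - 1) t^2 = N reduces to tr (\<phi>^3) <= (n - 2) t N. The values (n - 1) t and - t
  are the eigenvalues of the extremal \<phi>, for which (\<phi> - (n - 1) t I) m^2 = 0.\<close>

lemma okumura_upper:
  fixes \<phi> :: "nat \<Rightarrow> nat \<Rightarrow> real"
  assumes n: "n \<ge> 2" and tr: "(\<Sum>i<n. \<phi> i i) = 0" and sym: "\<And>i j. i < n \<Longrightarrow> j < n \<Longrightarrow> \<phi> i j = \<phi> j i"
  defines "N \<equiv> (\<Sum>i<n. \<Sum>j<n. (\<phi> i j)\<^sup>2)"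
  shows "(\<Sum>i<n. \<Sum>j<n. \<Sum>k<n. \<phi> i j * \<phi> j k * \<phi> k i) \<le> (real n - 2) / sqrt (real n * (real n - 1)) * (N * sqrt N)"
proof -
  define t where "t = sqrt N / sqrt (real n * (real n - 1))"
  have N: "N \<ge> 0" unfolding N_def by (intro sum_nonneg) auto
  have nn: "real n * (real n - 1) > 0" using n by auto
  have t2: "real n * (real n - 1) * t\<^sup>2 = N"
    using N nn unfolding t_def power_divide by (simp only: real_sqrt_pow2) auto
  have t0: "t \<ge> 0" using N nn by (simp add: t_def)
  define m where "m i j = \<phi> i j + t * (if i = j then 1 else 0)" for i j :: nat
  have form: "(\<Sum>i<n. \<Sum>j<n. \<phi> i j * (v i * v j)) \<le> (real n - 1) * t * (\<Sum>i<n. (v i)\<^sup>2)" for v :: "nat \<Rightarrow> real"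
  proof (rule power2_le_imp_le)
    have "N * ((real n - 1) / real n) = ((real n - 1) * t)\<^sup>2"
      using t2 n by (simp add: field_simps power2_eq_square)
    then show "(\<Sum>i<n. \<Sum>j<n. \<phi> i j * (v i * v j))\<^sup>2 \<le> ((real n - 1) * t * (\<Sum>i<n. (v i)\<^sup>2))\<^sup>2"
      using traceless_form_bound[of n \<phi> v] tr n by (simp add: N_def[symmetric] power_mult_distrib)
    show "0 \<le> (real n - 1) * t * (\<Sum>i<n. (v i)\<^sup>2)"
      using t0 n by (intro mult_nonneg_nonneg sum_nonneg) auto
  qed
  \<comment> \<open>The columns of m serve as test vectors; summing over them produces the two
    traces.\<close>
  have "(\<Sum>k<n. \<Sum>i<n. \<Sum>j<n. \<phi> i j * (m i k * m j k)) \<le> (\<Sum>k<n. (real n - 1) * t * (\<Sum>i<n. (m i k)\<^sup>2))"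
    by (intro sum_mono form)
  moreover have "(\<Sum>k<n. (real n - 1) * t * (\<Sum>i<n. (m i k)\<^sup>2)) = (real n - 1) * t * (N + real n * t\<^sup>2)"
  proof -
    have e: "(m i k)\<^sup>2 = (\<phi> i k)\<^sup>2 + (2 * t * \<phi> i k) * (if i = k then 1 else 0) + t\<^sup>2 * (if i = k then 1 else 0)" for i k
      by (simp add: m_def power2_eq_square algebra_simps)
    have "(\<Sum>i<n. (m i k)\<^sup>2) = (\<Sum>i<n. (\<phi> i k)\<^sup>2) + 2 * t * \<phi> k k + t\<^sup>2" if "k < n" for k
      unfolding e sum.distrib using that by (simp only: sum_kronecker)
    then have "(\<Sum>k<n. \<Sum>i<n. (m i k)\<^sup>2) = (\<Sum>k<n. (\<Sum>i<n. (\<phi> i k)\<^sup>2) + 2 * t * \<phi> k k + t\<^sup>2)"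
      by (intro sum.cong) auto
    also have "\<dots> = (\<Sum>k<n. \<Sum>i<n. (\<phi> i k)\<^sup>2) + real n * t\<^sup>2"
      by (simp add: sum.distrib sum_distrib_left[symmetric] tr)
    also have "(\<Sum>k<n. \<Sum>i<n. (\<phi> i k)\<^sup>2) = N" unfolding N_def by (rule sum.swap)
    finally show ?thesis by (simp add: sum_distrib_left[symmetric])
  qed
  moreover have "(\<Sum>k<n. \<Sum>i<n. \<Sum>j<n. \<phi> i j * (m i k * m j k)) = 
      (\<Sum>i<n. \<Sum>j<n. \<Sum>k<n. \<phi> i j * \<phi> j k * \<phi> k i) + 2 * t * N"
  proof -
    have e: "(\<Sum>k<n. \<phi> i j * (m i k * m j k)) = (\<Sum>k<n. \<phi> i j * \<phi> j k * \<phi> k i) + 2 * t * (\<phi> i j)\<^sup>2 + (t\<^sup>2 * \<phi> i j) * (if i = j then 1 else 0)"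
      if i: "i < n" "j < n" for i j
    proof -
      have "(\<Sum>k<n. \<phi> i j * (m i k * m j k)) = (\<Sum>k<n. \<phi> i j * \<phi> i k * \<phi> j k + (t * \<phi> i j * \<phi> i k) * (if j = k then 1 else 0)
         + (t * \<phi> i j * \<phi> j k) * (if i = k then 1 else 0) + (t\<^sup>2 * \<phi> i j * (if j = k then 1 else 0)) * (if i = k then 1 else 0))"
        by (intro sum.cong refl) (simp add: m_def power2_eq_square algebra_simps)
      also have "\<dots> = (\<Sum>k<n. \<phi> i j * \<phi> i k * \<phi> j k) + t * \<phi> i j * \<phi> i j + t * \<phi> i j * \<phi> j i + t\<^sup>2 * \<phi> i j * (if j = i then 1 else 0)"
        unfolding sum.distrib using i by (simp only: sum_kronecker)
      also have "(\<Sum>k<n. \<phi> i j * \<phi> i k * \<phi> j k) = (\<Sum>k<n. \<phi> i j * \<phi> j k * \<phi> k i)"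
        using i sym by (intro sum.cong) auto
      finally show ?thesis using sym[OF i] by (auto simp: power2_eq_square algebra_simps)
    qed
    have "(\<Sum>k<n. \<Sum>i<n. \<Sum>j<n. \<phi> i j * (m i k * m j k)) = (\<Sum>i<n. \<Sum>j<n. \<Sum>k<n. \<phi> i j * (m i k * m j k))"
    proof -
      have "(\<Sum>k<n. \<Sum>i<n. \<Sum>j<n. \<phi> i j * (m i k * m j k)) = (\<Sum>i<n. \<Sum>k<n. \<Sum>j<n. \<phi> i j * (m i k * m j k))"
        by (rule sum.swap)
      also have "\<dots> = (\<Sum>i<n. \<Sum>j<n. \<Sum>k<n. \<phi> i j * (m i k * m j k))"
        by (rule sum.cong[OF refl], rule sum.swap)
      finally show ?thesis .
    qed
    also have "\<dots> = (\<Sum>i<n. \<Sum>j<n. (\<Sum>k<n. \<phi> i j * \<phi> j k * \<phi> k i) + 2 * t * (\<phi> i j)\<^sup>2 + (t\<^sup>2 * \<phi> i j) * (if i = j then 1 else 0))"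
      by (intro sum.cong refl e) auto
    also have "\<dots> = (\<Sum>i<n. \<Sum>j<n. \<Sum>k<n. \<phi> i j * \<phi> j k * \<phi> k i) + 2 * t * N
        + (\<Sum>i<n. \<Sum>j<n. (t\<^sup>2 * \<phi> i j) * (if i = j then 1 else 0))"
      by (simp only: sum.distrib N_def sum_distrib_left)
    also have "(\<Sum>i<n. \<Sum>j<n. (t\<^sup>2 * \<phi> i j) * (if i = j then 1 else 0)) = (\<Sum>i<n. t\<^sup>2 * \<phi> i i)"
      by (intro sum.cong refl) (simp only: sum_kronecker lessThan_iff)
    also have "\<dots> = 0" by (simp add: sum_distrib_left[symmetric] tr)
    finally show ?thesis by simp
  qed
  ultimately have "(\<Sum>i<n. \<Sum>j<n. \<Sum>k<n. \<phi> i j * \<phi> j k * \<phi> k i) + 2 * t * N \<le> (real n - 1) * t * N + t * (real n * (real n - 1) * t\<^sup>2)"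
    by (simp add: algebra_simps)
  then have "(\<Sum>i<n. \<Sum>j<n. \<Sum>k<n. \<phi> i j * \<phi> j k * \<phi> k i) \<le> (real n - 2) * (t * N)"
    unfolding t2 by (simp add: algebra_simps)
  then show ?thesis by (simp add: t_def mult.commute[of "sqrt N"])
qed

lemma okumura:
  fixes \<phi> :: "nat \<Rightarrow> nat \<Rightarrow> real"
  assumes n: "n \<ge> 2" and tr: "(\<Sum>i<n. \<phi> i i) = 0" and sym: "\<And>i j. i < n \<Longrightarrow> j < n \<Longrightarrow> \<phi> i j = \<phi> j i"
  defines "N \<equiv> (\<Sum>i<n. \<Sum>j<n. (\<phi> i j)\<^sup>2)"
  shows "\<bar>\<Sum>i<n. \<Sum>j<n. \<Sum>k<n. \<phi> i j * \<phi> j k * \<phi> k i\<bar> \<le> (real n - 2) / sqrt (real n * (real n - 1)) * (N * sqrt N)"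
proof -
  have "(\<Sum>i<n. \<Sum>j<n. \<Sum>k<n. (- \<phi> i j) * (- \<phi> j k) * (- \<phi> k i)) \<le> (real n - 2) / sqrt (real n * (real n - 1)) * (N * sqrt N)"
    using okumura_upper[OF n, of "\<lambda>i j. - \<phi> i j"] tr sym by (simp add: N_def sum_negf)
  then show ?thesis
    using okumura_upper[OF n, of \<phi>] tr sym by (simp add: N_def sum_negf abs_le_iff)
qed

text \<open>The factor of \<open>a\<^sub>j\<^sub>l\<close> is the commutator of the second covariant derivatives of \<open>A\<close> with indices \<open>i j i l\<close>,
  as computed from the Gauss equation.\<close>

lemma curvature_sum:
  fixes a :: "nat \<Rightarrow> nat \<Rightarrow> real"
  assumes sym: "\<And>i j. i < n \<Longrightarrow> j < n \<Longrightarrow> a i j = a j i"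
  defines "a2 \<equiv> \<lambda>i j. \<Sum>m<n. a i m * a j m"
    and "\<delta> \<equiv> \<lambda>i j :: nat. if i = j then 1 else (0::real)"
    and "S \<equiv> \<Sum>i<n. \<Sum>j<n. (a i j)\<^sup>2" and "\<tau> \<equiv> \<Sum>i<n. a i i"
  shows "(\<Sum>i<n. \<Sum>j<n. \<Sum>l<n. a j l * (k * (a j i * \<delta> i l - a i i * \<delta> j l) - (a2 j i * a i l - a2 i i * a j l)
      - (k * (\<delta> j i * a i l - \<delta> i i * a j l) - (a j i * a2 i l - a i i * a2 j l))))
    = k * (real n * S - \<tau>\<^sup>2) + S\<^sup>2 - \<tau> * (\<Sum>j<n. \<Sum>l<n. a j l * a2 j l)"
proof -
  define T where "T = (\<Sum>j<n. \<Sum>l<n. a j l * a2 j l)"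
  define U where "U = (\<Sum>i<n. \<Sum>j<n. a2 i j * a2 i j)"
  have a2s: "a2 i j = a2 j i" for i j by (simp add: a2_def mult.commute)
  have S: "S = (\<Sum>i<n. a2 i i)" by (simp add: S_def a2_def power2_eq_square)
  note d = sum_kronecker
  have 1: "(\<Sum>i<n. \<Sum>j<n. \<Sum>l<n. (a j l * a j i) * \<delta> i l) = S"
  proof -
    have "(\<Sum>i<n. \<Sum>j<n. \<Sum>l<n. (a j l * a j i) * \<delta> i l) = (\<Sum>i<n. \<Sum>j<n. a j i * a j i)"
      unfolding \<delta>_def by (intro sum.cong refl) (simp only: d lessThan_iff)
    also have "\<dots> = S" unfolding S_def by (subst sum.swap) (simp add: power2_eq_square)
    finally show ?thesis .
  qed
  have 2: "(\<Sum>i<n. \<Sum>j<n. \<Sum>l<n. (a j l * a i i) * \<delta> j l) = \<tau>\<^sup>2"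
  proof -
    have "(\<Sum>i<n. \<Sum>j<n. \<Sum>l<n. (a j l * a i i) * \<delta> j l) = (\<Sum>i<n. \<Sum>j<n. a i i * a j j)"
      unfolding \<delta>_def by (intro sum.cong refl) (simp only: d lessThan_iff mult.commute)
    also have "\<dots> = \<tau>\<^sup>2" unfolding \<tau>_def by (simp add: power2_eq_square sum_product)
    finally show ?thesis .
  qed
  have 3: "(\<Sum>i<n. \<Sum>j<n. \<Sum>l<n. a j l * (a2 j i * a i l)) = U"
  proof -
    have "(\<Sum>i<n. \<Sum>j<n. \<Sum>l<n. a j l * (a2 j i * a i l)) = (\<Sum>i<n. \<Sum>j<n. a2 i j * a2 i j)"
    proof (intro sum.cong refl)
      show "(\<Sum>l<n. a j l * (a2 j i * a i l)) = a2 i j * a2 i j" for i j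
        by (subst (2) a2_def) (simp add: sum_distrib_left a2s[of j i] mult.commute mult.left_commute)
    qed
    then show ?thesis by (simp add: U_def)
  qed
  have 4: "(\<Sum>i<n. \<Sum>j<n. \<Sum>l<n. a j l * (a2 i i * a j l)) = S\<^sup>2"
  proof -
    have "(\<Sum>i<n. \<Sum>j<n. \<Sum>l<n. a j l * (a2 i i * a j l)) = (\<Sum>i<n. a2 i i * S)"
      unfolding S_def sum_distrib_left by (intro sum.cong refl) (simp add: power2_eq_square)
    then show ?thesis by (simp add: S power2_eq_square sum_distrib_right)
  qed
  have 5: "(\<Sum>i<n. \<Sum>j<n. \<Sum>l<n. (a j l * a i l) * \<delta> j i) = S"
  proof -
    have "(\<Sum>i<n. \<Sum>j<n. \<Sum>l<n. (a j l * a i l) * \<delta> j i) = (\<Sum>i<n. \<Sum>l<n. \<Sum>j<n. (a j l * a i l) * \<delta> j i)"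
      by (rule sum.cong[OF refl], rule sum.swap)
    also have "\<dots> = (\<Sum>i<n. \<Sum>l<n. a i l * a i l)"
      unfolding \<delta>_def by (intro sum.cong refl) (simp only: d lessThan_iff)
    also have "\<dots> = S" unfolding S_def by (simp add: power2_eq_square)
    finally show ?thesis .
  qed
  have 6: "(\<Sum>i<n. \<Sum>j<n. \<Sum>l<n. a j l * (\<delta> i i * a j l)) = real n * S"
    by (simp add: \<delta>_def S_def power2_eq_square)
  have 7: "(\<Sum>i<n. \<Sum>j<n. \<Sum>l<n. a j l * (a j i * a2 i l)) = U"
  proof -
    have "(\<Sum>i<n. \<Sum>j<n. \<Sum>l<n. a j l * (a j i * a2 i l)) = (\<Sum>i<n. \<Sum>l<n. \<Sum>j<n. a j l * (a j i * a2 i l))"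
      by (rule sum.cong[OF refl], rule sum.swap)
    also have "\<dots> = (\<Sum>i<n. \<Sum>l<n. a2 i l * a2 i l)"
    proof (intro sum.cong refl)
      fix i l assume "i \<in> {..<n}" "l \<in> {..<n}"
      then have "(\<Sum>j<n. a j l * (a j i * a2 i l)) = (\<Sum>j<n. a2 i l * (a i j * a l j))"
        using sym by (intro sum.cong) auto
      also have "\<dots> = a2 i l * a2 i l"
        unfolding sum_distrib_left[symmetric] by (simp add: a2_def)
      finally show "(\<Sum>j<n. a j l * (a j i * a2 i l)) = a2 i l * a2 i l" .
    qed
    finally show ?thesis by (simp add: U_def)
  qed
  have 8: "(\<Sum>i<n. \<Sum>j<n. \<Sum>l<n. a j l * (a i i * a2 j l)) = \<tau> * T"
  proof -
    have "(\<Sum>i<n. \<Sum>j<n. \<Sum>l<n. a j l * (a i i * a2 j l)) = (\<Sum>i<n. a i i * T)"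
      unfolding T_def sum_distrib_left by (intro sum.cong refl) (rule mult.left_commute)
    then show ?thesis by (simp add: \<tau>_def sum_distrib_right)
  qed
  have "(\<Sum>i<n. \<Sum>j<n. \<Sum>l<n. a j l * (k * (a j i * \<delta> i l - a i i * \<delta> j l) - (a2 j i * a i l - a2 i i * a j l)
      - (k * (\<delta> j i * a i l - \<delta> i i * a j l) - (a j i * a2 i l - a i i * a2 j l))))
     = (\<Sum>i<n. \<Sum>j<n. \<Sum>l<n. k * ((a j l * a j i) * \<delta> i l) - k * ((a j l * a i i) * \<delta> j l)
         - a j l * (a2 j i * a i l) + a j l * (a2 i i * a j l)
         - k * ((a j l * a i l) * \<delta> j i) + k * (a j l * (\<delta> i i * a j l))
         + a j l * (a j i * a2 i l) - a j l * (a i i * a2 j l))"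
    by (intro sum.cong refl) (simp add: algebra_simps)
  \<comment> \<open>The two copies of U, the squared norm of the square of a, cancel, and so do the
    two terms k * S.\<close>
  also have "\<dots> = k * S - k * \<tau>\<^sup>2 - U + S\<^sup>2 - k * S + k * (real n * S) + U - \<tau> * T"
    unfolding sum.distrib sum_subtractf sum_distrib_left[symmetric] 1 2 3 4 5 6 7 8 ..
  finally show ?thesis by (simp add: T_def algebra_simps)
qed

text \<open>Used with \<open>\<mu> = 2\<tau> + \<alpha>\<close>, which comes from differentiating \<open>S = \<tau>\<^sup>2 + \<alpha> \<tau> - \<beta>\<close> where \<open>\<tau> = nH\<close>.\<close>

lemma gradient_bound:
  fixes b :: "nat \<Rightarrow> nat \<Rightarrow> nat \<Rightarrow> real"
  assumes S: "(\<Sum>j<n. \<Sum>k<n. (a j k)\<^sup>2) = S"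
    and grad: "\<And>i. i < n \<Longrightarrow> 2 * (\<Sum>j<n. \<Sum>k<n. a j k * b i j k) = \<mu> * t i"
    and \<mu>: "4 * S \<le> \<mu>\<^sup>2" and nz: "S \<noteq> 0 \<or> \<mu> \<noteq> 0"
  shows "(\<Sum>i<n. (t i)\<^sup>2) \<le> (\<Sum>i<n. \<Sum>j<n. \<Sum>k<n. (b i j k)\<^sup>2)"
proof -
  let ?B = "\<Sum>i<n. \<Sum>j<n. \<Sum>k<n. (b i j k)\<^sup>2" and ?t = "\<Sum>i<n. (t i)\<^sup>2"
  have S0: "S \<ge> 0" unfolding S[symmetric] by (intro sum_nonneg) auto
  have B0: "?B \<ge> 0" by (intro sum_nonneg) auto
  have t0: "?t \<ge> 0" by (intro sum_nonneg) auto
  have "\<mu>\<^sup>2 * (t i)\<^sup>2 \<le> 4 * S * (\<Sum>j<n. \<Sum>k<n. (b i j k)\<^sup>2)" if "i < n" for i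
  proof -
    have "(\<Sum>p\<in>{..<n}\<times>{..<n}. a (fst p) (snd p) * b i (fst p) (snd p))\<^sup>2 \<le>
     (\<Sum>p\<in>{..<n}\<times>{..<n}. (a (fst p) (snd p))\<^sup>2) * (\<Sum>p\<in>{..<n}\<times>{..<n}. (b i (fst p) (snd p))\<^sup>2)"
      by (rule Cauchy_Schwarz_ineq_sum)
    then have "(\<Sum>j<n. \<Sum>k<n. a j k * b i j k)\<^sup>2 \<le> S * (\<Sum>j<n. \<Sum>k<n. (b i j k)\<^sup>2)"
      by (simp add: sum.cartesian_product' S)
    moreover have "\<mu>\<^sup>2 * (t i)\<^sup>2 = 4 * (\<Sum>j<n. \<Sum>k<n. a j k * b i j k)\<^sup>2"
      using grad[OF that] by (metis (no_types, lifting) four_x_squared power_mult_distrib)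
    ultimately show ?thesis by simp
  qed
  then have "(\<Sum>i<n. \<mu>\<^sup>2 * (t i)\<^sup>2) \<le> (\<Sum>i<n. 4 * S * (\<Sum>j<n. \<Sum>k<n. (b i j k)\<^sup>2))"
    by (intro sum_mono) auto
  then have le: "\<mu>\<^sup>2 * ?t \<le> 4 * S * ?B" by (simp add: sum_distrib_left)
  \<comment> \<open>For S = 0 the bound \<open>le\<close> bounds \<mu>^2 times the sum by 0 with
    \<mu> nonzero, so the gradient vanishes; otherwise the positive factor 4 S can be
    cancelled.\<close>
  show ?thesis
  proof (cases "S = 0")
    case True
    then have "\<mu>\<^sup>2 > 0" using nz by simp
    then have "?t \<le> 0" using le True by (simp add: mult_le_0_iff)
    then show ?thesis using B0 by simp
  next
    case False
    have "4 * S * ?t \<le> 4 * S * ?B" using le mult_right_mono[OF \<mu> t0] by linarith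
    then show ?thesis using False S0 by simp
  qed
qed

text \<open>Split the matrix a as \<phi> + H I with \<phi> traceless. Then S = p^2 + n H^2 and the
  trace of the cube is W + 3 H p^2 + n H^3, so the right-hand side collapses to p^2 (k n + p^2 - n
  H^2) - n H W. Okumura's inequality bounds W, and c <= k does the rest.\<close>

lemma simons_term_bound:
  fixes a :: "nat \<Rightarrow> nat \<Rightarrow> real"
  assumes n: "n \<ge> 3" and sym: "\<And>i j. i < n \<Longrightarrow> j < n \<Longrightarrow> a i j = a j i" and "c \<le> k"
    and S: "S = (\<Sum>i<n. \<Sum>j<n. (a i j)\<^sup>2)" and \<tau>: "(\<Sum>i<n. a i i) = real n * H"
    and N: "p \<ge> 0" "p\<^sup>2 = S - real n * H\<^sup>2"
  shows "p\<^sup>2 * L_poly n c H p \<le>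
    k * (real n * S - (real n * H)\<^sup>2) + S\<^sup>2 - (real n * H) * (\<Sum>j<n. \<Sum>l<n. a j l * (\<Sum>m<n. a j m * a l m))"
proof -
  define T where "T = (\<Sum>j<n. \<Sum>l<n. a j l * (\<Sum>m<n. a j m * a l m))"
  define \<phi> where "\<phi> i j = a i j - H * (if i = j then 1 else 0)" for i j :: nat
  define W where "W = (\<Sum>i<n. \<Sum>j<n. \<Sum>k<n. \<phi> i j * \<phi> j k * \<phi> k i)"
  have tr: "(\<Sum>i<n. \<phi> i i) = 0" by (simp add: \<phi>_def sum_subtractf \<tau>)
  have \<phi>s: "\<phi> i j = \<phi> j i" if "i < n" "j < n" for i j using sym[OF that] by (simp add: \<phi>_def)
  have NN: "(\<Sum>i<n. \<Sum>j<n. (\<phi> i j)\<^sup>2) = p\<^sup>2"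
  proof -
    have e: "(\<phi> i j)\<^sup>2 = (a i j)\<^sup>2 - (2 * H * a i j) * (if i = j then 1 else 0) + H\<^sup>2 * (if i = j then 1 else 0)" for i j
      by (simp add: \<phi>_def power2_eq_square algebra_simps)
    have "(\<Sum>i<n. \<Sum>j<n. (\<phi> i j)\<^sup>2) = (\<Sum>i<n. (\<Sum>j<n. (a i j)\<^sup>2) - 2 * H * a i i + H\<^sup>2)"
      unfolding e sum.distrib sum_subtractf by (intro arg_cong2[where f = "(+)"] arg_cong2[where f = "(-)"] sum.cong refl)
        (simp_all only: sum_kronecker lessThan_iff)
    also have "\<dots> = S - 2 * H * (real n * H) + real n * H\<^sup>2"
      by (simp add: sum.distrib sum_subtractf S sum_distrib_left[symmetric] \<tau>)
    finally have "(\<Sum>i<n. \<Sum>j<n. (\<phi> i j)\<^sup>2) = S - real n * H\<^sup>2"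
      by (simp add: power2_eq_square)
    then show ?thesis using N(2) by simp
  qed
  have T: "T = W + 3 * H * p\<^sup>2 + real n * H ^ 3"
  proof -
    have e: "(\<Sum>m<n. a j m * a l m) = (\<Sum>m<n. \<phi> j m * \<phi> m l) + 2 * H * \<phi> j l + H\<^sup>2 * (if j = l then 1 else 0)"
      if "j < n" "l < n" for j l
    proof -
      have "(\<Sum>m<n. a j m * a l m) = (\<Sum>m<n. \<phi> j m * \<phi> m l + (H * \<phi> j m) * (if l = m then 1 else 0) 
        + (H * \<phi> m l) * (if j = m then 1 else 0) + (H\<^sup>2 * (if l = m then 1 else 0)) * (if j = m then 1 else 0))"
        using sym[of l] that by (intro sum.cong refl) (simp add: \<phi>_def power2_eq_square algebra_simps)
      also have "\<dots> = (\<Sum>m<n. \<phi> j m * \<phi> m l) + H * \<phi> j l + H * \<phi> j l + H\<^sup>2 * (if l = j then 1 else 0)"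
        unfolding sum.distrib using that by (simp only: sum_kronecker)
      finally show ?thesis by simp
    qed
    have e2: "a j l * (\<Sum>m<n. a j m * a l m) = \<phi> j l * (\<Sum>m<n. \<phi> j m * \<phi> m l) + 2 * H * (\<phi> j l)\<^sup>2
        + (H\<^sup>2 * \<phi> j l + H * (\<Sum>m<n. \<phi> j m * \<phi> m l) + 2 * H\<^sup>2 * \<phi> j l + H ^ 3) * (if j = l then 1 else 0)"
      if "j < n" "l < n" for j l
    proof -
      have a: "a j l = \<phi> j l + H * (if j = l then 1 else 0)" by (simp add: \<phi>_def)
      show ?thesis unfolding e[OF that] a by (simp add: power2_eq_square power3_eq_cube algebra_simps)
    qed
    have "T = (\<Sum>j<n. (\<Sum>l<n. \<phi> j l * (\<Sum>m<n. \<phi> j m * \<phi> m l)) + 2 * H * (\<Sum>l<n. (\<phi> j l)\<^sup>2)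
        + (H\<^sup>2 * \<phi> j j + H * (\<Sum>m<n. \<phi> j m * \<phi> m j) + 2 * H\<^sup>2 * \<phi> j j + H ^ 3))"
      unfolding T_def
    proof (intro sum.cong refl)
      fix j assume j: "j \<in> {..<n}"
      have "(\<Sum>l<n. a j l * (\<Sum>m<n. a j m * a l m)) = (\<Sum>l<n. \<phi> j l * (\<Sum>m<n. \<phi> j m * \<phi> m l) + 2 * H * (\<phi> j l)\<^sup>2
        + (H\<^sup>2 * \<phi> j l + H * (\<Sum>m<n. \<phi> j m * \<phi> m l) + 2 * H\<^sup>2 * \<phi> j l + H ^ 3) * (if j = l then 1 else 0))"
        using j by (intro sum.cong refl e2) auto
      also have "\<dots> = (\<Sum>l<n. \<phi> j l * (\<Sum>m<n. \<phi> j m * \<phi> m l)) + 2 * H * (\<Sum>l<n. (\<phi> j l)\<^sup>2)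
        + (H\<^sup>2 * \<phi> j j + H * (\<Sum>m<n. \<phi> j m * \<phi> m j) + 2 * H\<^sup>2 * \<phi> j j + H ^ 3)"
        using j by (simp only: sum.distrib sum_kronecker lessThan_iff flip: sum_distrib_left)
      finally show "(\<Sum>l<n. a j l * (\<Sum>m<n. a j m * a l m)) = (\<Sum>l<n. \<phi> j l * (\<Sum>m<n. \<phi> j m * \<phi> m l)) + 2 * H * (\<Sum>l<n. (\<phi> j l)\<^sup>2)
        + (H\<^sup>2 * \<phi> j j + H * (\<Sum>m<n. \<phi> j m * \<phi> m j) + 2 * H\<^sup>2 * \<phi> j j + H ^ 3)" .
    qed
    also have "\<dots> = (\<Sum>j<n. \<Sum>l<n. \<phi> j l * (\<Sum>m<n. \<phi> j m * \<phi> m l)) + 2 * H * (\<Sum>j<n. \<Sum>l<n. (\<phi> j l)\<^sup>2)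
        + H\<^sup>2 * (\<Sum>j<n. \<phi> j j) + H * (\<Sum>j<n. \<Sum>m<n. \<phi> j m * \<phi> m j) + 2 * H\<^sup>2 * (\<Sum>j<n. \<phi> j j) + real n * H ^ 3"
      by (simp only: sum.distrib sum_distrib_left) (simp add: algebra_simps)
    also have "(\<Sum>j<n. \<Sum>m<n. \<phi> j m * \<phi> m j) = p\<^sup>2"
      unfolding NN[symmetric] using \<phi>s by (intro sum.cong refl) (auto simp: power2_eq_square)
    also have "(\<Sum>j<n. \<Sum>l<n. \<phi> j l * (\<Sum>m<n. \<phi> j m * \<phi> m l)) = W"
      unfolding W_def sum_distrib_left using \<phi>s by (intro sum.cong refl) auto
    finally show ?thesis by (simp add: tr NN)
  qed
  define q where "q = (real n - 2) / sqrt (real n * (real n - 1))"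
  have "\<bar>W\<bar> \<le> q * (p\<^sup>2 * p)"
    using okumura[of n \<phi>] n tr \<phi>s N(1) unfolding W_def[symmetric] NN q_def by simp
  then have "real n * H * W \<le> real n * (\<bar>H\<bar> * (q * (p\<^sup>2 * p)))"
  proof -
    assume "\<bar>W\<bar> \<le> q * (p\<^sup>2 * p)"
    then have "\<bar>H\<bar> * \<bar>W\<bar> \<le> \<bar>H\<bar> * (q * (p\<^sup>2 * p))" by (intro mult_left_mono) auto
    moreover have "H * W \<le> \<bar>H\<bar> * \<bar>W\<bar>" by (metis abs_ge_self abs_mult)
    ultimately have "H * W \<le> \<bar>H\<bar> * (q * (p\<^sup>2 * p))" by linarith
    then have "real n * (H * W) \<le> real n * (\<bar>H\<bar> * (q * (p\<^sup>2 * p)))" by (intro mult_left_mono) auto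
    then show ?thesis by (simp add: mult.assoc)
  qed
  moreover have "c * (real n * p\<^sup>2) \<le> k * (real n * p\<^sup>2)" using assms(3) by (intro mult_right_mono) auto
  moreover have "p\<^sup>2 * L_poly n c H p = p\<^sup>2 * p\<^sup>2 - real n * (\<bar>H\<bar> * (q * (p\<^sup>2 * p))) + c * (real n * p\<^sup>2) - real n * H\<^sup>2 * p\<^sup>2"
    by (simp add: L_poly_def q_def power2_eq_square algebra_simps)
  moreover have "k * (real n * S - (real n * H)\<^sup>2) + S\<^sup>2 - (real n * H) * T
    = k * (real n * p\<^sup>2) + p\<^sup>2 * p\<^sup>2 - real n * H\<^sup>2 * p\<^sup>2 - real n * H * W"
  proof -
    have "S = p\<^sup>2 + real n * H\<^sup>2" using N(2) by simp
    then show ?thesis unfolding T by (simp add: power2_eq_square power3_eq_cube algebra_simps)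
  qed
  ultimately show ?thesis unfolding T_def by linarith
qed

section \<open>Simons' formula\<close>

context hypersurface
begin

definition smooth_endo :: "('a \<Rightarrow> 'a \<Rightarrow> 'a) \<Rightarrow> bool" where
  "smooth_endo T \<longleftrightarrow> (\<forall>x\<in>V. linear (T x)) \<and> (\<forall>v. smooth_on V (\<lambda>x. T x v))"

definition nabla :: "('a \<Rightarrow> 'a \<Rightarrow> 'a) \<Rightarrow> 'a \<Rightarrow> 'a \<Rightarrow> 'a \<Rightarrow> 'a" where
  "nabla T x u v = dd (\<lambda>y. T y v) x u + \<gamma> x u (T x v) - T x (\<gamma> x u v)"

text \<open>The second covariant derivative with w as outer and u as inner direction. For fixed u,
  \<open>nabla T y u\<close> is again a field of endomorphisms, so \<open>nabla\<close> applies once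
  more; the subtracted term corrects for u being constant only in coordinates.\<close>

definition nabla2 :: "('a \<Rightarrow> 'a \<Rightarrow> 'a) \<Rightarrow> 'a \<Rightarrow> 'a \<Rightarrow> 'a \<Rightarrow> 'a \<Rightarrow> 'a" where
  "nabla2 T x w u v = nabla (\<lambda>y. nabla T y u) x w v - nabla T x (\<gamma> x w u) v"

lemma endo_linear: "smooth_endo T \<Longrightarrow> x \<in> V \<Longrightarrow> linear (T x)"
  and endo_smooth: "smooth_endo T \<Longrightarrow> smooth_on V (\<lambda>x. T x v)"
  and endo_diff: "smooth_endo T \<Longrightarrow> x \<in> V \<Longrightarrow> (\<lambda>x. T x v) differentiable (at x)"
  by (auto simp: smooth_endo_def intro: smooth_on_differentiable)

lemma smooth_endo_A: "smooth_endo A"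
  by (simp add: smooth_endo_def linear_A smooth_A)

lemma smooth_endo_nabla:
  assumes "smooth_endo T" shows "smooth_endo (\<lambda>x. nabla T x u)"
  unfolding smooth_endo_def
proof (intro conjI ballI allI)
  fix x assume x: "x \<in> V"
  note b = g.chr_bilinear[OF x] and l = endo_linear[OF assms x]
  have d: "linear (\<lambda>v. dd (\<lambda>y. T y v) x u)"
    by (rule linear_dd_param[OF open_V x]) (auto intro: endo_linear endo_diff assms x)
  show "linear (nabla T x u)"
    by (rule linearI) (simp_all add: nabla_def bilinear_radd[OF b] bilinear_rmul[OF b] linear_add[OF l] linear_scale[OF l]
        linear_add[OF d] linear_scale[OF d] algebra_simps)
next
  fix v
  show "smooth_on V (\<lambda>x. nabla T x u v)"
    unfolding nabla_def
  proof (intro smooth_on_diff smooth_on_add open_V smooth_on_dd endo_smooth[OF assms])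
    show "smooth_on V (\<lambda>x. \<gamma> x u (T x v))"
      by (rule smooth_on_apply[OF open_V g.chr_linear g.smooth_chr endo_smooth[OF assms]])
    show "smooth_on V (\<lambda>x. T x (\<gamma> x u v))"
      by (rule smooth_on_apply[OF open_V endo_linear[OF assms] endo_smooth[OF assms] g.smooth_chr])
  qed
qed

lemma dd_endo:
  assumes T: "smooth_endo T" and x: "x \<in> V" and w: "w differentiable (at x)"
  shows "dd (\<lambda>y. T y (w y)) x u = nabla T x u (w x) - \<gamma> x u (T x (w x)) + T x (dd w x u + \<gamma> x u (w x))"
  using dd_eq[OF has_derivative_apply[OF open_V x endo_linear[OF T] endo_diff[OF T x] w]]
  by (simp add: nabla_def linear_add[OF endo_linear[OF T x]])

lemma differentiable_endo:
  assumes T: "smooth_endo T" and x: "x \<in> V" and w: "w differentiable (at x)"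
  shows "(\<lambda>y. T y (w y)) differentiable (at x)"
  using differentiableI[OF has_derivative_apply[OF open_V x endo_linear[OF T] endo_diff[OF T x] w]] .

text \<open>The connection terms form the commutator of the composition of S and T with
  \<open>\<gamma> x u\<close>, whose trace is zero. So ordinary and covariant derivatives of a trace
  agree.\<close>

lemma nabla_trace_compose:
  assumes S: "smooth_endo S" and T: "smooth_endo T" and x: "x \<in> V"
  shows "dd (\<lambda>y. trace_of (\<lambda>v. S y (T y v))) x u = trace_of (\<lambda>v. nabla S x u (T x v)) + trace_of (\<lambda>v. S x (nabla T x u v))"
proof -
  note l = endo_linear[OF S x] and lT = endo_linear[OF T x] and lg = g.chr_linear[OF x]
  have "((\<lambda>y. trace_of (\<lambda>v. S y (T y v))) has_derivative
      (\<lambda>u. \<Sum>b\<in>Basis. dd (\<lambda>y. S y (T y b)) x u \<bullet> b)) (at x)"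
    unfolding trace_of_def
    by (intro has_derivative_sum has_derivative_inner_left has_derivative_dd differentiable_endo[OF S x] endo_diff[OF T x])
  from dd_eq[OF this]
  have "dd (\<lambda>y. trace_of (\<lambda>v. S y (T y v))) x u = trace_of (\<lambda>v. dd (\<lambda>y. S y (T y v)) x u)"
    by (simp add: trace_of_def)
  also have "(\<lambda>v. dd (\<lambda>y. S y (T y v)) x u) =
     (\<lambda>v. (nabla S x u (T x v) + S x (nabla T x u v)) + (S x (T x (\<gamma> x u v)) - \<gamma> x u (S x (T x v))))"
    by (rule ext, subst dd_endo[OF S x endo_diff[OF T x]])
       (simp add: nabla_def[of T] linear_add[OF l] linear_diff[OF l])
  also have "trace_of \<dots> = trace_of (\<lambda>v. nabla S x u (T x v)) + trace_of (\<lambda>v. S x (nabla T x u v))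
      + (trace_of (\<lambda>v. S x (T x (\<gamma> x u v))) - trace_of (\<lambda>v. \<gamma> x u (S x (T x v))))"
    by (simp add: trace_of_add trace_of_diff)
  also have "trace_of (\<lambda>v. S x (T x (\<gamma> x u v))) = trace_of (\<lambda>v. \<gamma> x u (S x (T x v)))"
    using trace_of_commute[OF linear_compose[OF lT l] lg, of u] by (simp add: o_def)
  finally show ?thesis by simp
qed

lemma nabla_trace:
  assumes T: "smooth_endo T" and x: "x \<in> V"
  shows "dd (\<lambda>y. trace_of (T y)) x u = trace_of (nabla T x u)"
proof -
  have I: "smooth_endo (\<lambda>x v. v)" by (simp add: smooth_endo_def smooth_on_const linear_id[unfolded id_def])
  have "nabla (\<lambda>x v. v) x u v = 0" for v by (simp add: nabla_def)
  then show ?thesis using nabla_trace_compose[OF I T x, of u] by (simp add: trace_of_def)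
qed

text \<open>The metric is parallel, so differentiating the symmetry of T leaves only its covariant
  derivatives.\<close>

lemma nabla_selfadjoint:
  assumes T: "smooth_endo T" and sa: "\<And>x u v. x \<in> V \<Longrightarrow> g x (T x u) v = g x u (T x v)" and x: "x \<in> V"
  shows "g x (nabla T x u v) w = g x v (nabla T x u w)"
proof -
  note d = endo_diff[OF T x]
  have "dd (\<lambda>y. g y (T y v) w) x u = dd (\<lambda>y. g y v (T y w)) x u"
    by (rule dd_cong[OF open_V x sa])
  then have "g x (dd (\<lambda>y. T y v) x u + \<gamma> x u (T x v)) w + g x (T x v) (\<gamma> x u w) =
     g x (\<gamma> x u v) (T x w) + g x v (dd (\<lambda>y. T y w) x u + \<gamma> x u (T x w))"
    using dd_eq[OF g.dd_metric[OF x d differentiable_const]] dd_eq[OF g.dd_metric[OF x differentiable_const d]]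
    by simp
  then show ?thesis
    by (simp add: nabla_def g.G_linear x sa[OF x, symmetric])
qed

lemma nabla2_selfadjoint:
  assumes T: "smooth_endo T" and sa: "\<And>x u v. x \<in> V \<Longrightarrow> g x (T x u) v = g x u (T x v)" and x: "x \<in> V"
  shows "g x (nabla2 T x w u v) z = g x v (nabla2 T x w u z)"
  using nabla_selfadjoint[OF smooth_endo_nabla[OF T] nabla_selfadjoint[OF T sa] x] nabla_selfadjoint[OF T sa x]
  by (simp add: nabla2_def g.G_linear x)

text \<open>Second derivatives of T v commute and the correction along \<open>\<gamma> x w u\<close>
  is symmetric. What remains are the derivatives and products of \<gamma> that make up the
  curvature, acting on T as a commutator.\<close>

lemma ricci_identity:
  assumes T: "smooth_endo T" and x: "x \<in> V"
  shows "nabla2 T x w u v - nabla2 T x u w v = riemann \<gamma> x w u (T x v) - T x (riemann \<gamma> x w u v)"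
proof -
  note l = endo_linear[OF T x] and d = endo_diff[OF T x] and lg = g.chr_linear[OF x]
  note dg = g.diff_chr[OF x]
  have e: "dd (\<lambda>y. nabla T y u v) x w = dd (\<lambda>y. dd (\<lambda>y. T y v) y u) x w
      + (dd (\<lambda>y. \<gamma> y u (T x v)) x w + \<gamma> x u (dd (\<lambda>y. T y v) x w))
      - (dd (\<lambda>y. T y (\<gamma> x u v)) x w + T x (dd (\<lambda>y. \<gamma> y u v) x w))" for u w
    unfolding nabla_def
    by (rule dd_eq, intro has_derivative_diff has_derivative_add has_derivative_dd
       smooth_on_differentiable[OF smooth_on_dd[OF endo_smooth[OF T]] x]
       has_derivative_apply[OF open_V x g.chr_linear dg d] has_derivative_apply[OF open_V x endo_linear[OF T] d dg])
  show ?thesis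
    unfolding nabla2_def nabla_def[of "\<lambda>y. nabla T y _"] e dd_commute[OF open_V x endo_smooth[OF T], of v u w]
      g.chr_sym[OF x, of w u]
    by (simp add: nabla_def riemann_def linear_add[OF l] linear_diff[OF l] linear_add[OF lg] linear_diff[OF lg])
qed

lemma nabla_A_sym: "x \<in> V \<Longrightarrow> nabla A x u v = nabla A x v u"
  using codazzi[of x v u] g.chr_sym[of x u v] by (simp add: nabla_def)

lemma nabla2_A_sym:
  assumes x: "x \<in> V" shows "nabla2 A x w u v = nabla2 A x w v u"
proof -
  have "dd (\<lambda>y. nabla A y u v) x w = dd (\<lambda>y. nabla A y v u) x w"
    by (rule dd_cong[OF open_V x nabla_A_sym])
  then show ?thesis
    by (simp add: nabla2_def nabla_def[of "\<lambda>y. nabla A y _"] nabla_A_sym[OF x, of _ "\<gamma> x w u"] nabla_A_sym[OF x, of _ "\<gamma> x w v"]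
        nabla_A_sym[OF x, of u v])
qed

text \<open>In the application these are nH and S. As traces of smooth endomorphism fields they can
  be differentiated on V.\<close>

abbreviation \<tau> where "\<tau> x \<equiv> trace_of (A x)"
abbreviation \<sigma> where "\<sigma> x \<equiv> trace_of (\<lambda>v. A x (A x v))"

definition hessian :: "('a \<Rightarrow> real) \<Rightarrow> 'a \<Rightarrow> 'a \<Rightarrow> 'a \<Rightarrow> real" where
  "hessian s x u v = dd (\<lambda>y. dd s y v) x u - dd s x (\<gamma> x u v)"

lemma d_\<tau>: "x \<in> V \<Longrightarrow> dd \<tau> x u = trace_of (nabla A x u)"
  by (rule nabla_trace[OF smooth_endo_A])

lemma d_\<sigma>: "x \<in> V \<Longrightarrow> dd \<sigma> x u = 2 * trace_of (\<lambda>v. A x (nabla A x u v))"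
  using nabla_trace_compose[OF smooth_endo_A smooth_endo_A, of x u]
    trace_of_commute[OF endo_linear[OF smooth_endo_A, of x] endo_linear[OF smooth_endo_nabla[OF smooth_endo_A], of x u]]
  by simp

lemma Hs_\<tau>: assumes x: "x \<in> V" shows "hessian \<tau> x u v = trace_of (nabla2 A x u v)"
proof -
  have "dd (\<lambda>y. dd \<tau> y v) x u = dd (\<lambda>y. trace_of (nabla A y v)) x u"
    by (rule dd_cong[OF open_V x d_\<tau>])
  also have "\<dots> = trace_of (nabla (\<lambda>y. nabla A y v) x u)"
    by (rule nabla_trace[OF smooth_endo_nabla[OF smooth_endo_A] x])
  finally show ?thesis by (simp add: hessian_def d_\<tau> x nabla2_def[abs_def] trace_of_diff)
qed

lemma Hs_\<sigma>:
  assumes x: "x \<in> V"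
  shows "hessian \<sigma> x u v = 2 * trace_of (\<lambda>w. nabla A x u (nabla A x v w)) + 2 * trace_of (\<lambda>w. A x (nabla2 A x u v w))"
proof -
  note l = endo_linear[OF smooth_endo_A x]
  let ?f = "\<lambda>y. trace_of (\<lambda>w. A y (nabla A y v w))"
  have df: "(?f has_derivative (\<lambda>u. \<Sum>b\<in>Basis. dd (\<lambda>y. A y (nabla A y v b)) x u \<bullet> b)) (at x)"
    unfolding trace_of_def
    by (intro has_derivative_sum has_derivative_inner_left has_derivative_dd differentiable_endo[OF smooth_endo_A x] 
       endo_diff[OF smooth_endo_nabla[OF smooth_endo_A] x])
  have "dd (\<lambda>y. dd \<sigma> y v) x u = dd (\<lambda>y. 2 * ?f y) x u"
    by (rule dd_cong[OF open_V x d_\<sigma>])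
  also have "\<dots> = 2 * dd ?f x u"
    using dd_eq[OF has_derivative_mult_right[OF has_derivative_dd[OF differentiableI[OF df]], of 2]] by simp
  also have "dd ?f x u = trace_of (\<lambda>w. nabla A x u (nabla A x v w)) + trace_of (\<lambda>w. A x (nabla (\<lambda>y. nabla A y v) x u w))"
    by (rule nabla_trace_compose[OF smooth_endo_A smooth_endo_nabla[OF smooth_endo_A] x])
  finally show ?thesis
    by (simp add: hessian_def d_\<sigma> x nabla2_def linear_diff[OF l] trace_of_diff algebra_simps)
qed

lemma hessian_quadratic:
  assumes x: "x \<in> V" and rel: "\<And>y. y \<in> V \<Longrightarrow> \<sigma> y = (\<tau> y)\<^sup>2 + \<alpha> * \<tau> y - \<beta>"
  shows "dd \<sigma> x u = (2 * \<tau> x + \<alpha>) * dd \<tau> x u"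
    and "hessian \<sigma> x u u = 2 * (dd \<tau> x u)\<^sup>2 + (2 * \<tau> x + \<alpha>) * hessian \<tau> x u u"
proof -
  have smooth_\<tau>: "smooth_on V \<tau>"
    unfolding trace_of_def by (intro smooth_on_sum smooth_on_linear[OF open_V bounded_linear_inner_left] open_V smooth_A)
  have d\<tau>: "(\<tau> has_derivative dd \<tau> y) (at y)" if "y \<in> V" for y
    by (intro has_derivative_dd smooth_on_differentiable[OF smooth_\<tau> that])
  have d: "dd \<sigma> y u = (2 * \<tau> y + \<alpha>) * dd \<tau> y u" if y: "y \<in> V" for y u
  proof -
    have "dd \<sigma> y u = dd (\<lambda>y. (\<tau> y)\<^sup>2 + \<alpha> * \<tau> y - \<beta>) y u"
      by (rule dd_cong[OF open_V y rel])
    also have "\<dots> = (2 * \<tau> y + \<alpha>) * dd \<tau> y u"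
      by (rule dd_eq) (rule derivative_eq_intros d\<tau>[OF y] refl | simp add: algebra_simps fun_eq_iff)+
    finally show ?thesis .
  qed
  then show "dd \<sigma> x u = (2 * \<tau> x + \<alpha>) * dd \<tau> x u" using x by blast
  have d2: "((\<lambda>y. dd \<tau> y u) has_derivative dd (\<lambda>y. dd \<tau> y u) x) (at x)"
    by (intro has_derivative_dd smooth_on_differentiable[OF smooth_on_dd[OF smooth_\<tau>] x])
  have "dd (\<lambda>y. dd \<sigma> y u) x u = dd (\<lambda>y. (2 * \<tau> y + \<alpha>) * dd \<tau> y u) x u"
    by (rule dd_cong[OF open_V x d])
  also have "\<dots> = (2 * \<tau> x + \<alpha>) * dd (\<lambda>y. dd \<tau> y u) x u + 2 * dd \<tau> x u * dd \<tau> x u"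
    by (rule dd_eq) (rule derivative_eq_intros d\<tau>[OF x] d2 refl | simp add: algebra_simps fun_eq_iff)+
  finally show "hessian \<sigma> x u u = 2 * (dd \<tau> x u)\<^sup>2 + (2 * \<tau> x + \<alpha>) * hessian \<tau> x u u"
    by (simp add: hessian_def d x power2_eq_square algebra_simps)
qed

text \<open>Applied with \<alpha> = (n - 1) a and \<beta> = n (n - 1) b. The relation
  \<open>rel\<close> is demanded on all of V because it is differentiated twice, whereas H, p and
  the frame e belong to the single point x.\<close>

theorem L_inequality:
  fixes n :: nat and c \<alpha> \<beta> H p :: real
  assumes x: "x \<in> V" and e: "orthonormal_for (g x) e" and n: "n = DIM('a)" "n \<ge> 3"
    and rel: "\<And>y. y \<in> V \<Longrightarrow> \<sigma> y = (\<tau> y)\<^sup>2 + \<alpha> * \<tau> y - \<beta>"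
    and ab: "\<alpha>\<^sup>2 + 4 * \<beta> \<ge> 0" and ck: "c \<le> k"
    and H: "\<tau> x = real n * H" and p: "p \<ge> 0" "p\<^sup>2 = \<sigma> x - real n * H\<^sup>2"
  shows "p\<^sup>2 * L_poly n c H p \<le>
    (\<Sum>i<n. \<Sum>j<n. (\<tau> x * (if i = j then 1 else 0) - h x (e i) (e j)) * hessian \<tau> x (e i) (e j))
      + \<alpha> / 2 * (\<Sum>i<n. hessian \<tau> x (e i) (e i))"
proof -
  define a where "a i j = h x (e i) (e j)" for i j
  define b where "b i j m = g x (nabla A x (e i) (e j)) (e m)" for i j m
  define cc where "cc i j m l = g x (nabla2 A x (e i) (e j) (e m)) (e l)" for i j m l
  define \<delta> where "\<delta> i j = (if i = j then 1 else 0 :: real)" for i j :: nat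
  define a2 where "a2 i j = (\<Sum>m<n. a i m * a j m)" for i j
  note bx = g.bil[OF x] and sx = g.sym[OF x]
  note EA = smooth_endo_A and EN = smooth_endo_nabla[OF smooth_endo_A]
  have gd: "g x (e i) (e j) = \<delta> i j" if "i < n" "j < n" for i j
    using e that n by (simp add: orthonormal_for_def \<delta>_def)
  have gA: "g x (A x (e i)) (e j) = a i j" for i j by (simp add: a_def g_A x)
  have gA': "g x (e i) (A x (e j)) = a i j" for i j using A_selfadjoint[OF x] gA by simp
  have as: "a i j = a j i" for i j by (simp add: a_def h_sym[OF x, of "e i"])
  have inner: "g x u v = (\<Sum>i<n. g x u (e i) * g x (e i) v)" for u v
    using orthonormal_inner[OF bx e, of u v] n by simp
  have tro: "trace_of T = (\<Sum>i<n. g x (T (e i)) (e i))" if "linear T" for T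
    using trace_of_orthonormal[OF bx e that] n by simp
  have gAA: "g x (A x (e i)) (A x (e j)) = a2 i j" for i j
    unfolding inner[of "A x (e i)"] gA gA' a2_def by (simp add: as[of _ j])
  have hA: "h x (e i) (A x (e j)) = a2 i j" for i j
    using g_A[OF x, of "e i" "A x (e j)"] gAA by simp
  have lA: "linear (A x)" and lN: "linear (nabla A x u)" for u
    using linear_A[OF x] endo_linear[OF EN x] by auto
  have lN2: "linear (nabla2 A x u v)" for u v
    unfolding nabla2_def using endo_linear[OF smooth_endo_nabla[OF EN] x] lN by (intro linear_compose_sub)
  have \<tau>: "\<tau> x = (\<Sum>i<n. a i i)" using tro[OF lA] by (simp add: gA)
  have \<sigma>: "\<sigma> x = (\<Sum>i<n. \<Sum>j<n. (a i j)\<^sup>2)"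
  proof -
    have "\<sigma> x = (\<Sum>i<n. a2 i i)"
      using tro[OF linear_compose[OF lA lA]] by (simp add: o_def flip: gAA A_selfadjoint[OF x])
    then show ?thesis by (simp add: a2_def power2_eq_square)
  qed
  have d\<sigma>: "dd \<sigma> x (e i) = 2 * (\<Sum>j<n. \<Sum>m<n. a j m * b i j m)" for i
  proof -
    have "trace_of (\<lambda>v. A x (nabla A x (e i) v)) = (\<Sum>j<n. g x (nabla A x (e i) (e j)) (A x (e j)))"
      using tro[OF linear_compose[OF lN lA]] by (simp add: o_def A_selfadjoint[OF x])
    also have "\<dots> = (\<Sum>j<n. \<Sum>m<n. a j m * b i j m)"
      unfolding inner[of "nabla A x (e i) _"] gA' b_def[symmetric]
      by (intro sum.cong refl) (simp add: as[of _ j] mult.commute as)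
    finally show ?thesis by (simp add: d_\<sigma> x)
  qed
  have bb: "trace_of (\<lambda>v. nabla A x (e i) (nabla A x (e i) v)) = (\<Sum>j<n. \<Sum>m<n. (b i j m)\<^sup>2)" for i
  proof -
    have "trace_of (\<lambda>v. nabla A x (e i) (nabla A x (e i) v)) = (\<Sum>j<n. g x (nabla A x (e i) (e j)) (nabla A x (e i) (e j)))"
      using tro[OF linear_compose[OF lN lN]] by (simp add: o_def nabla_selfadjoint[OF EA A_selfadjoint x])
    also have "\<dots> = (\<Sum>j<n. \<Sum>m<n. (b i j m)\<^sup>2)"
      unfolding inner[of "nabla A x (e i) _"] sx[of "e _"] b_def[symmetric] by (simp add: power2_eq_square)
    finally show ?thesis .
  qed
  have Ac: "trace_of (\<lambda>v. A x (nabla2 A x (e i) (e i) v)) = (\<Sum>j<n. \<Sum>l<n. a j l * cc i i j l)" for i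
  proof -
    have "trace_of (\<lambda>v. A x (nabla2 A x (e i) (e i) v)) = (\<Sum>j<n. g x (nabla2 A x (e i) (e i) (e j)) (A x (e j)))"
      using tro[OF linear_compose[OF lN2 lA]] by (simp add: o_def A_selfadjoint[OF x])
    also have "\<dots> = (\<Sum>j<n. \<Sum>l<n. a j l * cc i i j l)"
      unfolding inner[of "nabla2 A x (e i) (e i) _"] gA' cc_def[symmetric]
      by (intro sum.cong refl) (simp add: mult.commute as)
    finally show ?thesis .
  qed
  have Hc: "hessian \<tau> x (e j) (e l) = (\<Sum>i<n. cc j l i i)" for j l
    using tro[OF lN2] by (simp add: Hs_\<tau> x cc_def)
  define Ric where "Ric i j l = k * (a j i * \<delta> i l - a i i * \<delta> j l) - (a2 j i * a i l - a2 i i * a j l)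
      - (k * (\<delta> j i * a i l - \<delta> i i * a j l) - (a j i * a2 i l - a i i * a2 j l))" for i j l
  \<comment> \<open>The differentiated Codazzi equation swaps the second and third indices, the
    Ricci identity swaps the first two at the cost of \<open>Ric\<close>, and self-adjointness
    followed by Codazzi again turns j i i l into j l i i. Summed over i, this last term is the
    Hessian of nH.\<close>
  have cc: "cc i i j l = cc j l i i + Ric i j l" if ij: "i < n" "j < n" "l < n" for i j l
  proof -
    have 1: "cc i i j l = cc i j i l" by (simp add: cc_def nabla2_A_sym[OF x, of "e i" "e i" "e j"])
    have "cc i j i l - cc j i i l = g x (nabla2 A x (e i) (e j) (e i) - nabla2 A x (e j) (e i) (e i)) (e l)"
      by (simp add: cc_def g.G_linear x)
    also have "\<dots> = g x (riemann \<gamma> x (e i) (e j) (A x (e i))) (e l) - g x (riemann \<gamma> x (e i) (e j) (e i)) (A x (e l))"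
      unfolding ricci_identity[OF EA x] by (simp add: g.G_linear x A_selfadjoint)
    also have "\<dots> = Ric i j l"
      unfolding gauss_equation[OF x] Ric_def using ij
      by (simp add: g.G_linear x gA gA' gAA hA gd a_def[symmetric])
    finally have 2: "cc i j i l - cc j i i l = Ric i j l" .
    have "cc j i i l = g x (e i) (nabla2 A x (e j) (e i) (e l))"
      unfolding cc_def by (rule nabla2_selfadjoint[OF EA A_selfadjoint x])
    also have "\<dots> = cc j l i i"
      unfolding cc_def nabla2_A_sym[OF x, of "e j" "e i" "e l"] by (rule sx)
    finally show ?thesis using 1 2 by simp
  qed
  \<comment> \<open>Classically, B is |\<nabla>A|^2, D the Laplacian of nH, t the squared length of
    its gradient and E the contraction of h with its Hessian; Q collects the terms free of
    derivatives.\<close>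
  define B where "B = (\<Sum>i<n. \<Sum>j<n. \<Sum>m<n. (b i j m)\<^sup>2)"
  define D where "D = (\<Sum>i<n. hessian \<tau> x (e i) (e i))"
  define t where "t = (\<Sum>i<n. (dd \<tau> x (e i))\<^sup>2)"
  define E where "E = (\<Sum>j<n. \<Sum>l<n. a j l * hessian \<tau> x (e j) (e l))"
  define Q where "Q = k * (real n * \<sigma> x - (\<tau> x)\<^sup>2) + (\<sigma> x)\<^sup>2 - \<tau> x * (\<Sum>j<n. \<Sum>l<n. a j l * a2 j l)"
  have simons: "(\<Sum>i<n. \<Sum>j<n. \<Sum>l<n. a j l * cc i i j l) = E + Q"
  proof -
    have "(\<Sum>i<n. \<Sum>j<n. \<Sum>l<n. a j l * cc i i j l) = (\<Sum>i<n. \<Sum>j<n. \<Sum>l<n. a j l * cc j l i i + a j l * Ric i j l)"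
      by (intro sum.cong refl) (simp add: cc distrib_left)
    also have "\<dots> = (\<Sum>i<n. \<Sum>j<n. \<Sum>l<n. a j l * cc j l i i) + (\<Sum>i<n. \<Sum>j<n. \<Sum>l<n. a j l * Ric i j l)"
      by (simp only: sum.distrib)
    also have "(\<Sum>i<n. \<Sum>j<n. \<Sum>l<n. a j l * Ric i j l) = Q"
      using curvature_sum[of n a k] as unfolding Ric_def Q_def \<tau> \<sigma> a2_def \<delta>_def by simp
    also have "(\<Sum>i<n. \<Sum>j<n. \<Sum>l<n. a j l * cc j l i i) = (\<Sum>j<n. \<Sum>i<n. \<Sum>l<n. a j l * cc j l i i)"
      by (rule sum.swap)
    also have "\<dots> = (\<Sum>j<n. \<Sum>l<n. \<Sum>i<n. a j l * cc j l i i)"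
      by (rule sum.cong[OF refl], rule sum.swap)
    also have "\<dots> = E" unfolding E_def Hc sum_distrib_left ..
    finally show ?thesis .
  qed
  have "(\<Sum>i<n. hessian \<sigma> x (e i) (e i)) = (\<Sum>i<n. 2 * (\<Sum>j<n. \<Sum>m<n. (b i j m)\<^sup>2) + 2 * (\<Sum>j<n. \<Sum>l<n. a j l * cc i i j l))"
    by (simp add: Hs_\<sigma> x bb Ac)
  also have "\<dots> = 2 * B + 2 * (E + Q)"
    unfolding sum.distrib sum_distrib_left[symmetric] simons B_def ..
  finally have 1: "(\<Sum>i<n. hessian \<sigma> x (e i) (e i)) = 2 * B + 2 * (E + Q)" .
  \<comment> \<open>The Laplacian of S a second time, now from the relation. Equating it with
    Simons' formula eliminates it.\<close>
  have "(\<Sum>i<n. hessian \<sigma> x (e i) (e i)) = (\<Sum>i<n. 2 * (dd \<tau> x (e i))\<^sup>2 + (2 * \<tau> x + \<alpha>) * hessian \<tau> x (e i) (e i))"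
    by (intro sum.cong refl hessian_quadratic(2)[OF x rel])
  also have "\<dots> = 2 * t + (2 * \<tau> x + \<alpha>) * D"
    unfolding sum.distrib sum_distrib_left[symmetric] t_def D_def ..
  finally have 2: "2 * B + 2 * (E + Q) = 2 * t + (2 * \<tau> x + \<alpha>) * D" using 1 by simp
  have "(\<Sum>i<n. \<Sum>j<n. (\<tau> x * (if i = j then 1 else 0) - h x (e i) (e j)) * hessian \<tau> x (e i) (e j))
     = (\<Sum>i<n. \<Sum>j<n. (\<tau> x * hessian \<tau> x (e i) (e j)) * (if i = j then 1 else 0) - a i j * hessian \<tau> x (e i) (e j))"
    by (intro sum.cong refl) (simp add: a_def left_diff_distrib)
  also have "\<dots> = (\<Sum>i<n. \<Sum>j<n. (\<tau> x * hessian \<tau> x (e i) (e j)) * (if i = j then 1 else 0)) - E"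
    unfolding sum_subtractf E_def ..
  also have "(\<Sum>i<n. \<Sum>j<n. (\<tau> x * hessian \<tau> x (e i) (e j)) * (if i = j then 1 else 0)) = (\<Sum>i<n. \<tau> x * hessian \<tau> x (e i) (e i))"
    by (intro sum.cong refl) (simp only: sum_kronecker lessThan_iff)
  also have "\<dots> = \<tau> x * D" unfolding D_def sum_distrib_left ..
  finally have L: "(\<Sum>i<n. \<Sum>j<n. (\<tau> x * (if i = j then 1 else 0) - h x (e i) (e j)) * hessian \<tau> x (e i) (e j))
      + \<alpha> / 2 * (\<Sum>i<n. hessian \<tau> x (e i) (e i)) = \<tau> x * D - E + \<alpha> / 2 * D" by (simp add: D_def)
  show ?thesis
  proof (cases "\<sigma> x \<noteq> 0 \<or> 2 * \<tau> x + \<alpha> \<noteq> 0")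
    case True
    have "t \<le> B" unfolding t_def B_def
    proof (rule gradient_bound[OF \<sigma>[symmetric] _ _ True])
      show "2 * (\<Sum>j<n. \<Sum>k<n. a j k * b i j k) = (2 * \<tau> x + \<alpha>) * dd \<tau> x (e i)" for i
        using hessian_quadratic(1)[OF x rel, of "e i"] d\<sigma> by simp
      \<comment> \<open>By the relation the difference of the two sides is \<alpha>^2 + 4
        \<beta>.\<close>
      show "4 * \<sigma> x \<le> (2 * \<tau> x + \<alpha>)\<^sup>2"
        using ab unfolding rel[OF x] by (simp add: power2_eq_square algebra_simps)
    qed
    moreover have "p\<^sup>2 * L_poly n c H p \<le> Q"
      using simons_term_bound[OF n(2) as ck \<sigma> _ p] \<tau> H unfolding Q_def a2_def by simp
    moreover have "\<tau> x * D - E + \<alpha> / 2 * D = B - t + Q" using 2 by (simp add: field_simps)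
    ultimately show ?thesis unfolding L by linarith
  next
    case False
    have a0: "a i j = 0" if "i < n" "j < n" for i j
    proof -
      have "(\<Sum>j<n. (a i j)\<^sup>2) = 0"
        using False that unfolding \<sigma> by (subst (asm) sum_nonneg_eq_0_iff) (auto intro: sum_nonneg)
      then show ?thesis using that by (subst (asm) sum_nonneg_eq_0_iff) auto
    qed
    then have "\<tau> x = 0" by (simp add: \<tau>)
    moreover have "E = 0" by (simp add: E_def a0)
    moreover have "\<alpha> = 0" using False \<open>\<tau> x = 0\<close> by simp
    moreover have "p\<^sup>2 = 0" using False \<open>\<tau> x = 0\<close> H n p(2) by simp
    ultimately show ?thesis unfolding L by simp
  qed
qed

end

section \<open>Independence of the charts\<close>

lemma (in metric_field) restrict:
  assumes "open O'" "O' \<subseteq> Y" shows "metric_field O' G"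
  by unfold_locales (use assms bil sym nondeg smooth_on_subset[OF smooth assms(2)] in auto)

text \<open>Between equal dimensions the differential of an isometry is onto, so the tangential
  component in \<open>pullback_chr\<close> is the whole vector: isometries preserve the
  connection.\<close>

lemma isometry_chr:
  fixes \<theta> :: "'e::euclidean_space \<Rightarrow> 'e"
  assumes S: "smooth_along Y' G' O' \<theta>" and G: "metric_field O' G" and x: "x \<in> O'"
    and iso: "\<And>x u v. x \<in> O' \<Longrightarrow> G x u v = G' (\<theta> x) (dd \<theta> x u) (dd \<theta> x v)"
  shows "smooth_along.cov G' \<theta> (\<lambda>x. dd \<theta> x v) x u = dd \<theta> x (levi_civita G x u v)"
proof -
  interpret S: smooth_along Y' G' O' \<theta> by (rule S)
  interpret G: metric_field O' G by (rule G)
  have "inj (dd \<theta> x)"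
  proof (rule injI)
    fix u v assume "dd \<theta> x u = dd \<theta> x v"
    then show "u = v" by (intro G.G_eqI[OF x]) (simp add: iso[OF x])
  qed
  then have surj: "surj (dd \<theta> x)"
    using linear_injective_imp_surjective[OF S.linear_df[OF x]] by blast
  show ?thesis
  proof (rule S.G_eqI[OF S.f_into[OF x]])
    fix z
    obtain z' where z: "z = dd \<theta> x z'" using surj by (metis surjD)
    show "G' (\<theta> x) (S.cov (\<lambda>x. dd \<theta> x v) x u) z = G' (\<theta> x) (dd \<theta> x (levi_civita G x u v)) z"
      unfolding z iso[OF x, symmetric] by (rule S.pullback_chr[OF G x iso])
  qed
qed

text \<open>Covers a change of the ambient chart. The second derivative of the composition contains
  that of \<theta>, which \<open>isometry_chr\<close> absorbs into the connection.\<close>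

lemma (in smooth_along) cov_isometry:
  fixes \<theta> :: "'e \<Rightarrow> 'e"
  assumes S: "smooth_along Y' G' O' \<theta>" and O': "O' \<subseteq> Y" "f ` V \<subseteq> O'"
    and iso: "\<And>x u v. x \<in> O' \<Longrightarrow> G x u v = G' (\<theta> x) (dd \<theta> x u) (dd \<theta> x v)"
    and x: "x \<in> V"
  shows "smooth_along.cov G' (\<lambda>x. \<theta> (f x)) (\<lambda>x. dd (\<lambda>x. \<theta> (f x)) x v) x u = dd \<theta> (f x) (cov (\<lambda>x. dd f x v) x u)"
proof -
  interpret S: smooth_along Y' G' O' \<theta> by (rule S)
  have fO: "f x \<in> O'" if "x \<in> V" for x using O' that by auto
  have G: "metric_field O' G" by (rule restrict[OF S.open_V O'(1)])
  interpret C: smooth_along Y' G' V "\<lambda>x. \<theta> (f x)"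
    by unfold_locales (use S.f_into fO smooth_on_compose[OF open_V S.open_V O'(2) smooth_f S.smooth_f] open_V in auto)
  have d: "dd (\<lambda>x. \<theta> (f x)) x v = dd \<theta> (f x) (dd f x v)" if "x \<in> V" for x v
    by (rule dd_eq[OF chain[OF that S.diff_f[OF fO[OF that]]]])
  have c: "((\<lambda>y. dd \<theta> (f y) w) has_derivative (\<lambda>u. dd (\<lambda>x. dd \<theta> x w) (f x) (dd f x u))) (at x)" for w
    by (rule chain[OF x smooth_on_differentiable[OF S.smooth_df fO[OF x]]])
  have "dd (\<lambda>x. dd (\<lambda>x. \<theta> (f x)) x v) x u = dd (\<lambda>y. dd \<theta> (f y) (dd f y v)) x u"
    by (rule dd_cong[OF open_V x d])
  also have "\<dots> = dd (\<lambda>y. dd \<theta> (f y) (dd f x v)) x u + dd \<theta> (f x) (dd (\<lambda>y. dd f y v) x u)"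
    by (rule dd_eq[OF has_derivative_apply[OF open_V x S.linear_df[OF fO] differentiableI[OF c] smooth_on_differentiable[OF smooth_df x]]])
  also have "dd (\<lambda>y. dd \<theta> (f y) (dd f x v)) x u = dd (\<lambda>y. dd \<theta> y (dd f x v)) (f x) (dd f x u)"
    by (rule dd_eq[OF c])
  finally have "C.cov (\<lambda>x. dd (\<lambda>x. \<theta> (f x)) x v) x u =
      S.cov (\<lambda>y. dd \<theta> y (dd f x v)) (f x) (dd f x u) + dd \<theta> (f x) (dd (\<lambda>y. dd f y v) x u)"
    by (simp add: C.cov_def S.cov_def d x)
  then show ?thesis
    by (simp add: isometry_chr[OF S G fO[OF x] iso] cov_def linear_add[OF S.linear_df[OF fO[OF x]]])
qed

text \<open>Covers a change of chart on the hypersurface. The additional term lies in the image of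
  df, so it disappears on pairing with the normal.\<close>

lemma (in smooth_along) cov_reparam:
  fixes s :: "'c::euclidean_space \<Rightarrow> 'a"
  assumes V': "open V'" and s: "smooth_on V' s" "s ` V' \<subseteq> V" and x: "x \<in> V'"
  shows "smooth_along.cov G (\<lambda>x. f (s x)) (\<lambda>x. dd (\<lambda>x. f (s x)) x v) x u =
     cov (\<lambda>y. dd f y (dd s x v)) (s x) (dd s x u) + dd f (s x) (dd (\<lambda>x. dd s x v) x u)"
proof -
  have sV: "s x \<in> V" if "x \<in> V'" for x using s that by auto
  interpret C: smooth_along Y G V' "\<lambda>x. f (s x)"
    by unfold_locales (use f_into sV smooth_on_compose[OF V' open_V s(2) s(1) smooth_f] V' in auto)
  have ch: "((\<lambda>y. h (s y)) has_derivative (\<lambda>u. dd h (s x) (dd s x u))) (at x)"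
    if "x \<in> V'" "h differentiable (at (s x))" for x and h :: "'a \<Rightarrow> 'e"
    using diff_chain_at[OF has_derivative_dd[OF smooth_on_differentiable[OF s(1) that(1)]] has_derivative_dd[OF that(2)]]
    by (simp add: o_def)
  have d: "dd (\<lambda>x. f (s x)) x v = dd f (s x) (dd s x v)" if "x \<in> V'" for x v
    by (rule dd_eq[OF ch[OF that diff_f[OF sV[OF that]]]])
  have c: "((\<lambda>y. dd f (s y) w) has_derivative (\<lambda>u. dd (\<lambda>x. dd f x w) (s x) (dd s x u))) (at x)" for w
    by (rule ch[OF x smooth_on_differentiable[OF smooth_df sV[OF x]]])
  have "dd (\<lambda>x. dd (\<lambda>x. f (s x)) x v) x u = dd (\<lambda>y. dd f (s y) (dd s y v)) x u"
    by (rule dd_cong[OF V' x d])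
  also have "\<dots> = dd (\<lambda>y. dd f (s y) (dd s x v)) x u + dd f (s x) (dd (\<lambda>y. dd s y v) x u)"
    by (rule dd_eq[OF has_derivative_apply[OF V' x linear_df[OF sV] differentiableI[OF c]
        smooth_on_differentiable[OF smooth_on_dd[OF s(1)] x]]])
  also have "dd (\<lambda>y. dd f (s y) (dd s x v)) x u = dd (\<lambda>y. dd f y (dd s x v)) (s x) (dd s x u)"
    by (rule dd_eq[OF c])
  finally show ?thesis by (simp add: C.cov_def cov_def d x)
qed

lemma (in hypersurface) trace_shape_operator:
  assumes x: "x \<in> V" and e: "orthonormal_for (g x) e"
  shows "trace_of (A x) = (\<Sum>i<DIM('a). h x (e i) (e i))"
    and "trace_of (\<lambda>v. A x (A x v)) = (\<Sum>i<DIM('a). \<Sum>j<DIM('a). (h x (e i) (e j))\<^sup>2)"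
proof -
  note b = g.bil[OF x]
  show "trace_of (A x) = (\<Sum>i<DIM('a). h x (e i) (e i))"
    using trace_of_orthonormal[OF b e linear_A[OF x]] by (simp add: g_A x)
  have "trace_of (\<lambda>v. A x (A x v)) = (\<Sum>i<DIM('a). g x (A x (e i)) (A x (e i)))"
    using trace_of_orthonormal[OF b e linear_compose[OF linear_A[OF x] linear_A[OF x]]] unfolding o_def A_selfadjoint[OF x, of "A x _"] by simp
  also have "\<dots> = (\<Sum>i<DIM('a). \<Sum>j<DIM('a). (h x (e i) (e j))\<^sup>2)"
  proof (rule sum.cong[OF refl])
    fix i
    have "g x (e j) (A x (e i)) = h x (e i) (e j)" for j
      unfolding g.sym[OF x, of "e j" "A x (e i)"] by (rule g_A[OF x])
    then show "g x (A x (e i)) (A x (e i)) = (\<Sum>j<DIM('a). (h x (e i) (e j))\<^sup>2)"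
      unfolding orthonormal_inner[OF b e, of "A x (e i)" "A x (e i)"] by (simp add: g_A x power2_eq_square)
  qed
  finally show "trace_of (\<lambda>v. A x (A x v)) = (\<Sum>i<DIM('a). \<Sum>j<DIM('a). (h x (e i) (e j))\<^sup>2)" .
qed

section \<open>From charts of the manifolds to the local theory\<close>

lemma chart_at:
  assumes "p \<in> points M" shows "chart_at M p \<in> charts M" "p \<in> fst (chart_at M p)"
proof -
  have "\<exists>c. c \<in> charts M \<and> p \<in> fst c" using assms by (auto simp: points_def)
  from someI_ex[OF this] show "chart_at M p \<in> charts M" "p \<in> fst (chart_at M p)"
    by (auto simp: chart_at_def)
qed

lemma chart_inv_left: "is_chart c \<Longrightarrow> p \<in> fst c \<Longrightarrow> chart_inv c (snd c p) = p"
  by (auto simp: is_chart_def homeomorphism_def)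

lemma open_chart_image:
  assumes c: "is_chart c" and W: "open W" "W \<subseteq> fst c" shows "open (snd c ` W)"
proof -
  have cont: "continuous_on (chart_image c) (chart_inv c)" and op: "open (chart_image c)"
    using c by (auto simp: is_chart_def homeomorphism_def)
  have "snd c ` W = chart_image c \<inter> chart_inv c -` W"
    using chart_inv_left[OF c] W(2) by (auto simp: chart_image_def)
  then show ?thesis using continuous_open_preimage[OF cont op W(1)] by simp
qed

lemma semi_riemannian_charts: "semi_riemannian M \<Longrightarrow> c \<in> charts M \<Longrightarrow> is_chart c"
  by (auto simp: semi_riemannian_def smooth_atlas_def)

lemma semi_riemannian_metric_field:
  assumes "semi_riemannian M" "c \<in> charts M" shows "metric_field (chart_image c) (gten M c)"
proof -
  have "\<forall>x\<in>chart_image c. bilinear (gten M c x) \<and> (\<forall>u v. gten M c x u v = gten M c x v u) \<and>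
      (\<forall>u. (\<forall>v. gten M c x u v = 0) \<longrightarrow> u = 0)" "\<forall>u v. smooth_on (chart_image c) (\<lambda>x. gten M c x u v)"
    using assms unfolding semi_riemannian_def by blast+
  moreover have "open (chart_image c)" using semi_riemannian_charts[OF assms] by (simp add: is_chart_def)
  ultimately show ?thesis unfolding metric_field_def by blast
qed

lemma transition_smooth_along:
  assumes M: "semi_riemannian M" and c: "c \<in> charts M" and d: "d \<in> charts M"
  shows "smooth_along (chart_image d) (gten M d) (snd c ` (fst c \<inter> fst d)) (transition c d)"
proof -
  interpret metric_field "chart_image d" "gten M d" by (rule semi_riemannian_metric_field[OF M d])
  show ?thesis
  proof
    show "open (snd c ` (fst c \<inter> fst d))"
      using semi_riemannian_charts[OF M c] semi_riemannian_charts[OF M d]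
      by (intro open_chart_image) (auto simp: is_chart_def)
    show "smooth_on (snd c ` (fst c \<inter> fst d)) (transition c d)"
      using M c d by (auto simp: semi_riemannian_def smooth_atlas_def)
    show "transition c d x \<in> chart_image d" if "x \<in> snd c ` (fst c \<inter> fst d)" for x
      using that chart_inv_left[OF semi_riemannian_charts[OF M c]]
      by (auto simp: transition_def chart_image_def)
  qed
qed

lemma transition_isometry:
  assumes "semi_riemannian M" "c \<in> charts M" "d \<in> charts M" "p \<in> fst c" "p \<in> fst d"
  shows "gten M c (snd c p) u v = gten M d (snd d p) (dd (transition c d) (snd c p) u) (dd (transition c d) (snd c p) v)"
  using assms unfolding semi_riemannian_def by (metis IntI)

text \<open>\<open>second_ff\<close> with the pair of charts as parameters. The original consults
  \<open>chart_at\<close> anew at every point, while this version can be followed over a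
  neighbourhood in fixed charts.\<close>

definition sff ::
  "('q, 'b::euclidean_space) semi_riem \<Rightarrow> ('p \<Rightarrow> 'q) \<Rightarrow> (('q, 'b) chart \<Rightarrow> 'p \<Rightarrow> 'b) \<Rightarrow>
   ('p, 'a::euclidean_space) chart \<Rightarrow> ('q, 'b) chart \<Rightarrow> 'p \<Rightarrow> 'a \<Rightarrow> 'a \<Rightarrow> real" where
  "sff L F N c d p u v = gten L d (snd d (F p))
     (smooth_along.cov (gten L d) (local_rep c d F) (\<lambda>x. dd (local_rep c d F) x v) (snd c p) u) (N d p)"

locale spacelike_immersion =
  fixes M :: "('p::{t2_space, second_countable_topology}, 'a::euclidean_space) semi_riem"
    and L :: "('q::{t2_space, second_countable_topology}, 'b::euclidean_space) semi_riem"
    and F :: "'p \<Rightarrow> 'q" and U :: "'p set" and N :: "('q, 'b) chart \<Rightarrow> 'p \<Rightarrow> 'b"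
  assumes L: "semi_riemannian L" and hyp: "spacelike_hypersurface M L F"
    and U: "open U" "U \<subseteq> points M" and N: "unit_normal M L F U N"
begin

lemma semi_riemannian_M: "semi_riemannian M" and image_points: "F ` points M \<subseteq> points L" and continuous_F: "continuous_on (points M) F"
  using hyp by (auto simp: spacelike_hypersurface_def riemannian_def smooth_map_def)

lemma open_points: "open (points M)"
  using semi_riemannian_charts[OF semi_riemannian_M] by (auto simp: points_def is_chart_def)

lemma is_chart_M: "c \<in> charts M \<Longrightarrow> is_chart c" and is_chart_L: "d \<in> charts L \<Longrightarrow> is_chart d"
  using semi_riemannian_charts semi_riemannian_M L by blast+

lemma open_preimage: 
  assumes "c \<in> charts M" "open O'" shows "open (fst c \<inter> F -` O')"
proof -
  have "fst c \<inter> F -` O' = fst c \<inter> (points M \<inter> F -` O')" using assms(1) by (auto simp: points_def)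
  moreover have "open (fst c)" using is_chart_M[OF assms(1)] by (simp add: is_chart_def)
  ultimately show ?thesis using continuous_open_preimage[OF continuous_F open_points assms(2)] by auto
qed

lemma open_preimage_chart: "c \<in> charts M \<Longrightarrow> d \<in> charts L \<Longrightarrow> open (fst c \<inter> F -` fst d)"
  using open_preimage is_chart_L by (simp add: is_chart_def)

lemma local_rep_smooth_along:
  assumes c: "c \<in> charts M" and d: "d \<in> charts L" and W: "open W" "W \<subseteq> fst c \<inter> F -` fst d"
  shows "smooth_along (chart_image d) (gten L d) (snd c ` W) (local_rep c d F)"
proof -
  interpret metric_field "chart_image d" "gten L d" by (rule semi_riemannian_metric_field[OF L d])
  show ?thesis
  proof
    show "open (snd c ` W)" using W by (intro open_chart_image is_chart_M c) auto
    have "smooth_on (snd c ` (fst c \<inter> F -` fst d)) (local_rep c d F)"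
      using hyp c d by (auto simp: spacelike_hypersurface_def smooth_map_def)
    then show "smooth_on (snd c ` W) (local_rep c d F)" by (rule smooth_on_subset) (use W in auto)
    show "local_rep c d F x \<in> chart_image d" if "x \<in> snd c ` W" for x
    proof -
      obtain r where r: "x = snd c r" "r \<in> W" using \<open>x \<in> snd c ` W\<close> by (rule imageE)
      then have "r \<in> fst c" "F r \<in> fst d" using W by auto
      then show ?thesis
        using r chart_inv_left[OF is_chart_M[OF c]] by (simp add: local_rep_def chart_image_def)
    qed
  qed
qed

lemma local_rep_at: "c \<in> charts M \<Longrightarrow> q \<in> fst c \<Longrightarrow> local_rep c d F (snd c q) = snd d (F q)"
  using chart_inv_left[OF is_chart_M] by (auto simp: local_rep_def)

lemma isometry:
  "c \<in> charts M \<Longrightarrow> d \<in> charts L \<Longrightarrow> q \<in> fst c \<Longrightarrow> F q \<in> fst d \<Longrightarrow>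
    gten M c (snd c q) u v = gten L d (snd d (F q)) (dd (local_rep c d F) (snd c q) u) (dd (local_rep c d F) (snd c q) v)"
  using hyp unfolding spacelike_hypersurface_def by blast

lemma normal_field:
  assumes "c \<in> charts M" "d \<in> charts L"
  shows "smooth_on (snd c ` (fst c \<inter> U \<inter> F -` fst d)) (\<lambda>x. N d (chart_inv c x))"
    and "q \<in> fst c \<Longrightarrow> q \<in> U \<Longrightarrow> F q \<in> fst d \<Longrightarrow> gten L d (snd d (F q)) (N d q) (N d q) = -1"
    and "q \<in> fst c \<Longrightarrow> q \<in> U \<Longrightarrow> F q \<in> fst d \<Longrightarrow>
      gten L d (snd d (F q)) (N d q) (dd (local_rep c d F) (snd c q) u) = 0"
proof -
  have NN: "smooth_on (snd c ` (fst c \<inter> U \<inter> F -` fst d)) (\<lambda>x. N d (chart_inv c x)) \<and>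
      (\<forall>p\<in>fst c \<inter> U \<inter> F -` fst d.
         gten L d (snd d (F p)) (N d p) (N d p) = -1 \<and>
         (\<forall>u. gten L d (snd d (F p)) (N d p) (dd (local_rep c d F) (snd c p) u) = 0))"
    using N assms unfolding unit_normal_def by blast
  show "smooth_on (snd c ` (fst c \<inter> U \<inter> F -` fst d)) (\<lambda>x. N d (chart_inv c x))" using NN by blast
  assume "q \<in> fst c" "q \<in> U" "F q \<in> fst d"
  then have "q \<in> fst c \<inter> U \<inter> F -` fst d" by blast
  from NN[THEN conjunct2, rule_format, OF this]
  show "gten L d (snd d (F q)) (N d q) (N d q) = -1"
    "gten L d (snd d (F q)) (N d q) (dd (local_rep c d F) (snd c q) u) = 0" by auto
qed

text \<open>Both coordinate changes are made at once: \<theta> \<circ> f and f' \<circ> s are the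
  same map on W in coordinates. Its covariant derivative is computed by \<open>cov_isometry\<close>
  on one side and by \<open>cov_reparam\<close> on the other.\<close>

lemma sff_invariant:
  assumes c: "c \<in> charts M" "c' \<in> charts M" and d: "d \<in> charts L" "d' \<in> charts L"
    and q: "q \<in> U" "q \<in> fst c" "q \<in> fst c'" "F q \<in> fst d" "F q \<in> fst d'"
  shows "sff L F N c' d' q (dd (transition c c') (snd c q) u) (dd (transition c c') (snd c q) v) = sff L F N c d q u v"
proof -
  define W where "W = (fst c \<inter> F -` fst d) \<inter> (fst c' \<inter> F -` fst d')"
  have W: "open W" unfolding W_def by (intro open_Int open_preimage_chart c d)
  define f where "f = local_rep c d F"
  define f' where "f' = local_rep c' d' F"
  define \<theta> where "\<theta> = transition d d'"
  define s where "s = transition c c'"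
  define x where "x = snd c q"
  interpret S: smooth_along "chart_image d" "gten L d" "snd c ` W" f
    unfolding f_def by (rule local_rep_smooth_along[OF c(1) d(1) W]) (auto simp: W_def)
  interpret S': smooth_along "chart_image d'" "gten L d'" "snd c' ` W" f'
    unfolding f'_def by (rule local_rep_smooth_along[OF c(2) d(2) W]) (auto simp: W_def)
  interpret T: smooth_along "chart_image d'" "gten L d'" "snd d ` (fst d \<inter> fst d')" \<theta>
    unfolding \<theta>_def by (rule transition_smooth_along[OF L d])
  interpret R: smooth_along "chart_image c'" "gten M c'" "snd c ` (fst c \<inter> fst c')" s
    unfolding s_def by (rule transition_smooth_along[OF semi_riemannian_M c])
  have qW: "q \<in> W" using q by (auto simp: W_def)
  then have x: "x \<in> snd c ` W" by (simp add: x_def)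
  have fW: "f (snd c r) = snd d (F r)" "f' (snd c' r) = snd d' (F r)" "s (snd c r) = snd c' r" if "r \<in> W" for r
    using that local_rep_at[OF c(1), where d = d] local_rep_at[OF c(2), where d = d'] chart_inv_left[OF is_chart_M[OF c(1)]]
    by (auto simp: W_def f_def f'_def s_def transition_def)
  have \<theta>W: "\<theta> (snd d (F r)) = snd d' (F r)" if "r \<in> W" for r
    using that chart_inv_left[OF is_chart_L[OF d(1)]] by (auto simp: W_def \<theta>_def transition_def)
  have eq: "\<theta> (f y) = f' (s y)" if "y \<in> snd c ` W" for y using that fW \<theta>W by auto
  have 1: "dd \<theta> (f x) (S.cov (\<lambda>x. dd f x v) x u) =
      smooth_along.cov (gten L d') (\<lambda>x. \<theta> (f x)) (\<lambda>x. dd (\<lambda>x. \<theta> (f x)) x v) x u"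
  proof (rule S.cov_isometry[OF T.smooth_along_axioms _ _ _ x, symmetric])
    show "snd d ` (fst d \<inter> fst d') \<subseteq> chart_image d" by (auto simp: chart_image_def)
    show "f ` snd c ` W \<subseteq> snd d ` (fst d \<inter> fst d')" using fW by (auto simp: W_def)
    show "gten L d y u v = gten L d' (\<theta> y) (dd \<theta> y u) (dd \<theta> y v)" if y: "y \<in> snd d ` (fst d \<inter> fst d')" for y u v
    proof -
      obtain r where r: "y = snd d r" "r \<in> fst d" "r \<in> fst d'" using y by auto
      have "\<theta> y = snd d' r" using r chart_inv_left[OF is_chart_L[OF d(1)]] by (simp add: \<theta>_def transition_def)
      then show ?thesis using transition_isometry[OF L d r(2,3)] r by (simp add: \<theta>_def)
    qed
  qed
  have 2: "smooth_along.cov (gten L d') (\<lambda>x. f' (s x)) (\<lambda>x. dd (\<lambda>x. f' (s x)) x v) x u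
     = S'.cov (\<lambda>y. dd f' y (dd s x v)) (s x) (dd s x u) + dd f' (s x) (dd (\<lambda>x. dd s x v) x u)"
  proof (rule S'.cov_reparam[OF S.open_V _ _ x])
    show "smooth_on (snd c ` W) s"
      by (rule smooth_on_subset[OF R.smooth_f]) (auto simp: W_def)
    show "s ` snd c ` W \<subseteq> snd c' ` W" using fW by auto
  qed
  interpret C: smooth_along "chart_image d'" "gten L d'" "snd c ` W" "\<lambda>x. \<theta> (f x)"
  proof
    show "open (snd c ` W)" by (rule S.open_V)
    show "smooth_on (snd c ` W) (\<lambda>x. \<theta> (f x))"
    proof (rule smooth_on_compose[OF S.open_V T.open_V _ S.smooth_f T.smooth_f])
      show "f ` snd c ` W \<subseteq> snd d ` (fst d \<inter> fst d')" using fW by (auto simp: W_def)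
    qed
    show "\<theta> (f y) \<in> chart_image d'" if "y \<in> snd c ` W" for y
      using that fW \<theta>W by (auto simp: chart_image_def W_def)
  qed
  interpret C': smooth_along "chart_image d'" "gten L d'" "snd c ` W" "\<lambda>x. f' (s x)"
  proof
    show "open (snd c ` W)" by (rule S.open_V)
    show "smooth_on (snd c ` W) (\<lambda>x. f' (s x))"
      using C.smooth_f smooth_on_cong[OF S.open_V, of "\<lambda>x. \<theta> (f x)" "\<lambda>x. f' (s x)"] eq by simp
    show "f' (s y) \<in> chart_image d'" if "y \<in> snd c ` W" for y
      using C.f_into[OF that] eq[OF that] by simp
  qed
  have deq: "dd (\<lambda>x. \<theta> (f x)) y v = dd (\<lambda>x. f' (s x)) y v" if "y \<in> snd c ` W" for y v
    by (rule dd_cong[OF S.open_V that eq])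
  have ddeq: "dd (\<lambda>x. dd (\<lambda>x. \<theta> (f x)) x v) x u = dd (\<lambda>x. dd (\<lambda>x. f' (s x)) x v) x u"
    by (rule dd_cong[OF S.open_V x deq])
  have "C.cov (\<lambda>x. dd (\<lambda>x. \<theta> (f x)) x v) x u = C'.cov (\<lambda>x. dd (\<lambda>x. f' (s x)) x v) x u"
    unfolding C.cov_def C'.cov_def ddeq deq[OF x] eq[OF x] ..
  then have *: "dd \<theta> (f x) (S.cov (\<lambda>x. dd f x v) x u) =
     S'.cov (\<lambda>y. dd f' y (dd s x v)) (s x) (dd s x u) + dd f' (s x) (dd (\<lambda>x. dd s x v) x u)"
    using 1 2 by simp
  have y': "snd d' (F q) \<in> chart_image d'" using q by (auto simp: chart_image_def)
  have Nd: "N d' q = dd \<theta> (snd d (F q)) (N d q)"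
    using N d q unfolding unit_normal_def \<theta>_def by blast
  have nrm: "gten L d' (snd d' (F q)) (N d' q) (dd f' (s x) w) = 0" for w
    unfolding x_def fW(3)[OF qW] f'_def by (rule normal_field(3)[OF c(2) d(2) q(3,1,5)])
  have "sff L F N c d q u v = gten L d' (snd d' (F q)) (dd \<theta> (f x) (S.cov (\<lambda>x. dd f x v) x u)) (N d' q)"
    unfolding sff_def Nd using transition_isometry[OF L d q(4,5)] fW[OF qW]
    by (simp add: f_def[symmetric] x_def \<theta>_def)
  \<comment> \<open>The term with the second derivative of s is tangential, hence orthogonal to the
    normal.\<close>
  also have "\<dots> = gten L d' (snd d' (F q)) (S'.cov (\<lambda>y. dd f' y (dd s x v)) (s x) (dd s x u)) (N d' q)"
    unfolding * using nrm S'.sym[OF y', of "N d' q"] by (simp add: S'.G_linear y')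
  also have "\<dots> = sff L F N c' d' q (dd s x u) (dd s x v)"
    using fW(3)[OF qW] by (simp add: sff_def f'_def[symmetric] x_def)
  finally show ?thesis by (simp add: s_def x_def)
qed

lemma second_ff_eq_sff: "second_ff M L F N q u v = sff L F N (chart_at M q) (chart_at L (F q)) q u v"
  if "q \<in> U"
proof -
  have q: "q \<in> points M" "F q \<in> points L" using that U image_points by auto
  interpret smooth_along "chart_image (chart_at L (F q))" "gten L (chart_at L (F q))"
    "snd (chart_at M q) ` (fst (chart_at M q) \<inter> F -` fst (chart_at L (F q)))" "local_rep (chart_at M q) (chart_at L (F q)) F"
    by (rule local_rep_smooth_along[OF chart_at(1)[OF q(1)] chart_at(1)[OF q(2)] open_preimage_chart[OF chart_at(1)[OF q(1)] chart_at(1)[OF q(2)]]]) simp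
  show ?thesis
    by (simp add: second_ff_def sff_def Let_def cov_def christoffel_eq_levi_civita local_rep_at chart_at q)
qed

lemma frame_orthonormal:
  assumes "q \<in> points M"
  shows "orthonormal_for (gten M (chart_at M q) (snd (chart_at M q) q)) (frame M q)"
proof -
  let ?c = "chart_at M q"
  have x: "snd ?c q \<in> chart_image ?c" using chart_at[OF assms] by (auto simp: chart_image_def)
  interpret metric_field "chart_image ?c" "gten M ?c"
    by (rule semi_riemannian_metric_field[OF semi_riemannian_M chart_at(1)[OF assms]])
  have "\<exists>e. orthonormal_for (gten M ?c (snd ?c q)) e"
    by (rule orthonormal_for_exists[OF bil[OF x] sym[OF x]])
       (use hyp chart_at(1)[OF assms] x in \<open>auto simp: spacelike_hypersurface_def riemannian_def\<close>)
  then have "\<exists>e. orthonormal_frame M q e" by (simp add: orthonormal_frame_def orthonormal_for_def)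
  from someI_ex[OF this] show ?thesis by (simp add: frame_def orthonormal_frame_def orthonormal_for_def)
qed

text \<open>The frame chosen at q is pushed forward by the transition map into the prescribed chart.
  Nothing is claimed about its dependence on q; traces do not see it.\<close>

lemma transported_frame:
  assumes c: "c \<in> charts M" and d: "d \<in> charts L" and q: "q \<in> U" "q \<in> fst c" "F q \<in> fst d"
  obtains e where "orthonormal_for (gten M c (snd c q)) e" "\<And>i j. h_comp M L F N q i j = sff L F N c d q (e i) (e j)"
proof
  have qp: "q \<in> points M" "F q \<in> points L" using q U image_points by auto
  let ?c = "chart_at M q" and ?d = "chart_at L (F q)"
  note cq = chart_at[OF qp(1)] and dq = chart_at[OF qp(2)]
  let ?e = "\<lambda>i. dd (transition ?c c) (snd ?c q) (frame M q i)"
  show "orthonormal_for (gten M c (snd c q)) ?e"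
    using frame_orthonormal[OF qp(1)] unfolding orthonormal_for_def transition_isometry[OF semi_riemannian_M cq(1) c cq(2) q(2)] .
  show "h_comp M L F N q i j = sff L F N c d q (?e i) (?e j)" for i j
    unfolding h_comp_def second_ff_eq_sff[OF q(1)]
    by (rule sff_invariant[symmetric]) (use c d q cq dq in auto)
qed

end

section \<open>The inequality on the hypersurface\<close>

theorem proposition3p1:
  fixes n :: nat
    and c1 c2 c a b :: real
    and L :: "('q::{t2_space, second_countable_topology}, 'b::euclidean_space) semi_riem"
    and M :: "('p::{t2_space, second_countable_topology}, 'a::euclidean_space) semi_riem"
    and F :: "'p \<Rightarrow> 'q"
    and U :: "'p set"
    and N :: "('q, 'b) chart \<Rightarrow> 'p \<Rightarrow> 'b"
    and P :: "'p \<Rightarrow> real"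
  assumes n: "n \<ge> 3" and dimM: "DIM('a) = n" and dimL: "DIM('b) = n + 1"
    and lorentz: "lorentz_space L" and symm: "locally_symmetric L"
    and K_time: "\<forall>d\<in>charts L. \<forall>y\<in>chart_image d. \<forall>u v.
        spacelike L d y u \<and> timelike L d y v \<longrightarrow> sec_curv L d y u v = - c1 / real n"
    and K_space: "\<forall>d\<in>charts L. \<forall>y\<in>chart_image d. \<forall>u v.
        spacelike L d y u \<and> spacelike L d y v \<and> nondeg_plane L d y u v \<longrightarrow>
          sec_curv L d y u v \<ge> c2"
    and c: "c = 2 * c2 + c1 / real n" and c_pos: "c > 0"
    and hyp: "spacelike_hypersurface M L F"
    and U: "open U" "U \<subseteq> points M"
    and N: "unit_normal M L F U N"
    and P: "\<forall>p\<in>U. real n * (real n - 1) * P p =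
        (real n)\<^sup>2 * (mean_curvature M L F N p)\<^sup>2 - sq_length M L F N p"
    and weingarten: "\<forall>p\<in>U. P p + a * mean_curvature M L F N p = b"
    and ab: "(real n - 1) * a\<^sup>2 + 4 * real n * b \<ge> 0"
  shows "\<forall>p\<in>U. L_op M L F N a (\<lambda>q. real n * mean_curvature M L F N q) p \<ge>
      (phi_norm M L F N p)\<^sup>2 * L_poly n c (mean_curvature M L F N p) (phi_norm M L F N p)"
proof
  fix p assume p: "p \<in> U"
  have SL: "semi_riemannian L" using lorentz by (simp add: lorentz_space_def)
  interpret HI: spacelike_immersion M L F U N
    by unfold_locales (fact SL hyp U N)+
  have pp: "p \<in> points M" "F p \<in> points L" using p U HI.image_points by auto
  define C where "C = chart_at M p"
  define D where "D = chart_at L (F p)"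
  have C: "C \<in> charts M" "p \<in> fst C" and D: "D \<in> charts L" "F p \<in> fst D"
    using chart_at[OF pp(1)] chart_at[OF pp(2)] by (auto simp: C_def D_def)
  \<comment> \<open>A neighbourhood of p on which the charts chosen at p and the normal field are
    all available; the charts chosen at other points of W may differ from C and D.\<close>
  define W where "W = fst C \<inter> F -` fst D \<inter> U"
  have W: "open W" unfolding W_def using HI.open_preimage_chart[OF C(1) D(1)] U(1) by (rule open_Int)
  define V where "V = snd C ` W"
  define f where "f = local_rep C D F"
  define g where "g = gten M C"
  define G where "G = gten L D"
  define \<nu> where "\<nu> x = N D (chart_inv C x)" for x
  define k where "k = - c1 / real n"
  define x0 where "x0 = snd C p"
  have pW: "p \<in> W" using p C D by (simp add: W_def)
  have x0: "x0 \<in> V" using pW by (simp add: V_def x0_def)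
  have fW: "f (snd C q) = snd D (F q)" "\<nu> (snd C q) = N D q" if "q \<in> W" for q
    using that HI.local_rep_at[OF C(1), where d = D] chart_inv_left[OF HI.is_chart_M[OF C(1)]]
    by (auto simp: W_def f_def \<nu>_def)
  interpret S: smooth_along "chart_image D" G V f
    unfolding G_def V_def f_def by (rule HI.local_rep_smooth_along[OF C(1) D(1) W]) (auto simp: W_def)
  have g: "metric_field V g"
    unfolding g_def
    by (rule metric_field.restrict[OF semi_riemannian_metric_field[OF HI.semi_riemannian_M C(1)] S.open_V])
       (auto simp: V_def W_def chart_image_def)
  interpret g: metric_field V g by (rule g)
  have iso: "g x u v = G (f x) (dd f x u) (dd f x v)" if x: "x \<in> V" for x u v
  proof -
    obtain q where q: "x = snd C q" "q \<in> W" using x by (auto simp: V_def)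
    then show ?thesis
      using HI.isometry[OF C(1) D(1), of q u v] fW[of q] by (auto simp: g_def G_def f_def W_def)
  qed
  have pos: "g x u u > 0" if "x \<in> V" "u \<noteq> 0" for x u
    using hyp C(1) that unfolding spacelike_hypersurface_def riemannian_def g_def V_def W_def chart_image_def
    by blast
  have \<nu>: "smooth_on V \<nu>" "x \<in> V \<Longrightarrow> G (f x) (\<nu> x) (\<nu> x) = -1" "x \<in> V \<Longrightarrow> G (f x) (\<nu> x) (dd f x u) = 0" for x u
  proof -
    note nf = HI.normal_field[OF C(1) D(1)]
    have We: "W = fst C \<inter> U \<inter> F -` fst D" by (auto simp: W_def)
    show "smooth_on V \<nu>" unfolding V_def We \<nu>_def[abs_def] by (rule nf(1))
    assume "x \<in> V"
    then obtain q where q: "x = snd C q" "q \<in> W" by (auto simp: V_def)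
    then have "q \<in> fst C" "q \<in> U" "F q \<in> fst D" by (auto simp: W_def)
    then show "G (f x) (\<nu> x) (\<nu> x) = -1" "G (f x) (\<nu> x) (dd f x u) = 0"
      using nf(2,3)[of q] unfolding q(1) fW[OF q(2)] G_def by (auto simp: f_def)
  qed
  have curvature: "S.R (f x) X Y Z = k *\<^sub>R (G (f x) Y Z *\<^sub>R X - G (f x) X Z *\<^sub>R Y)" if x: "x \<in> V" for x X Y Z
  proof (rule S.constant_curvature[OF S.f_into[OF x]])
    show "G (f x) (\<nu> x) (\<nu> x) < 0" using \<nu>(2)[OF x] by simp
    \<comment> \<open>Nonzero tangent vectors of the hypersurface are spacelike; the image of any
      basis vector provides one.\<close>
    show "G (f x) (dd f x (SOME b. b \<in> Basis)) (dd f x (SOME b. b \<in> Basis)) > 0"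
      using pos[OF x nonzero_Basis[OF SOME_Basis]] iso[OF x] by simp
    fix u v assume uv: "G (f x) u u > 0" "G (f x) v v < 0"
    then have "G (f x) u u * G (f x) v v < 0" by (rule mult_pos_neg)
    \<comment> \<open>The plane spanned by a spacelike and a timelike vector has negative
      discriminant, so the denominator of \<open>sec_curv\<close> can be cleared.\<close>
    then have "G (f x) u u * G (f x) v v - (G (f x) u v)\<^sup>2 \<noteq> 0"
      by (smt (verit) zero_le_power2)
    moreover have "sec_curv L D (f x) u v = k"
      using K_time D(1) S.f_into[OF x] uv by (simp add: spacelike_def timelike_def G_def k_def)
    ultimately show "G (f x) (S.R (f x) u v v) u = k * (G (f x) u u * G (f x) v v - (G (f x) u v)\<^sup>2)"
      by (simp add: sec_curv_def plane_disc_def curv_eq_riemann G_def[symmetric] field_simps)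
  qed
  interpret HS: hypersurface "chart_image D" G V f g \<nu> k
    by unfold_locales (use dimM dimL iso pos \<nu> curvature in auto)
  have h: "sff L F N C D q u v = HS.h (snd C q) u v" if "q \<in> W" for q u v
    using fW[OF that] by (simp add: sff_def HS.h_def flip: f_def G_def)
  \<comment> \<open>\<open>mean_curvature\<close> and \<open>sq_length\<close> depend on choices
    made separately at each q. Carrying them over to the charts C and D identifies them on all of W
    with traces of one smooth field, which is what allows them to be differentiated.\<close>
  have traces: "trace_of (HS.A (snd C q)) = real n * mean_curvature M L F N q"
    "trace_of (\<lambda>v. HS.A (snd C q) (HS.A (snd C q) v)) = sq_length M L F N q" if q: "q \<in> W" for q
  proof -
    obtain e where e: "orthonormal_for (gten M C (snd C q)) e" "\<And>i j. h_comp M L F N q i j = sff L F N C D q (e i) (e j)"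
      using HI.transported_frame[OF C(1) D(1)] q unfolding W_def by blast
    have x: "snd C q \<in> V" using q by (simp add: V_def)
    have "orthonormal_for (g (snd C q)) e" using e(1) by (simp add: g_def)
    note t = HS.trace_shape_operator[OF x this]
    show "trace_of (HS.A (snd C q)) = real n * mean_curvature M L F N q"
      using n by (simp add: t mean_curvature_def e(2) h[OF q] dimM)
    show "trace_of (\<lambda>v. HS.A (snd C q) (HS.A (snd C q) v)) = sq_length M L F N q"
      by (simp add: t sq_length_def e(2) h[OF q] dimM)
  qed
  \<comment> \<open>Two orthonormal tangent vectors span a spacelike plane, whose curvature is k by
    constancy and at least c2 by \<open>K_space\<close>. Since c = 2 * c2 - k, this gives c <=
    k.\<close>
  have kc: "c \<le> k"
  proof -
    have e: "orthonormal_for (g x0) (frame M p)"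
      using HI.frame_orthonormal[OF pp(1)] by (simp add: g_def x0_def C_def)
    define u v where "u = dd f x0 (frame M p 0)" and "v = dd f x0 (frame M p 1)"
    have uv: "G (f x0) u u = 1" "G (f x0) v v = 1" "G (f x0) u v = 0" "G (f x0) v u = 0"
      using e n dimM by (auto simp: orthonormal_for_def u_def v_def iso[OF x0, symmetric])
    have "c2 \<le> sec_curv L D (f x0) u v"
      using K_space D(1) S.f_into[OF x0] uv
      by (simp add: spacelike_def nondeg_plane_def plane_disc_def G_def)
    also have "sec_curv L D (f x0) u v = k"
      using curvature[OF x0, of u v v] uv S.f_into[OF x0]
      by (simp add: sec_curv_def plane_disc_def curv_eq_riemann G_def[symmetric] S.G_linear)
    finally show ?thesis using c by (simp add: k_def)
  qed
  have rel: "HS.\<sigma> y = (HS.\<tau> y)\<^sup>2 + (real n - 1) * a * HS.\<tau> y - real n * (real n - 1) * b" if y: "y \<in> V" for y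
  proof -
    obtain q where q: "y = snd C q" "q \<in> W" using y by (auto simp: V_def)
    then have qU: "q \<in> U" by (simp add: W_def)
    let ?H = "mean_curvature M L F N q"
    have Pq: "P q = b - a * ?H" using weingarten qU by (simp add: algebra_simps)
    have "sq_length M L F N q = (real n)\<^sup>2 * ?H\<^sup>2 - real n * (real n - 1) * (b - a * ?H)"
      using P qU unfolding Pq[symmetric] by simp
    then show ?thesis unfolding q(1) traces[OF q(2)] by (simp add: power2_eq_square algebra_simps)
  qed
  let ?f = "\<lambda>q. real n * mean_curvature M L F N q"
  have f\<tau>: "(?f \<circ> chart_inv C) y = HS.\<tau> y" if y: "y \<in> V" for y
  proof -
    obtain q where q: "y = snd C q" "q \<in> W" using y by (auto simp: V_def)
    then show ?thesis using traces[OF q(2)] chart_inv_left[OF HI.is_chart_M[OF C(1)], of q] by (simp add: W_def)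
  qed
  \<comment> \<open>The function in question agrees with \<tau> on the open set V of coordinates, so
    both derivatives taken in \<open>hess\<close> agree at x0.\<close>
  have hess: "hess_comp M ?f p i j = HS.hessian HS.\<tau> x0 (frame M p i) (frame M p j)" for i j
  proof -
    have d: "dd (?f \<circ> chart_inv C) y w = dd HS.\<tau> y w" if "y \<in> V" for y w
      by (rule dd_cong[OF S.open_V that f\<tau>])
    have "dd (\<lambda>z. dd (?f \<circ> chart_inv C) z v) x0 u = dd (\<lambda>z. dd HS.\<tau> z v) x0 u" for u v
      by (rule dd_cong[OF S.open_V x0 d])
    then show ?thesis
      using d[OF x0]
      by (simp add: hess_comp_def hess_def Let_def HS.hessian_def C_def[symmetric] x0_def[symmetric] christoffel_eq_levi_civita g_def[symmetric])
  qed
  have e: "orthonormal_for (g x0) (frame M p)"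
    using HI.frame_orthonormal[OF pp(1)] by (simp add: g_def x0_def C_def)
  have hc: "h_comp M L F N p i j = HS.h x0 (frame M p i) (frame M p j)" for i j
    using h[OF pW] by (simp add: h_comp_def HI.second_ff_eq_sff[OF p] C_def D_def x0_def)
  have \<tau>0: "HS.\<tau> x0 = real n * mean_curvature M L F N p" and \<sigma>0: "HS.\<sigma> x0 = sq_length M L F N p"
    using traces[OF pW] by (simp_all add: x0_def)
  have ab': "((real n - 1) * a)\<^sup>2 + 4 * (real n * (real n - 1) * b) \<ge> 0"
  proof -
    have "((real n - 1) * a)\<^sup>2 + 4 * (real n * (real n - 1) * b) = (real n - 1) * ((real n - 1) * a\<^sup>2 + 4 * real n * b)"
      by (simp add: power2_eq_square algebra_simps)
    then show ?thesis using ab n by simp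
  qed
  have "(phi_norm M L F N p)\<^sup>2 * L_poly n c (mean_curvature M L F N p) (phi_norm M L F N p) \<le>
    (\<Sum>i<n. \<Sum>j<n. (HS.\<tau> x0 * (if i = j then 1 else 0) - HS.h x0 (frame M p i) (frame M p j))
        * HS.hessian HS.\<tau> x0 (frame M p i) (frame M p j))
      + (real n - 1) * a / 2 * (\<Sum>i<n. HS.hessian HS.\<tau> x0 (frame M p i) (frame M p i))"
  proof (rule HS.L_inequality[OF x0 e dimM[symmetric] n rel ab' kc \<tau>0])
    show "phi_norm M L F N p \<ge> 0" by (simp add: phi_norm_def sum_nonneg)
    show "(phi_norm M L F N p)\<^sup>2 = HS.\<sigma> x0 - real n * (mean_curvature M L F N p)\<^sup>2"
      unfolding \<sigma>0 phi_norm_squared dimM ..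
  qed
  also have "\<dots> = L_op M L F N a ?f p"
    unfolding L_op_def laplacian_def hess hc \<tau>0 dimM ..
  finally show "(phi_norm M L F N p)\<^sup>2 * L_poly n c (mean_curvature M L F N p) (phi_norm M L F N p)
      \<le> L_op M L F N a ?f p" .
qed

end
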